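(* Let $n=d=3$ and let $\mathbb{F}$ be an algebraically closed field of characteristic zero. Then (a) $P_{3,3}$ is a minimal generating set for the algebra of invariants $\mathcal{O}(\mathcal{N}_3^3)^{GL_3}$; (b) $S_{3,3}$ is a minimal separating set for the algebra of invariants $\mathcal{O}(\mathcal{N}_3^3)^{GL_3}$.
   Context: $\mathcal{N}_3^3$ is the set of triples $\underline{A}=(A_1,A_2,A_3)$ of nilpotent $3\times3$ matrices over $\mathbb{F}$, with $GL_3$ acting by simultaneous conjugation $g\cdot\underline{A}=(gA_1g^{-1},gA_2g^{-1},gA_3g^{-1})$; $\mathcal{O}(\mathcal{N}_3^3)^{GL_3}$ is the algebra of $GL_3$-invariant polynomial functions on $\mathcal{N}_3^3$. $Y_k$ denotes the generic nilpotent matrix, so $\mathrm{tr}(Y_{i_1}\cdots Y_{i_r})$ is the invariant $\underline{A}\mapsto\mathrm{tr}(A_{i_1}\cdots A_{i_r})$. $S_{3,3}$ is the set consisting of: $\mathrm{tr}(Y_iY_j),\ \mathrm{tr}(Y_i^2Y_j),\ \mathrm{tr}(Y_iY_j^2),\ \mathrm{tr}(Y_i^2Y_j^2),\ \mathrm{tr}(Y_i^2Y_j^2Y_iY_j)$ for $1\le i<j\le3$; $\mathrm{tr}(Y_1Y_2Y_3)$, $\mathrm{tr}(Y_1Y_3Y_2)$; $\mathrm{tr}(Y_i^2Y_jY_k)$ for $\{i,j,k\}=\{1,2,3\}$; $\mathrm{tr}(Y_1^2Y_2Y_1Y_3)$, $\mathrm{tr}(Y_2^2Y_1Y_2Y_3)$,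 $\mathrm{tr}(Y_3^2Y_1Y_3Y_2)$ (26 elements). $P_{3,3}=S_{3,3}\sqcup P'_{3,3}$, where $P'_{3,3}$ consists of $\mathrm{tr}(Y_i^2Y_j^2Y_k)$ and $\mathrm{tr}(Y_i^2Y_j^2Y_iY_k)$ for $\{i,j,k\}=\{1,2,3\}$, and $\mathrm{tr}(Y_1^2Y_2^2Y_3^2)$ (so $|P_{3,3}|=39$). Two points $u,v$ are separated by a subset $S$ if some $f\in S$ has $f(u)\ne f(v)$, and separated if separated by the whole invariant algebra; $S$ is separating if all separated pairs are separated by $S$; minimal means minimal with respect to inclusion. A minimal generating set is a generating set no proper subset of which generates. *)

theory Defs
  imports "HOL-Analysis.Analysis" "HOL-Computational_Algebra.Polynomial"
begin

definition alg_closed :: "'a::field itself \<Rightarrow> bool" where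
  "alg_closed _ \<longleftrightarrow> (\<forall>p::'a poly. degree p > 0 \<longrightarrow> (\<exists>x. poly p x = 0))"

type_synonym 'a mat3 = "'a^3^3"
type_synonym 'a trip = "'a mat3 \<times> 'a mat3 \<times> 'a mat3"

definition Yc :: "nat \<Rightarrow> 'a trip \<Rightarrow> 'a mat3" where
  "Yc k A = (if k = 1 then fst A else if k = 2 then fst (snd A) else snd (snd A))"

fun mpow :: "'a::semiring_1 mat3 \<Rightarrow> nat \<Rightarrow> 'a mat3" where
  "mpow M 0 = mat 1"
| "mpow M (Suc k) = M ** mpow M k"

definition nilp :: "'a::semiring_1 mat3 \<Rightarrow> bool" where
  "nilp M \<longleftrightarrow> (\<exists>k. mpow M k = 0)"

definition Nil3 :: "'a::field trip set" where
  "Nil3 = {A. nilp (fst A) \<and> nilp (fst (snd A)) \<and> nilp (snd (snd A))}"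

text \<open>Simultaneous conjugation by g, where h is the inverse of g.\<close>
definition act :: "'a::field mat3 \<Rightarrow> 'a mat3 \<Rightarrow> 'a trip \<Rightarrow> 'a trip" where
  "act g h A = (g ** fst A ** h, g ** fst (snd A) ** h, g ** snd (snd A) ** h)"

definition GL3 :: "('a::field mat3 \<times> 'a mat3) set" where
  "GL3 = {(g,h). g ** h = mat 1 \<and> h ** g = mat 1}"

inductive_set polyfun :: "('a::field trip \<Rightarrow> 'a) set" where
  pconst: "(\<lambda>A. c) \<in> polyfun"
| pcoord: "k \<in> {1,2,3} \<Longrightarrow> (\<lambda>A. Yc k A $ i $ j) \<in> polyfun"
| padd: "f \<in> polyfun \<Longrightarrow> g \<in> polyfun \<Longrightarrow> (\<lambda>A. f A + g A) \<in> polyfun"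
| pmul: "f \<in> polyfun \<Longrightarrow> g \<in> polyfun \<Longrightarrow> (\<lambda>A. f A * g A) \<in> polyfun"

text \<open>Functions on N_3^3 are encoded as functions on all triples that vanish outside N_3^3.\<close>
definition onN :: "('a::field trip \<Rightarrow> 'a) \<Rightarrow> ('a trip \<Rightarrow> 'a)" where
  "onN f = (\<lambda>A. if A \<in> Nil3 then f A else 0)"

definition Oring :: "('a::field trip \<Rightarrow> 'a) set" where
  "Oring = onN ` polyfun"

definition Inv :: "('a::field trip \<Rightarrow> 'a) set" where
  "Inv = {f \<in> Oring. \<forall>(g,h)\<in>GL3. \<forall>A\<in>Nil3. f (act g h A) = f A}"

inductive_set subalg :: "('a::field trip \<Rightarrow> 'a) set \<Rightarrow> ('a trip \<Rightarrow> 'a) set" for S where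
  sgen: "f \<in> S \<Longrightarrow> f \<in> subalg S"
| sconst: "onN (\<lambda>A. c) \<in> subalg S"
| sadd: "f \<in> subalg S \<Longrightarrow> g \<in> subalg S \<Longrightarrow> (\<lambda>A. f A + g A) \<in> subalg S"
| smul: "f \<in> subalg S \<Longrightarrow> g \<in> subalg S \<Longrightarrow> (\<lambda>A. f A * g A) \<in> subalg S"

definition generating :: "('a::field trip \<Rightarrow> 'a) set \<Rightarrow> bool" where
  "generating S \<longleftrightarrow> S \<subseteq> Inv \<and> subalg S = Inv"

definition min_generating :: "('a::field trip \<Rightarrow> 'a) set \<Rightarrow> bool" where
  "min_generating S \<longleftrightarrow> generating S \<and> (\<forall>T. T \<subset> S \<longrightarrow> \<not> generating T)"

definition separated_by :: "('a::field trip \<Rightarrow> 'a) set \<Rightarrow> 'a trip \<Rightarrow> 'a trip \<Rightarrow> bool" where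
  "separated_by S u v \<longleftrightarrow> (\<exists>f\<in>S. f u \<noteq> f v)"

definition separating :: "('a::field trip \<Rightarrow> 'a) set \<Rightarrow> bool" where
  "separating S \<longleftrightarrow> S \<subseteq> Inv \<and>
     (\<forall>u\<in>Nil3. \<forall>v\<in>Nil3. separated_by Inv u v \<longrightarrow> separated_by S u v)"

definition min_separating :: "('a::field trip \<Rightarrow> 'a) set \<Rightarrow> bool" where
  "min_separating S \<longleftrightarrow> separating S \<and> (\<forall>T. T \<subset> S \<longrightarrow> \<not> separating T)"

definition wprod :: "nat list \<Rightarrow> 'a::field trip \<Rightarrow> 'a mat3" where
  "wprod w A = foldr (\<lambda>k M. Yc k A ** M) w (mat 1)"

definition trw :: "nat list \<Rightarrow> 'a::field trip \<Rightarrow> 'a" where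
  "trw w = onN (\<lambda>A. trace (wprod w A))"

definition S33_words :: "nat list set" where
  "S33_words =
     {w. \<exists>i j. i \<in> {1,2,3} \<and> j \<in> {1,2,3} \<and> i < j \<and>
          w \<in> {[i,j], [i,i,j], [i,j,j], [i,i,j,j], [i,i,j,j,i,j]}}
   \<union> {[1,2,3], [1,3,2]}
   \<union> {[i,i,j,k] | i j k. {i,j,k} = {1,2,3::nat}}
   \<union> {[1,1,2,1,3], [2,2,1,2,3], [3,3,1,3,2]}"

definition P33'_words :: "nat list set" where
  "P33'_words =
     {[i,i,j,j,k] | i j k. {i,j,k} = {1,2,3::nat}}
   \<union> {[i,i,j,j,i,k] | i j k. {i,j,k} = {1,2,3::nat}}
   \<union> {[1,1,2,2,3,3]}"

definition S33 :: "('a::field trip \<Rightarrow> 'a) set" where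
  "S33 = trw ` S33_words"

definition P33 :: "('a::field trip \<Rightarrow> 'a) set" where
  "P33 = trw ` (S33_words \<union> P33'_words)"

end

theory Submission
  imports Defs "HOL-Library.Function_Algebras"
begin

text \<open>
  Traces of words generate the invariants: if \<open>f\<close> is homogeneous of degree \<open>d\<close> and
  invariant on the nilpotent triples, then \<open>f (g A adj g) = det g ^ d * f A\<close> for every matrix
  \<open>g\<close>.  Cayley's omega operator in \<open>g\<close> turns the right-hand side into a nonzero multiple of
  \<open>f A\<close>, and the left-hand side into a sum of full contractions of \<open>A\<close> against alternating
  symbols, that is, into a polynomial in traces.  Modulo shorter words, traces satisfy the
  polarized identity \<open>x ^ 3 = 0\<close>; it makes all words of length at least 7 decomposable, and
  reduces the shorter ones to the 39 given words.

  A generator is not superfluous if two points agree on all others.  For the generators outside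
  \<open>S33\<close> there are no such points; instead, some point kills every product of other generators
  that has the same multidegree.

  For separation, suppose some \<open>tr (X ^ 2 Y)\<close> or \<open>tr (X ^ 2 Y ^ 2)\<close> is nonzero for two of the
  three matrices.  Then \<open>X\<close> is a regular nilpotent, \<open>(X, Y)\<close> has a normal form, and the
  traces in \<open>S33\<close> determine \<open>Y\<close> and the third matrix, so the triples are conjugate.  Otherwise
  all products \<open>X ^ 2 Y ^ 2\<close> vanish, and so do the generators outside \<open>S33\<close>.
\<close>

section \<open>Polarization and the alternating symbol\<close>

text \<open>The polynomial representing an invariant need not be invariant off the nilpotent cone.
  The omega operator acts on the group variable alone, so the triple stays fixed inside the cone.
  The adjugate in place of the inverse keeps everything polynomial in g, and homogeneous parts can
  be separated because the cone is stable under scaling. That the operator does not kill powers of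
  det is a positivity argument: up to sign, a positive multiple of the value is a sum of integer
  squares.

  Decomposability is tested by functionals with rational values: a trace outside the algebra admits
  a Q-linear functional that kills the algebra and is 1 on that trace. Relations between words
  become linear equations over an ordered field, which \<open>linarith\<close> can solve; the field
  of the matrices carries no order.

  Algebraic closedness provides the cube root of unity that isolates tr(X^2 Y^2).

  \<open>S33\<close> contains some words in one orientation only, while the normal form is attached
  to an arbitrary ordered pair of letters. The other orientations therefore have to be recovered
  from trace identities before the normal forms are compared.\<close>

lemma alternating_sum_supersets:
  assumes "finite J" and FJ: "F \<subseteq> J"
  shows "(\<Sum>S | S \<subseteq> J \<and> F \<subseteq> S. (-1) ^ card S) = (if J = F then (-1) ^ card J else (0::'a::comm_ring_1))"
proof -
  let ?f = "\<lambda>i::'b. (-1::'a)" and ?g = "\<lambda>i. if i \<in> F then 0 else (1::'a)"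
  \<comment> \<open>Inclusion-exclusion as one product: an element of J contributes -1 when chosen
    for S; when left out it contributes 1, or 0 if it lies in F.\<close>
  have "(\<Prod>i\<in>J. ?f i + ?g i) = (\<Sum>X\<in>Pow J. prod ?f X * prod ?g (J - X))"
    by (rule prod_add[OF assms(1)])
  also have "\<dots> = (\<Sum>X\<in>Pow J. if F \<subseteq> X then (-1) ^ card X else 0)"
  proof (rule sum.cong[OF refl])
    fix X assume "X \<in> Pow J"
    have "prod ?g (J - X) = (if F \<subseteq> X then 1 else 0)"
    proof (cases "F \<subseteq> X")
      case True
      then have "prod ?g (J - X) = prod (\<lambda>_. 1) (J - X)" by (intro prod.cong) auto
      then show ?thesis using True by simp
    next
      case False
      then obtain i where "i \<in> F" "i \<notin> X" by blast
      then show ?thesis using False FJ assms(1) by (simp, intro prod_zero) auto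
    qed
    then show "prod ?f X * prod ?g (J - X) = (if F \<subseteq> X then (-1) ^ card X else 0)"
      by simp
  qed
  also have "\<dots> = (\<Sum>S | S \<subseteq> J \<and> F \<subseteq> S. (-1) ^ card S)"
    using assms by (subst sum.inter_filter[symmetric]) (auto simp: Pow_def)
  also have "(\<Prod>i\<in>J. ?f i + ?g i) = (if J = F then (-1) ^ card J else 0)"
  proof (cases "J = F")
    case False
    then obtain i where "i \<in> J" "i \<notin> F" using FJ by blast
    then show ?thesis using False assms by (simp, intro prod_zero) auto
  qed (simp add: prod_constant)
  finally show ?thesis by simp
qed

text \<open>Permutations of J are the identity off J, while extensional functions are
  \<open>undefined\<close> there. The two conventions are exchanged, which is harmless because
  \<open>f\<close> depends only on values on J.\<close>

lemma sum_permutations_PiE: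
  assumes "finite J" and f: "\<And>p q. (\<And>j. j \<in> J \<Longrightarrow> p j = q j) \<Longrightarrow> f p = f q"
  shows "(\<Sum>p | p permutes J. f p) = (\<Sum>p | p \<in> J \<rightarrow>\<^sub>E J \<and> p ` J = J. f p)"
proof (rule sum.reindex_bij_witness[where i = "\<lambda>p x. if x \<in> J then p x else x"
      and j = "\<lambda>p. restrict p J"])
  fix p assume "p \<in> {p. p permutes J}"
  then show "(\<lambda>x. if x \<in> J then restrict p J x else x) = p"
    "restrict p J \<in> {p \<in> J \<rightarrow>\<^sub>E J. p ` J = J}"
    by (auto simp: permutes_in_image permutes_image permutes_def)
  show "f (restrict p J) = f p" by (rule f) simp
next
  fix p assume p: "p \<in> {p \<in> J \<rightarrow>\<^sub>E J. p ` J = J}"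
  then show "restrict (\<lambda>x. if x \<in> J then p x else x) J = p"
    by (auto simp: PiE_def extensional_def)
  have "inj_on p J" using p assms(1) by (simp add: eq_card_imp_inj_on)
  then have "bij_betw (\<lambda>x. if x \<in> J then p x else x) J J"
    using p by (auto simp: bij_betw_def inj_on_def)
  then show "(\<lambda>x. if x \<in> J then p x else x) \<in> {p. p permutes J}"
    by (auto intro: bij_imp_permutes)
qed

text \<open>Ryser's formula for the permanent of \<open>m\<close>. Expanding the product gives maps
  from J into S; the signed sum over all S that contain the image of a fixed map vanishes unless the
  image is J.\<close>

lemma polarization:
  fixes m :: "'b \<Rightarrow> 'b \<Rightarrow> 'a::comm_ring_1"
  assumes J: "finite J"
  shows "(\<Sum>S\<in>Pow J. (-1) ^ card S * (\<Prod>j\<in>J. \<Sum>i\<in>S. m j i))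
    = (-1) ^ card J * (\<Sum>p | p permutes J. \<Prod>j\<in>J. m j (p j))"
proof -
  have "(\<Sum>S\<in>Pow J. (-1) ^ card S * (\<Prod>j\<in>J. \<Sum>i\<in>S. m j i))
      = (\<Sum>S\<in>Pow J. \<Sum>p \<in> J \<rightarrow>\<^sub>E J. (if p ` J \<subseteq> S then (-1) ^ card S * (\<Prod>j\<in>J. m j (p j)) else 0))"
  proof (rule sum.cong[OF refl])
    fix S assume S: "S \<in> Pow J"
    then have fS: "finite S" using J finite_subset by auto
    have "(\<Prod>j\<in>J. \<Sum>i\<in>S. m j i) = (\<Sum>p \<in> J \<rightarrow>\<^sub>E S. \<Prod>j\<in>J. m j (p j))"
      using J fS by (intro prod_sum_PiE) auto
    moreover have "J \<rightarrow>\<^sub>E S = {p \<in> J \<rightarrow>\<^sub>E J. p ` J \<subseteq> S}" using S by (fastforce simp: PiE_iff extensional_def)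
    moreover have "finite (J \<rightarrow>\<^sub>E J)" using J by (intro finite_PiE) auto
    ultimately show "(-1) ^ card S * (\<Prod>j\<in>J. \<Sum>i\<in>S. m j i) =
      (\<Sum>p \<in> J \<rightarrow>\<^sub>E J. (if p ` J \<subseteq> S then (-1) ^ card S * (\<Prod>j\<in>J. m j (p j)) else 0))"
      by (subst sum.inter_filter[symmetric]) (auto simp: sum_distrib_left)
  qed
  also have "\<dots> = (\<Sum>p \<in> J \<rightarrow>\<^sub>E J. (\<Sum>S | S \<subseteq> J \<and> p ` J \<subseteq> S. (-1) ^ card S) * (\<Prod>j\<in>J. m j (p j)))"
  proof (subst sum.swap, rule sum.cong[OF refl])
    fix p
    have "(\<Sum>S\<in>Pow J. if p ` J \<subseteq> S then (-1) ^ card S * (\<Prod>j\<in>J. m j (p j)) else 0)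
       = (\<Sum>S | S \<in> Pow J \<and> p ` J \<subseteq> S. (-1) ^ card S * (\<Prod>j\<in>J. m j (p j)))"
      using J by (subst sum.inter_filter) auto
    then show "(\<Sum>S\<in>Pow J. if p ` J \<subseteq> S then (-1) ^ card S * (\<Prod>j\<in>J. m j (p j)) else 0)
       = (\<Sum>S | S \<subseteq> J \<and> p ` J \<subseteq> S. (-1) ^ card S) * (\<Prod>j\<in>J. m j (p j))"
      by (simp add: sum_distrib_right)
  qed
  also have "\<dots> = (\<Sum>p \<in> J \<rightarrow>\<^sub>E J. if p ` J = J then (-1) ^ card J * (\<Prod>j\<in>J. m j (p j)) else 0)"
    by (rule sum.cong[OF refl], subst alternating_sum_supersets[OF J]) auto
  also have "\<dots> = (\<Sum>p | p \<in> J \<rightarrow>\<^sub>E J \<and> p ` J = J. (-1) ^ card J * (\<Prod>j\<in>J. m j (p j)))"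
    using J by (subst sum.inter_filter[symmetric]) (simp_all add: finite_PiE)
  also have "\<dots> = (\<Sum>p | p permutes J. (-1) ^ card J * (\<Prod>j\<in>J. m j (p j)))"
  proof (rule sum_permutations_PiE[OF J, symmetric])
    fix p q :: "'b \<Rightarrow> 'b" assume "\<And>j. j \<in> J \<Longrightarrow> p j = q j"
    then have "(\<Prod>j\<in>J. m j (p j)) = (\<Prod>j\<in>J. m j (q j))" by (intro prod.cong) auto
    then show "(-1) ^ card J * (\<Prod>j\<in>J. m j (p j)) = (-1) ^ card J * (\<Prod>j\<in>J. m j (q j))" by simp
  qed
  finally show ?thesis by (simp add: sum_distrib_left)
qed

text \<open>The Levi-Civita symbol, zero on maps that are not permutations. As a determinant of a
  0/1 matrix it inherits multiplicativity.\<close>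

definition eps :: "(3 \<Rightarrow> 3) \<Rightarrow> 'a::comm_ring_1" where
  "eps y = det (\<chi> i j. if y i = j then 1 else 0)"

lemma eps_eq_sign: "eps y = (\<Sum>p | p permutes UNIV. if y = p then of_int (sign p) else 0)"
  unfolding eps_def det_def
proof (rule sum.cong[OF refl])
  fix p :: "3 \<Rightarrow> 3"
  have "(\<Prod>i\<in>UNIV. if y i = p i then 1 else (0::'a)) = (if y = p then 1 else 0)"
  proof (cases "y = p")
    case False
    then obtain i where "y i \<noteq> p i" by auto
    then have "(\<Prod>i\<in>UNIV. if y i = p i then 1 else (0::'a)) = 0"
      by (intro prod_zero) auto
    then show ?thesis using False by simp
  qed simp
  then show "of_int (sign p) * (\<Prod>i\<in>UNIV. (\<chi> i j. if y i = j then 1 else (0::'a)) $ i $ p i) =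
      (if y = p then of_int (sign p) else 0)" by simp
qed

lemma of_int_eps: "of_int (eps y) = eps y"
  unfolding eps_eq_sign of_int_sum by (intro sum.cong) auto

lemma eps_id: "eps id = 1"
proof -
  have "(\<chi> i j. if id i = j then 1 else 0) = (mat 1 :: 'a^3^3)" by (simp add: mat_def vec_eq_iff)
  then show ?thesis unfolding eps_def by (metis det_I)
qed

lemma det_eq_sum_eps: "det M = (\<Sum>y\<in>UNIV. eps y * (\<Prod>i\<in>UNIV. M $ i $ y i))"
proof -
  have "(\<Sum>y\<in>UNIV. eps y * (\<Prod>i\<in>UNIV. M $ i $ y i)) =
     (\<Sum>p | p permutes UNIV. \<Sum>y\<in>UNIV. if y = p then of_int (sign p) * (\<Prod>i\<in>UNIV. M $ i $ y i) else 0)"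
    unfolding eps_eq_sign sum_distrib_right by (subst sum.swap) (intro sum.cong, auto)
  also have "\<dots> = det M" unfolding det_def by (intro sum.cong) auto
  finally show ?thesis by simp
qed

text \<open>Selecting the rows \<open>r 1\<close>, \<open>r 2\<close>, \<open>r 3\<close> of
  \<open>g\<close> is multiplication by the 0/1 matrix of \<open>r\<close>, so the determinant
  factors.\<close>

lemma sum_eps_rows: "(\<Sum>y\<in>UNIV. eps y * (\<Prod>i\<in>UNIV. g $ r i $ y i)) = eps r * det g"
proof -
  have "(\<chi> i j. if r i = j then 1 else 0) ** g = (\<chi> i j. g $ r i $ j)"
    by (simp add: matrix_matrix_mult_def vec_eq_iff if_distrib[where f = "\<lambda>x. x * _"] cong: if_cong)
  then have "eps r * det g = det (\<chi> i j. g $ r i $ j)"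
    unfolding eps_def by (metis det_mul)
  also have "\<dots> = (\<Sum>y\<in>UNIV. eps y * (\<Prod>i\<in>UNIV. g $ r i $ y i))"
    by (subst det_eq_sum_eps) simp
  finally show ?thesis by simp
qed

text \<open>One 0/1 matrix times the transpose of the other has the Kronecker deltas of
  \<open>y\<close> and \<open>z\<close> as entries. A pair of alternating symbols thus becomes a
  signed sum of identifications of indices.\<close>

lemma eps_mult:
  "eps y * eps z = (\<Sum>p | p permutes UNIV. of_int (sign p) * (\<Prod>i\<in>UNIV. if y i = z (p i) then 1 else 0))"
proof -
  let ?Y = "\<lambda>y. \<chi> i j. if y i = j then 1 else (0::'a)"
  have "eps y * eps z = det (?Y y ** transpose (?Y z))"
    by (simp add: det_mul det_transpose eps_def)
  also have "?Y y ** transpose (?Y z) = (\<chi> i j. if y i = z j then 1 else 0)"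
    unfolding matrix_matrix_mult_def transpose_def vec_eq_iff
    by (simp add: if_distrib[where f = "\<lambda>x. x * _"] cong: if_cong)
  finally show ?thesis by (simp add: det_def)
qed

section \<open>The omega operator\<close>

text \<open>One slot for each of the 3d linear factors in a polynomial of degree 3d; slot (k, i) is
  position i of the k-th alternating symbol.\<close>

definition slots :: "nat \<Rightarrow> (nat \<times> 3) set" where
  "slots d = {..<d} \<times> UNIV"

abbreviation idx :: "nat \<Rightarrow> (nat \<times> 3 \<Rightarrow> 3) set" where
  "idx d \<equiv> slots d \<rightarrow>\<^sub>E UNIV"

definition epsd :: "nat \<Rightarrow> (nat \<times> 3 \<Rightarrow> 3) \<Rightarrow> 'a::comm_ring_1" where
  "epsd d x = (\<Prod>k<d. eps (\<lambda>i. x (k, i)))"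

lemma finite_slots [simp]: "finite (slots d)"
  by (simp add: slots_def)

lemma finite_idx [simp]: "finite (idx d)"
  by (simp add: finite_PiE)

lemma prod_slots: "prod f (slots d) = (\<Prod>k<d. \<Prod>i\<in>UNIV. f (k, i))"
  by (simp add: slots_def prod.cartesian_product)

lemma prod_sum_slots:
  fixes F :: "nat \<Rightarrow> (3 \<Rightarrow> 3) \<Rightarrow> 'a::comm_semiring_1"
  shows "(\<Prod>k<d. \<Sum>y\<in>UNIV. F k y) = (\<Sum>x\<in>idx d. \<Prod>k<d. F k (\<lambda>i. x (k, i)))"
proof -
  have "(\<Prod>k<d. \<Sum>y\<in>UNIV. F k y) = (\<Sum>g\<in>{..<d} \<rightarrow>\<^sub>E UNIV. \<Prod>k<d. F k (g k))"
    by (intro prod_sum_PiE) auto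
  also have "\<dots> = (\<Sum>x\<in>idx d. \<Prod>k<d. F k (\<lambda>i. x (k, i)))"
    by (rule sum.reindex_bij_witness[where i = "\<lambda>x. \<lambda>k\<in>{..<d}. \<lambda>i. x (k, i)"
          and j = "\<lambda>g. \<lambda>(k, i)\<in>slots d. g k i"])
      (auto simp: slots_def restrict_def PiE_def extensional_def fun_eq_iff intro!: prod.cong)
  finally show ?thesis .
qed

lemma epsd_cong: "(\<And>j. j \<in> slots d \<Longrightarrow> x j = y j) \<Longrightarrow> epsd d x = epsd d y"
  unfolding epsd_def by (intro prod.cong refl arg_cong[where f = eps]) (auto simp: slots_def)

lemma of_int_epsd: "of_int (epsd d x) = epsd d x"
  by (simp add: epsd_def of_int_eps)

text \<open>Up to sign, this is the $d$-th power of Cayley's omega operator, applied to a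
  polynomial of degree $3d$ in the entries of a matrix.  The polarization of \<open>h\<close> replaces
  differentiation, so that only values of \<open>h\<close> are needed.\<close>

definition Omega :: "nat \<Rightarrow> ('a::comm_ring_1^3^3 \<Rightarrow> 'a) \<Rightarrow> 'a" where
  "Omega d h = (\<Sum>R\<in>idx d. \<Sum>C\<in>idx d. epsd d R * epsd d C *
     (\<Sum>S\<in>Pow (slots d). (-1) ^ card S * h (\<chi> r c. \<Sum>j\<in>S. if R j = r \<and> C j = c then 1 else 0)))"

lemma Omega_cmult: "Omega d (\<lambda>g. c * h g) = c * Omega d h"
  by (simp add: Omega_def sum_distrib_left mult_ac)

lemma Omega_sum: "Omega d (\<lambda>g. \<Sum>a\<in>I. h a g) = (\<Sum>a\<in>I. Omega d (h a))"
proof -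
  have "Omega d (\<lambda>g. \<Sum>a\<in>I. h a g) = (\<Sum>R\<in>idx d. \<Sum>C\<in>idx d. \<Sum>a\<in>I. epsd d R * epsd d C *
     (\<Sum>S\<in>Pow (slots d). (-1) ^ card S * h a (\<chi> r c. \<Sum>j\<in>S. if R j = r \<and> C j = c then 1 else 0)))"
    unfolding Omega_def sum_distrib_left
    by (intro sum.cong refl) (rule sum.swap)
  also have "\<dots> = (\<Sum>a\<in>I. Omega d (h a))"
    unfolding Omega_def
    by (simp add: sum.swap[of _ _ I])
  finally show ?thesis .
qed

lemma Omega_add: "Omega d (\<lambda>g. h g + k g) = Omega d h + Omega d k"
  by (simp add: Omega_def distrib_left sum.distrib)

text \<open>Polarization leaves a sum over permutations of the slots. For a fixed permutation the
  indicators determine \<open>R\<close> and \<open>C\<close> on all slots, so the double sum over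
  index maps collapses to one term.\<close>

lemma Omega_monomial:
  "Omega d (\<lambda>g. \<Prod>j\<in>slots d. g $ r j $ c j) =
    (-1) ^ card (slots d) * (\<Sum>p | p permutes slots d. epsd d (r \<circ> p) * (epsd d (c \<circ> p) :: 'a::comm_ring_1))"
proof -
  let ?J = "slots d" and ?P = "{p. p permutes slots d}"
  have fP: "finite ?P" by (simp add: finite_permutations)
  let ?d = "\<lambda>R C p. (if \<forall>j\<in>?J. R (p j) = r j \<and> C (p j) = c j then 1 else (0::'a))"
  have "(\<Sum>S\<in>Pow ?J. (-1) ^ card S * (\<Prod>j\<in>?J. (\<chi> r c. \<Sum>j\<in>S. if R j = r \<and> C j = c then 1 else 0) $ r j $ c j))
     = (-1) ^ card ?J * (\<Sum>p\<in>?P. ?d R C p)" for R C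
  proof -
    have "(\<Prod>j\<in>?J. if R (p j) = r j \<and> C (p j) = c j then 1 else (0::'a)) = ?d R C p" for p
    proof (cases "\<forall>j\<in>?J. R (p j) = r j \<and> C (p j) = c j")
      case False
      then show ?thesis by (subst if_not_P, assumption, intro prod_zero) auto
    qed simp
    then show ?thesis
      using polarization[of ?J "\<lambda>j i. if R i = r j \<and> C i = c j then 1 else (0::'a)"] by simp
  qed
  then have "Omega d (\<lambda>g. \<Prod>j\<in>?J. g $ r j $ c j) =
     (\<Sum>R\<in>idx d. \<Sum>C\<in>idx d. epsd d R * epsd d C * ((-1) ^ card ?J * (\<Sum>p\<in>?P. ?d R C p)))"
    unfolding Omega_def by simp
  also have "\<dots> = (\<Sum>p\<in>?P. (-1) ^ card ?J * (\<Sum>R\<in>idx d. \<Sum>C\<in>idx d. epsd d R * epsd d C * ?d R C p))"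
    by (simp add: sum_distrib_left sum.swap[of _ _ ?P] mult_ac)
  also have "\<dots> = (\<Sum>p\<in>?P. (-1) ^ card ?J * (epsd d (r \<circ> inv p) * epsd d (c \<circ> inv p)))"
  proof (intro sum.cong refl)
    fix p assume "p \<in> ?P"
    then have p: "p permutes ?J" by simp
    let ?R = "restrict (r \<circ> inv p) ?J" and ?C = "restrict (c \<circ> inv p) ?J"
    have uniq: "(\<forall>j\<in>?J. R (p j) = s j) \<longleftrightarrow> R = restrict (s \<circ> inv p) ?J" if "R \<in> idx d" for R s
    proof -
      have "(\<forall>j\<in>?J. R (p j) = s j) \<longleftrightarrow> (\<forall>j\<in>?J. R j = s (inv p j))"
      proof safe
        fix j assume "\<forall>j\<in>?J. R (p j) = s j" "j \<in> ?J"
        then have "R (p (inv p j)) = s (inv p j)"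
          using permutes_in_image[OF permutes_inv[OF p]] by blast
        then show "R j = s (inv p j)" by (simp add: permutes_inverses[OF p])
      next
        fix j assume "\<forall>j\<in>?J. R j = s (inv p j)" "j \<in> ?J"
        then have "R (p j) = s (inv p (p j))" using permutes_in_image[OF p] by blast
        then show "R (p j) = s j" by (simp add: permutes_inverses[OF p])
      qed
      then show ?thesis using that by (auto simp: fun_eq_iff PiE_def extensional_def)
    qed
    have "(\<Sum>R\<in>idx d. \<Sum>C\<in>idx d. epsd d R * epsd d C * ?d R C p) =
      (\<Sum>R\<in>idx d. \<Sum>C\<in>idx d. if R = ?R then if C = ?C then epsd d R * epsd d C else 0 else (0::'a))"
      using uniq[of _ r] uniq[of _ c] by (intro sum.cong refl) (auto simp: ball_conj_distrib)
    also have "\<dots> = (\<Sum>R\<in>idx d. if R = ?R then \<Sum>C\<in>idx d. if C = ?C then epsd d R * epsd d C else 0 else (0::'a))"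
      by (intro sum.cong) auto
    also have "\<dots> = epsd d ?R * epsd d ?C"
      by (simp add: sum.delta)
    also have "\<dots> = epsd d (r \<circ> inv p) * epsd d (c \<circ> inv p)"
      by (intro arg_cong2[where f = "(*)"] epsd_cong) auto
    finally show "(-1) ^ card ?J * (\<Sum>R\<in>idx d. \<Sum>C\<in>idx d. epsd d R * epsd d C * ?d R C p) =
       (-1) ^ card ?J * (epsd d (r \<circ> inv p) * epsd d (c \<circ> inv p))"
      by (rule arg_cong)
  qed
  also have "\<dots> = (-1) ^ card ?J * (\<Sum>p\<in>?P. epsd d (r \<circ> p) * epsd d (c \<circ> p))"
    unfolding sum_distrib_left[symmetric] by (subst (2) sum_permutations_inverse) simp
  finally show ?thesis .
qed

text \<open>Multiplying by the sum of the squares \<open>epsd d r * epsd d r\<close> and expanding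
  det along the rows \<open>r\<close> makes the value symmetric in rows and columns: up to sign it
  becomes the sum over permutations of \<open>X p * X p\<close>. The numbers \<open>X p\<close> are
  integers, so a vanishing sum would force \<open>X id = 0\<close>.\<close>

lemma Omega_det_power_nonzero:
  "Omega d (\<lambda>g. det g ^ d) \<noteq> (0::'a::field_char_0)"
proof
  let ?J = "slots d" and ?P = "{p. p permutes slots d}"
  assume zero: "Omega d (\<lambda>g. det g ^ d) = (0::'a)"
  define X :: "(nat \<times> 3 \<Rightarrow> nat \<times> 3) \<Rightarrow> int" where "X p = (\<Sum>x\<in>idx d. epsd d x * epsd d (x \<circ> p))" for p
  have row: "epsd d r * det g ^ d = (\<Sum>c\<in>idx d. epsd d c * (\<Prod>j\<in>?J. g $ r j $ c j))" for r and g :: "'a mat3"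
  proof -
    have "epsd d r * det g ^ d = (\<Prod>k<d. eps (\<lambda>i. r (k, i)) * det g)"
      by (simp add: epsd_def prod.distrib)
    also have "\<dots> = (\<Prod>k<d. \<Sum>y\<in>UNIV. eps y * (\<Prod>i\<in>UNIV. g $ r (k, i) $ y i))"
      by (simp add: sum_eps_rows[symmetric])
    also have "\<dots> = (\<Sum>c\<in>idx d. epsd d c * (\<Prod>j\<in>?J. g $ r j $ c j))"
      by (simp add: prod_sum_slots epsd_def prod.distrib prod_slots)
    finally show ?thesis .
  qed
  have "0 = (\<Sum>r\<in>idx d. epsd d r * Omega d (\<lambda>g. epsd d r * det g ^ d :: 'a))"
    using zero by (simp add: Omega_cmult)
  also have "\<dots> = (\<Sum>r\<in>idx d. \<Sum>c\<in>idx d. epsd d r * epsd d c * Omega d (\<lambda>g. \<Prod>j\<in>?J. g $ r j $ c j))"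
    by (simp add: row Omega_sum Omega_cmult sum_distrib_left mult_ac)
  also have "\<dots> = (-1) ^ card ?J * (\<Sum>r\<in>idx d. \<Sum>c\<in>idx d. \<Sum>p\<in>?P.
      (epsd d r * epsd d (r \<circ> p)) * (epsd d c * epsd d (c \<circ> p)))"
    by (simp add: Omega_monomial sum_distrib_left mult_ac)
  also have "\<dots> = (-1) ^ card ?J * (\<Sum>p\<in>?P. of_int (X p) * of_int (X p))"
    by (simp add: X_def of_int_epsd sum_product sum.swap[of _ _ ?P])
  finally have "(of_int (\<Sum>p\<in>?P. X p * X p) :: 'a) = 0" by simp
  then have "(\<Sum>p\<in>?P. X p * X p) = 0" unfolding of_int_eq_0_iff .
  moreover have "(\<Sum>p\<in>?P. X p * X p) > 0"
  proof -
    \<comment> \<open>On the index map sending (k, i) to i every alternating symbol is 1, which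
      makes \<open>X id\<close> positive.\<close>
    let ?e = "restrict snd ?J"
    have "epsd d ?e = (epsd d snd :: int)" by (rule epsd_cong) simp
    then have "epsd d ?e = (1::int)" using eps_id[where 'a=int] by (simp add: epsd_def id_def)
    moreover have "epsd d ?e * epsd d ?e \<le> X id"
      unfolding X_def o_id by (rule member_le_sum) auto
    ultimately have "X id > 0" by simp
    moreover have "X id * X id \<le> (\<Sum>p\<in>?P. X p * X p)"
      by (rule member_le_sum) (auto simp: permutes_id[unfolded id_def] id_def finite_permutations)
    ultimately show ?thesis by (smt (verit) zero_less_mult_iff)
  qed
  ultimately show False by simp
qed

section \<open>Contractions and traces\<close>

lemma wprod_Nil [simp]: "wprod [] A = mat 1"
  by (simp add: wprod_def)

lemma wprod_Cons [simp]: "wprod (k # w) A = Yc k A ** wprod w A"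
  by (simp add: wprod_def)

lemma wprod_append: "wprod (u @ v) A = wprod u A ** wprod v A"
  by (induct u) (simp_all add: matrix_mul_assoc)

lemma sum_PiE_insert:
  assumes "j \<notin> J"
  shows "(\<Sum>x\<in>insert j J \<rightarrow>\<^sub>E UNIV. G x) = (\<Sum>x\<in>J \<rightarrow>\<^sub>E UNIV. \<Sum>a\<in>UNIV. G (x(j := a)))"
proof -
  have "(\<Sum>x\<in>insert j J \<rightarrow>\<^sub>E UNIV. G x) = (\<Sum>(a, x)\<in>UNIV \<times> (J \<rightarrow>\<^sub>E UNIV). G (x(j := a)))"
    unfolding PiE_insert_eq
    by (subst sum.reindex[OF inj_combinator[OF assms]]) (simp add: case_prod_unfold)
  also have "\<dots> = (\<Sum>a\<in>UNIV. \<Sum>x\<in>J \<rightarrow>\<^sub>E UNIV. G (x(j := a)))"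
    by (simp add: sum.cartesian_product)
  finally show ?thesis by (simp add: sum.swap[of _ UNIV])
qed

text \<open>Isolates the closure properties that contractions need. Later \<open>T\<close> is the
  set of functions whose restriction to the nilpotent triples lies in
  \<open>subalg P33\<close>.\<close>

locale trace_algebra =
  fixes T :: "('a::field trip \<Rightarrow> 'a) set"
  assumes const: "(\<lambda>_. c) \<in> T"
    and add: "f \<in> T \<Longrightarrow> g \<in> T \<Longrightarrow> (\<lambda>A. f A + g A) \<in> T"
    and mult: "f \<in> T \<Longrightarrow> g \<in> T \<Longrightarrow> (\<lambda>A. f A * g A) \<in> T"
    and trace: "(\<lambda>A. trace (wprod w A)) \<in> T"
begin

lemma cmult: "f \<in> T \<Longrightarrow> (\<lambda>A. c * f A) \<in> T"
  by (rule mult[OF const])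

lemma sum: "(\<And>i. i \<in> I \<Longrightarrow> f i \<in> T) \<Longrightarrow> (\<lambda>A. \<Sum>i\<in>I. f i A) \<in> T"
  by (induct I rule: infinite_finite_induct) (auto intro: const add)

text \<open>The contraction along a permutation is a product of traces, one for each cycle.
  Contracting the index \<open>j\<close> shortens its cycle.\<close>

lemma cycle_contraction:
  fixes B :: "'b \<Rightarrow> 'a trip \<Rightarrow> 'a mat3"
  assumes "finite J" "p permutes J" "\<And>j. j \<in> J \<Longrightarrow> \<exists>w. B j = wprod w"
  shows "(\<lambda>A. \<Sum>x\<in>J \<rightarrow>\<^sub>E UNIV. \<Prod>j\<in>J. B j A $ x j $ x (p j)) \<in> T"
  using assms
proof (induct J arbitrary: p B rule: finite_induct)
  case empty
  then show ?case by (simp add: const)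
next
  case (insert j J)
  note p = insert.prems(1)
  show ?case
  proof (cases "p j = j")
    case True
    have pJ: "p permutes J" by (rule permutes_superset[OF p]) (use True in auto)
    obtain w where w: "B j = wprod w" using insert.prems(2) by blast
    have "(\<Sum>x\<in>insert j J \<rightarrow>\<^sub>E UNIV. \<Prod>k\<in>insert j J. B k A $ x k $ x (p k)) =
       trace (wprod w A) * (\<Sum>x\<in>J \<rightarrow>\<^sub>E UNIV. \<Prod>k\<in>J. B k A $ x k $ x (p k))" for A
    proof -
      have "(\<Prod>k\<in>J. B k A $ (x(j := a)) k $ (x(j := a)) (p k)) = (\<Prod>k\<in>J. B k A $ x k $ x (p k))" for x a
        using insert.hyps permutes_in_image[OF pJ] by (intro prod.cong) auto
      then show ?thesis
        using insert.hyps True w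
        by (simp add: sum_PiE_insert trace_def sum_product sum.swap[of _ UNIV])
    qed
    then show ?thesis
      using mult[OF trace insert.hyps(3)[OF pJ insert.prems(2)]] by simp
  next
    case False
    define i where "i = inv p j"
    have pi: "p i = j" by (simp add: i_def permutes_inverses[OF p])
    then have ij: "i \<noteq> j" using False by auto
    have "i \<in> insert j J" using permutes_in_image[OF p, of i] pi by simp
    then have iJ: "i \<in> J" using ij by simp
    \<comment> \<open>\<open>i\<close> precedes \<open>j\<close> in its cycle. The new permutation
      sends \<open>i\<close> directly to \<open>p j\<close> and fixes \<open>j\<close>; summing over
      the index at \<open>j\<close> turns the two factors into the matrix product
      \<open>B i ** B j\<close>, again a word.\<close>
    let ?q = "p \<circ> Transposition.transpose i j"
    have "?q permutes insert j J"
      using iJ by (intro permutes_compose[OF _ p] permutes_swap_id) auto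
    then have q: "?q permutes J"
      by (rule permutes_superset) (use pi in auto)
    let ?B = "B(i := \<lambda>A. B i A ** B j A)"
    have "\<exists>w. ?B k = wprod w" if "k \<in> J" for k
    proof (cases "k = i")
      case True
      obtain u v where "B i = wprod u" "B j = wprod v" using insert.prems(2) iJ by blast
      then have "?B k = wprod (u @ v)" using True by (simp add: fun_eq_iff wprod_append)
      then show ?thesis by blast
    qed (use that insert.prems(2) in simp)
    note IH = insert.hyps(3)[OF q this]
    have pk: "p k \<noteq> j" if "k \<noteq> i" for k
      using that pi permutes_inj[OF p] by (metis injD)
    have "(\<Sum>x\<in>insert j J \<rightarrow>\<^sub>E UNIV. \<Prod>k\<in>insert j J. B k A $ x k $ x (p k)) =
       (\<Sum>x\<in>J \<rightarrow>\<^sub>E UNIV. \<Prod>k\<in>J. ?B k A $ x k $ x (?q k))" for A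
    proof -
      have inner: "(\<Sum>a\<in>UNIV. \<Prod>k\<in>insert j J. B k A $ (x(j := a)) k $ (x(j := a)) (p k)) =
          (\<Prod>k\<in>J. ?B k A $ x k $ x (?q k))" for x
      proof -
        let ?R = "\<Prod>k\<in>J - {i}. B k A $ x k $ x (p k)"
        have "(\<Prod>k\<in>insert j J. B k A $ (x(j := a)) k $ (x(j := a)) (p k)) =
           B i A $ x i $ a * B j A $ a $ x (p j) * ?R" for a
        proof -
          have "(\<Prod>k\<in>J - {i}. B k A $ (x(j := a)) k $ (x(j := a)) (p k)) = ?R"
            using insert.hyps(2) pk by (intro prod.cong) auto
          then show ?thesis
            using insert.hyps(1,2) iJ ij pi False by (simp add: prod.remove[of J i] mult_ac)
        qed
        moreover have "(\<Prod>k\<in>J. ?B k A $ x k $ x (?q k)) = (B i A ** B j A) $ x i $ x (p j) * ?R"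
        proof -
          have "(\<Prod>k\<in>J - {i}. ?B k A $ x k $ x (?q k)) = ?R"
            using insert.hyps(2) by (intro prod.cong) (auto simp: Transposition.transpose_def)
          then show ?thesis using insert.hyps(1) iJ by (simp add: prod.remove[of J i])
        qed
        ultimately show ?thesis
          by (simp add: matrix_matrix_mult_def sum_distrib_right)
      qed
      show ?thesis
        unfolding sum_PiE_insert[OF insert.hyps(2)] by (rule sum.cong[OF refl inner])
    qed
    then show ?thesis using IH by simp
  qed
qed

end

section \<open>The adjugate and the entries of \<open>g ** A ** adj2 g\<close>\<close>

definition tri :: "'b \<Rightarrow> 'b \<Rightarrow> 'b \<Rightarrow> 3 \<Rightarrow> 'b" where
  "tri a b c i = (if i = 1 then a else if i = 2 then b else c)"

lemma tri_simps [simp]: "tri a b c 1 = a" "tri a b c 2 = b" "tri a b c 3 = c"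
  "(tri a b c)(1 := s) = tri s b c"
  by (auto simp: tri_def fun_eq_iff)

lemma tri_eta: "tri (f 1) (f 2) (f 3) = f"
  by (simp add: fun_eq_iff forall_3)

lemma sum_rotate: "(\<Sum>a\<in>I. \<Sum>b\<in>J. \<Sum>c\<in>K. F a b c) = (\<Sum>c\<in>K. \<Sum>a\<in>I. \<Sum>b\<in>J. F a b c)"
proof -
  have "(\<Sum>c\<in>K. \<Sum>a\<in>I. \<Sum>b\<in>J. F a b c) = (\<Sum>a\<in>I. \<Sum>c\<in>K. \<Sum>b\<in>J. F a b c)"
    by (rule sum.swap)
  also have "\<dots> = (\<Sum>a\<in>I. \<Sum>b\<in>J. \<Sum>c\<in>K. F a b c)"
    by (intro sum.cong[OF refl] sum.swap)
  finally show ?thesis by simp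
qed

lemma sum_tri: "(\<Sum>f\<in>UNIV. F f) = (\<Sum>a\<in>UNIV. \<Sum>b\<in>UNIV. \<Sum>c\<in>UNIV. F (tri a b c))"
proof -
  have "(\<Sum>f\<in>UNIV. F f) = (\<Sum>(a, b, c)\<in>UNIV \<times> UNIV \<times> UNIV. F (tri a b c))"
    by (rule sum.reindex_bij_witness[where i = "\<lambda>(a, b, c). tri a b c" and j = "\<lambda>f. (f 1, f 2, f 3)"])
      (auto simp: tri_eta)
  then show ?thesis by (simp add: sum.cartesian_product)
qed

lemma prod_3: "prod f (UNIV :: 3 set) = f 1 * f 2 * f 3"
  unfolding UNIV_3 by (simp add: mult_ac)

text \<open>Twice the adjugate, written with the alternating symbol.\<close>

definition adj2 :: "'a::comm_ring_1^3^3 \<Rightarrow> 'a^3^3" where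
  "adj2 g = (\<chi> b s. \<Sum>q\<in>UNIV. \<Sum>t\<in>UNIV. \<Sum>b'\<in>UNIV. \<Sum>c'\<in>UNIV.
     eps (tri s q t) * eps (tri b b' c') * g $ q $ b' * g $ t $ c')"

lemma sum_eps_eps: "(\<Sum>q\<in>UNIV. \<Sum>t\<in>UNIV. eps (tri s q t) * eps (tri r q t)) = (if r = s then 2 else 0)"
proof -
  have "\<forall>r s. (\<Sum>q\<in>UNIV. \<Sum>t\<in>UNIV. eps (tri s q t) * eps (tri r q t)) = (if r = s then 2 else 0)"
    unfolding forall_3 sum_3 eps_def det_3 by simp
  then show ?thesis by blast
qed

text \<open>The sum over the three column indices is a determinant with rows r, q, t, that is,
  \<open>eps (tri r q t) * det g\<close>; contracting with \<open>eps (tri s q t)\<close> leaves the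
  factor 2 on the diagonal.\<close>

lemma matrix_mult_adj2: "g ** adj2 g = (\<chi> r s. if r = s then 2 * det g else 0)"
proof -
  have "(\<Sum>b\<in>UNIV. g $ r $ b * adj2 g $ b $ s) = (if r = s then 2 * det g else 0)" for r s
  proof -
    have "(\<Sum>b\<in>UNIV. g $ r $ b * adj2 g $ b $ s) =
       (\<Sum>b\<in>UNIV. \<Sum>q\<in>UNIV. \<Sum>t\<in>UNIV. \<Sum>b'\<in>UNIV. \<Sum>c'\<in>UNIV.
         eps (tri s q t) * (eps (tri b b' c') * (g $ r $ b * g $ q $ b' * g $ t $ c')))"
      by (simp add: adj2_def sum_distrib_left mult_ac)
    also have "\<dots> = (\<Sum>q\<in>UNIV. \<Sum>t\<in>UNIV. eps (tri s q t) *
       (\<Sum>b\<in>UNIV. \<Sum>b'\<in>UNIV. \<Sum>c'\<in>UNIV. eps (tri b b' c') * (g $ r $ b * g $ q $ b' * g $ t $ c')))"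
      unfolding sum_distrib_left
      by (rule sum_rotate[symmetric])
    also have "\<dots> = (\<Sum>q\<in>UNIV. \<Sum>t\<in>UNIV. eps (tri s q t) * (eps (tri r q t) * det g))"
      unfolding sum_eps_rows[symmetric] sum_tri[of "\<lambda>y. eps y * _ y"] prod_3 tri_simps by (rule refl)
    also have "\<dots> = (if r = s then 2 else 0) * det g"
      by (simp add: sum_eps_eps[symmetric] sum_distrib_left sum_distrib_right mult_ac)
    finally show ?thesis by simp
  qed
  then show ?thesis by (simp add: matrix_matrix_mult_def)
qed

text \<open>The alternating symbol with \<open>A\<close> applied to its first index. It is the
  coefficient of a product of three entries of g, one from g itself and two from the
  adjugate.\<close>

definition twist :: "'a::comm_ring_1^3^3 \<Rightarrow> (3 \<Rightarrow> 3) \<Rightarrow> 'a" where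
  "twist A x = (\<Sum>y\<in>UNIV. eps y * (\<Prod>i\<in>UNIV. (if i = 1 then A else mat 1) $ x i $ y i))"

lemma twist_tri: "twist A (tri a b c) = (\<Sum>y\<in>UNIV. eps (tri y b c) * A $ a $ y)"
proof -
  have "twist A (tri a b c) = (\<Sum>y\<in>UNIV. \<Sum>y'\<in>UNIV. \<Sum>y''\<in>UNIV.
      if c = y'' then if b = y' then eps (tri y y' y'') * A $ a $ y else 0 else 0)"
    unfolding twist_def sum_tri prod_3 by (intro sum.cong refl) (simp add: mat_def)
  then show ?thesis by simp
qed

text \<open>An entry of the conjugate is a cubic form in g, so d such entries have the degree 3d
  that \<open>Omega d\<close> expects. Each coefficient splits into a row part free of
  \<open>A\<close> and a column part, the twist.\<close>

lemma conj_adj2_expansion: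
  "(g ** A ** adj2 g) $ r $ s = (\<Sum>q\<in>UNIV. \<Sum>x\<in>UNIV.
     (if q 1 = r then eps (q(1 := s)) else 0) * twist A x * (\<Prod>i\<in>UNIV. g $ q i $ x i))"
proof -
  let ?s = "\<lambda>q t a b c y. eps (tri s q t) * eps (tri y b c) * A $ a $ y * (g $ r $ a * g $ q $ b * g $ t $ c)"
  have "(\<Sum>q\<in>UNIV. \<Sum>x\<in>UNIV. (if q 1 = r then eps (q(1 := s)) else 0) * twist A x * (\<Prod>i\<in>UNIV. g $ q i $ x i))
     = (\<Sum>p\<in>UNIV. if p = r then \<Sum>q\<in>UNIV. \<Sum>t\<in>UNIV. \<Sum>a\<in>UNIV. \<Sum>b\<in>UNIV. \<Sum>c\<in>UNIV. \<Sum>y\<in>UNIV. ?s q t a b c y else 0)"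
    unfolding sum_tri
    by (intro sum.cong refl) (simp add: twist_tri prod_3 sum_distrib_left sum_distrib_right mult_ac)
  also have "\<dots> = (\<Sum>q\<in>UNIV. \<Sum>t\<in>UNIV. \<Sum>a\<in>UNIV. \<Sum>b\<in>UNIV. \<Sum>c\<in>UNIV. \<Sum>y\<in>UNIV. ?s q t a b c y)"
    by simp
  \<comment> \<open>From here on only the order of the six summations changes, until it matches the
    definition of the matrix products.\<close>
  also have "\<dots> = (\<Sum>q\<in>UNIV. \<Sum>t\<in>UNIV. \<Sum>y\<in>UNIV. \<Sum>a\<in>UNIV. \<Sum>b\<in>UNIV. \<Sum>c\<in>UNIV. ?s q t a b c y)"
    by (subst sum_rotate, subst sum.swap) (rule refl)
  also have "\<dots> = (\<Sum>y\<in>UNIV. \<Sum>a\<in>UNIV. \<Sum>q\<in>UNIV. \<Sum>t\<in>UNIV. \<Sum>b\<in>UNIV. \<Sum>c\<in>UNIV. ?s q t a b c y)"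
    by (subst sum_rotate, rule sum.cong[OF refl], rule sum_rotate)
  also have "\<dots> = (\<Sum>y\<in>UNIV. \<Sum>q\<in>UNIV. \<Sum>t\<in>UNIV. \<Sum>a\<in>UNIV. \<Sum>b\<in>UNIV. \<Sum>c\<in>UNIV. ?s q t a b c y)"
    by (rule sum.cong[OF refl], rule sum_rotate[symmetric])
  also have "\<dots> = (\<Sum>y\<in>UNIV. \<Sum>q\<in>UNIV. \<Sum>t\<in>UNIV. \<Sum>b\<in>UNIV. \<Sum>c\<in>UNIV. \<Sum>a\<in>UNIV. ?s q t a b c y)"
    by (rule sum.cong[OF refl], rule sum.cong[OF refl], rule sum.cong[OF refl], rule sum_rotate[symmetric])
  also have "\<dots> = (g ** A ** adj2 g) $ r $ s"
    unfolding matrix_matrix_mult_def adj2_def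
    by (simp add: sum_distrib_left sum_distrib_right mult_ac)
  finally show ?thesis by simp
qed

lemma epsd_mult:
  "epsd d y * epsd d z = (\<Sum>P\<in>{..<d} \<rightarrow>\<^sub>E {p. p permutes UNIV}.
     (\<Prod>k<d. of_int (sign (P k))) * (\<Prod>(k, i)\<in>slots d. if y (k, i) = z (k, P k i) then 1 else 0))"
proof -
  have "epsd d y * epsd d z = (\<Prod>k<d. \<Sum>p | p permutes UNIV. of_int (sign p) *
       (\<Prod>i\<in>UNIV. if y (k, i) = z (k, p i) then 1 else 0))"
    unfolding epsd_def prod.distrib[symmetric] eps_mult by (rule refl)
  also have "\<dots> = (\<Sum>P\<in>{..<d} \<rightarrow>\<^sub>E {p. p permutes UNIV}. \<Prod>k<d. of_int (sign (P k)) *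
       (\<Prod>i\<in>UNIV. if y (k, i) = z (k, P k i) then 1 else 0))"
    by (intro prod_sum_PiE) (auto simp: finite_permutations)
  finally show ?thesis by (simp add: prod.distrib prod_slots)
qed

lemma slotwise_permutes:
  assumes "P \<in> {..<d} \<rightarrow>\<^sub>E {p. p permutes UNIV}"
  shows "(\<lambda>(k, i). if k < d then (k, P k i) else (k, i)) permutes slots d"
proof -
  let ?h = "\<lambda>(k, i). if k < d then (k, P k i) else (k, i)"
  have P: "P k permutes UNIV" if "k < d" for k
    using assms that by auto
  have "bij_betw ?h (slots d) (slots d)"
    by (rule bij_betwI[where g = "\<lambda>(k, i). (k, inv (P k) i)"])
      (auto simp: slots_def permutes_inverses[OF P])
  then show ?thesis by (rule bij_imp_permutes) (auto simp: slots_def split: if_splits)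
qed

lemma prod_indicator: "finite J \<Longrightarrow> (\<Prod>j\<in>J. if Q j then 1 else 0) = (if \<forall>j\<in>J. Q j then 1 else (0::'a::comm_semiring_1))"
  by (induct J rule: finite_induct) auto

text \<open>Each twist contains an alternating symbol; pairing these with
  \<open>epsd d (x o p)\<close> gives Kronecker deltas that identify every \<open>y j\<close> with
  some value of \<open>x\<close>. What remains is a contraction along the permutation
  \<open>p o h P\<close>, with a one-letter word in position 1 of each block and the empty word in
  the other two.\<close>

lemma (in trace_algebra) twist_contraction:
  assumes p: "p permutes slots d"
  shows "(\<lambda>A. \<Sum>x\<in>idx d. (\<Prod>k<d. twist (Yc (l k) A) (\<lambda>i. x (k, i))) * epsd d (x \<circ> p)) \<in> T"
proof -
  define B :: "nat \<times> 3 \<Rightarrow> 'a trip \<Rightarrow> 'a mat3" where "B j = wprod (if snd j = (1::3) then [l (fst j)] else [])" for j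
  let ?PP = "{..<d} \<rightarrow>\<^sub>E {p. p permutes (UNIV::3 set)}"
  define h where "h P = (\<lambda>(k, i). if k < d then (k, P k i) else (k::nat, i::3))" for P
  let ?s = "\<lambda>P. \<Prod>k<d. of_int (sign (P k)) :: 'a"
  have h: "h P permutes slots d" if "P \<in> ?PP" for P
    unfolding h_def by (rule slotwise_permutes[OF that])
  have tw: "(\<Prod>k<d. twist (Yc (l k) A) (\<lambda>i. x (k, i))) =
      (\<Sum>y\<in>idx d. epsd d y * (\<Prod>j\<in>slots d. B j A $ x j $ y j))" for A x
  proof -
    have "twist (Yc (l k) A) (\<lambda>i. x (k, i)) =
        (\<Sum>y\<in>UNIV. eps y * (\<Prod>i\<in>UNIV. B (k, i) A $ x (k, i) $ y i))" for k
      unfolding twist_def by (intro sum.cong arg_cong2[where f = "(*)"] prod.cong refl) (simp add: B_def)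
    then show ?thesis by (simp add: prod_sum_slots epsd_def prod.distrib prod_slots)
  qed
  have ind: "epsd d y * epsd d (x \<circ> p) = (\<Sum>P\<in>?PP. if \<forall>j\<in>slots d. y j = x (p (h P j)) then ?s P else 0)" for x y
  proof -
    have "(\<Prod>(k, i)\<in>slots d. if y (k, i) = (x \<circ> p) (k, P k i) then 1 else 0) =
        (if \<forall>j\<in>slots d. y j = x (p (h P j)) then 1 else (0::'a))" for P
      by (subst prod_indicator[OF finite_slots, symmetric])
        (auto simp: slots_def h_def intro!: prod.cong)
    then show ?thesis unfolding epsd_mult by (intro sum.cong refl) simp
  qed
  have "(\<Sum>x\<in>idx d. (\<Prod>k<d. twist (Yc (l k) A) (\<lambda>i. x (k, i))) * epsd d (x \<circ> p)) =
      (\<Sum>P\<in>?PP. ?s P * (\<Sum>x\<in>idx d. \<Prod>j\<in>slots d. B j A $ x j $ x ((p \<circ> h P) j)))" for A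
  proof -
    have "(\<Prod>k<d. twist (Yc (l k) A) (\<lambda>i. x (k, i))) * epsd d (x \<circ> p) =
        (\<Sum>P\<in>?PP. ?s P * (\<Prod>j\<in>slots d. B j A $ x j $ x ((p \<circ> h P) j)))" for x
    proof -
      have "(\<Prod>k<d. twist (Yc (l k) A) (\<lambda>i. x (k, i))) * epsd d (x \<circ> p) =
          (\<Sum>y\<in>idx d. (epsd d y * epsd d (x \<circ> p)) * (\<Prod>j\<in>slots d. B j A $ x j $ y j))"
        by (simp add: tw sum_distrib_left sum_distrib_right mult_ac)
      also have "\<dots> = (\<Sum>P\<in>?PP. \<Sum>y\<in>idx d. (if \<forall>j\<in>slots d. y j = x (p (h P j)) then ?s P else 0) *
          (\<Prod>j\<in>slots d. B j A $ x j $ y j))"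
        unfolding ind sum_distrib_right by (rule sum.swap)
      also have "\<dots> = (\<Sum>P\<in>?PP. ?s P * (\<Prod>j\<in>slots d. B j A $ x j $ x ((p \<circ> h P) j)))"
      proof (intro sum.cong refl)
        fix P
        let ?y = "restrict (\<lambda>j. x (p (h P j))) (slots d)"
        have "(\<Sum>y\<in>idx d. (if \<forall>j\<in>slots d. y j = x (p (h P j)) then ?s P else 0) *
            (\<Prod>j\<in>slots d. B j A $ x j $ y j)) =
          (\<Sum>y\<in>idx d. if y = ?y then ?s P * (\<Prod>j\<in>slots d. B j A $ x j $ y j) else 0)"
          by (intro sum.cong refl) (auto simp: PiE_def extensional_def fun_eq_iff)
        also have "\<dots> = ?s P * (\<Prod>j\<in>slots d. B j A $ x j $ x ((p \<circ> h P) j))"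
          by simp
        finally show "(\<Sum>y\<in>idx d. (if \<forall>j\<in>slots d. y j = x (p (h P j)) then ?s P else 0) *
            (\<Prod>j\<in>slots d. B j A $ x j $ y j)) = ?s P * (\<Prod>j\<in>slots d. B j A $ x j $ x ((p \<circ> h P) j))" .
      qed
      finally show ?thesis .
    qed
    then show ?thesis by (simp add: sum_distrib_left sum.swap[of _ ?PP])
  qed
  moreover have "(\<lambda>A. \<Sum>P\<in>?PP. ?s P * (\<Sum>x\<in>idx d. \<Prod>j\<in>slots d. B j A $ x j $ x ((p \<circ> h P) j))) \<in> T"
    by (rule sum, rule cmult, rule cycle_contraction[OF finite_slots permutes_compose[OF h p]]) (use B_def in blast)+
  ultimately show ?thesis by simp
qed

text \<open>After the omega operator the row indices carry constants only, and all dependence on the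
  triple sits in the column sums treated by \<open>twist_contraction\<close>.\<close>

lemma (in trace_algebra) Omega_conj_monomial:
  "(\<lambda>A. Omega d (\<lambda>g. \<Prod>k<d. (g ** Yc (l k) A ** adj2 g) $ r k $ s k)) \<in> T"
proof -
  let ?c = "\<lambda>k q. if q (1::3) = r k then eps (q(1 := s k)) else (0::'a)"
  let ?C = "\<lambda>q. \<Prod>k<d. ?c k (\<lambda>i. q (k, i))"
  let ?W = "\<lambda>A x. \<Prod>k<d. twist (Yc (l k) A) (\<lambda>i. x (k, i))"
  let ?P = "{p. p permutes slots d}"
  have "(\<Prod>k<d. (g ** Yc (l k) A ** adj2 g) $ r k $ s k) =
      (\<Sum>q\<in>idx d. \<Sum>x\<in>idx d. ?C q * ?W A x * (\<Prod>j\<in>slots d. g $ q j $ x j))" for g A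
  proof -
    have "(\<Prod>k<d. (g ** Yc (l k) A ** adj2 g) $ r k $ s k) =
        (\<Sum>q\<in>idx d. \<Prod>k<d. \<Sum>x\<in>UNIV. ?c k (\<lambda>i. q (k, i)) * twist (Yc (l k) A) x * (\<Prod>i\<in>UNIV. g $ q (k, i) $ x i))"
      unfolding conj_adj2_expansion by (rule prod_sum_slots)
    also have "\<dots> = (\<Sum>q\<in>idx d. \<Sum>x\<in>idx d. \<Prod>k<d. ?c k (\<lambda>i. q (k, i)) * twist (Yc (l k) A) (\<lambda>i. x (k, i)) *
        (\<Prod>i\<in>UNIV. g $ q (k, i) $ x (k, i)))"
      by (intro sum.cong refl prod_sum_slots)
    finally show ?thesis by (simp add: prod.distrib prod_slots)
  qed
  then have "Omega d (\<lambda>g. \<Prod>k<d. (g ** Yc (l k) A ** adj2 g) $ r k $ s k) =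
      (\<Sum>q\<in>idx d. \<Sum>x\<in>idx d. ?C q * ?W A x *
        ((-1) ^ card (slots d) * (\<Sum>p\<in>?P. epsd d (q \<circ> p) * epsd d (x \<circ> p))))" for A
    by (simp add: Omega_sum Omega_cmult Omega_monomial)
  also have "\<dots> A = (\<Sum>q\<in>idx d. \<Sum>p\<in>?P. (?C q * (-1) ^ card (slots d) * epsd d (q \<circ> p)) *
        (\<Sum>x\<in>idx d. ?W A x * epsd d (x \<circ> p)))" for A
    by (simp add: sum_distrib_left sum.swap[of _ ?P] mult_ac)
  finally have eq: "Omega d (\<lambda>g. \<Prod>k<d. (g ** Yc (l k) A ** adj2 g) $ r k $ s k) =
      (\<Sum>q\<in>idx d. \<Sum>p\<in>?P. (?C q * (-1) ^ card (slots d) * epsd d (q \<circ> p)) *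
        (\<Sum>x\<in>idx d. ?W A x * epsd d (x \<circ> p)))" for A .
  show ?thesis unfolding eq by (intro sum cmult twist_contraction) simp
qed

section \<open>The first fundamental theorem\<close>

definition mono_eval :: "(nat \<times> 3 \<times> 3) list \<Rightarrow> 'a::field trip \<Rightarrow> 'a" where
  "mono_eval m A = (\<Prod>(l, r, s)\<leftarrow>m. Yc l A $ r $ s)"

text \<open>Explicit lists of coefficients and monomials: homogeneous parts are read off from the
  length of the monomials, which a bare function does not reveal.\<close>

definition poly_eval :: "('a \<times> (nat \<times> 3 \<times> 3) list) list \<Rightarrow> 'a::field trip \<Rightarrow> 'a" where
  "poly_eval L A = (\<Sum>(c, m)\<leftarrow>L. c * mono_eval m A)"

lemma polyfun_eq_poly_eval: "f \<in> polyfun \<Longrightarrow> \<exists>L. f = poly_eval L"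
proof (induct rule: polyfun.induct)
  case (pconst c)
  then show ?case by (intro exI[of _ "[(c, [])]"]) (simp add: poly_eval_def mono_eval_def fun_eq_iff)
next
  case (pcoord k i j)
  then show ?case by (intro exI[of _ "[(1, [(k, i, j)])]"]) (simp add: poly_eval_def mono_eval_def fun_eq_iff)
next
  case (padd f g)
  then obtain K L where "f = poly_eval K" "g = poly_eval L" by blast
  then show ?case by (intro exI[of _ "K @ L"]) (simp add: poly_eval_def fun_eq_iff)
next
  case (pmul f g)
  then obtain K L where f: "f = poly_eval K" and g: "g = poly_eval L" by blast
  have one: "c * mono_eval m A * poly_eval L A = poly_eval (map (\<lambda>(c', m'). (c * c', m @ m')) L) A" for c m A
    unfolding poly_eval_def by (induct L) (auto simp: mono_eval_def algebra_simps)
  have "poly_eval K A * poly_eval L A =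
      poly_eval (concat (map (\<lambda>(c, m). map (\<lambda>(c', m'). (c * c', m @ m')) L) K)) A" for A
  proof (induct K)
    case (Cons cm K)
    obtain c m where cm: "cm = (c, m)" by force
    have "poly_eval (cm # K) A * poly_eval L A = c * mono_eval m A * poly_eval L A + poly_eval K A * poly_eval L A"
      by (simp add: poly_eval_def cm algebra_simps)
    then show ?case unfolding one Cons by (simp add: cm) (simp add: poly_eval_def)
  qed (simp add: poly_eval_def)
  then show ?case using f g by blast
qed

section \<open>Scaling and conjugation of nilpotent triples\<close>

definition smat :: "'a::comm_semiring_1 \<Rightarrow> 'a^3^3 \<Rightarrow> 'a^3^3" where
  "smat t X = (\<chi> i j. t * X $ i $ j)"

lemma smat_nth [simp]: "smat t X $ i $ j = t * X $ i $ j"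
  by (simp add: smat_def)

lemma smat_mult [simp]: "smat t X ** Y = smat t (X ** Y)" "X ** smat t Y = smat t (X ** Y)"
  by (simp_all add: matrix_matrix_mult_def vec_eq_iff sum_distrib_left mult_ac)

lemma smat_smat [simp]: "smat s (smat t X) = smat (s * t) X"
  by (simp add: vec_eq_iff mult_ac)

lemma smat_1 [simp]: "smat 1 X = X"
  by (simp add: vec_eq_iff)

lemma smat_0 [simp]: "smat t 0 = 0"
  by (simp add: vec_eq_iff)

lemma nilp_smat: "nilp X \<Longrightarrow> nilp (smat t X)"
proof -
  have "mpow (smat t X) k = smat (t ^ k) (mpow X k)" for k by (induct k) (simp_all add: mult.commute)
  then show "nilp X \<Longrightarrow> nilp (smat t X)" unfolding nilp_def by (metis smat_0)
qed

lemma nilp_conj: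
  assumes "h ** g = mat 1" "nilp X"
  shows "nilp (g ** X ** h)"
proof -
  have "mpow (g ** X ** h) (Suc k) = g ** mpow X (Suc k) ** h" for k
  proof (induct k)
    case (Suc k)
    have "mpow (g ** X ** h) (Suc (Suc k)) = (g ** X ** h) ** (g ** mpow X (Suc k) ** h)"
      using Suc by simp
    also have "\<dots> = g ** X ** (h ** g) ** mpow X (Suc k) ** h" by (simp only: matrix_mul_assoc)
    finally show ?case using assms(1) by (simp add: matrix_mul_assoc)
  qed simp
  moreover obtain k where k: "mpow X k = 0" using assms(2) by (auto simp: nilp_def)
  then have "mpow X (Suc k) = 0" by (simp add: matrix_matrix_mult_def vec_eq_iff)
  ultimately have "mpow (g ** X ** h) (Suc k) = 0" by (simp add: matrix_matrix_mult_def vec_eq_iff)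
  then show ?thesis unfolding nilp_def by blast
qed

text \<open>More general than \<open>act\<close>: it also covers scaling and X -> g X adj g for
  singular g.\<close>

definition map3 :: "('a mat3 \<Rightarrow> 'a mat3) \<Rightarrow> 'a trip \<Rightarrow> 'a trip" where
  "map3 F A = (F (fst A), F (fst (snd A)), F (snd (snd A)))"

lemma Yc_map3 [simp]: "Yc k (map3 F A) = F (Yc k A)"
  by (simp add: Yc_def map3_def)

lemma act_eq_map3: "act g h = map3 (\<lambda>X. g ** X ** h)"
  by (simp add: act_def map3_def fun_eq_iff)

lemma Nil3_map3: "A \<in> Nil3 \<Longrightarrow> (\<And>X. nilp X \<Longrightarrow> nilp (F X)) \<Longrightarrow> map3 F A \<in> Nil3"
  by (simp add: Nil3_def map3_def)

lemma Nil3_act: "(g, h) \<in> GL3 \<Longrightarrow> A \<in> Nil3 \<Longrightarrow> act g h A \<in> Nil3"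
  unfolding act_eq_map3 by (rule Nil3_map3) (auto simp: GL3_def intro: nilp_conj)

definition hom_part :: "nat \<Rightarrow> ('a \<times> (nat \<times> 3 \<times> 3) list) list \<Rightarrow> ('a \<times> (nat \<times> 3 \<times> 3) list) list" where
  "hom_part d L = filter (\<lambda>(c, m). length m = d) L"

lemma mono_eval_smat: "mono_eval m (map3 (smat t) A) = t ^ length m * mono_eval m A"
  by (induct m) (auto simp: mono_eval_def)

lemma poly_eval_hom_part_smat: "poly_eval (hom_part d L) (map3 (smat t) A) = t ^ d * poly_eval (hom_part d L) A"
  by (induct L) (auto simp: poly_eval_def hom_part_def mono_eval_smat algebra_simps)

lemma poly_eval_smat:
  "poly_eval L (map3 (smat t) A) = poly (\<Sum>(c, m)\<leftarrow>L. monom (c * mono_eval m A) (length m)) t"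
  by (induct L) (auto simp: poly_eval_def mono_eval_smat poly_monom)

lemma coeff_hom_part:
  "coeff (\<Sum>(c, m)\<leftarrow>L. monom (c * mono_eval m A) (length m)) d = poly_eval (hom_part d L) A"
  by (induct L) (auto simp: poly_eval_def hom_part_def)

lemma poly_eval_eq_sum_hom_part:
  assumes "\<And>c m. (c, m) \<in> set L \<Longrightarrow> length m < N"
  shows "poly_eval L A = (\<Sum>d<N. poly_eval (hom_part d L) A)"
  using assms
proof (induct L)
  case (Cons cm L)
  obtain c m where cm: "cm = (c, m)" by force
  have "(\<Sum>d<N. poly_eval (hom_part d (cm # L)) A) =
      (\<Sum>d<N. (if d = length m then c * mono_eval m A else 0) + poly_eval (hom_part d L) A)"
    by (intro sum.cong refl) (auto simp: cm hom_part_def poly_eval_def)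
  moreover have "length m < N" using Cons.prems cm by auto
  moreover have "poly_eval L A = (\<Sum>d<N. poly_eval (hom_part d L) A)"
    using Cons.prems by (intro Cons.hyps) auto
  moreover have "poly_eval (cm # L) A = c * mono_eval m A + poly_eval L A"
    by (simp add: cm poly_eval_def)
  ultimately show ?case by (simp add: sum.distrib)
qed (simp add: poly_eval_def hom_part_def)

text \<open>Scaling by t preserves the nilpotent triples and commutes with conjugation. Both sides
  thus come from polynomials in t that agree everywhere, and the coefficients of t^d coincide
  because the field is infinite.\<close>

lemma hom_part_invariant:
  fixes L :: "('a::field_char_0 \<times> (nat \<times> 3 \<times> 3) list) list"
  assumes inv: "\<And>A. A \<in> Nil3 \<Longrightarrow> poly_eval L (act g h A) = poly_eval L A" and A: "A \<in> Nil3"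
  shows "poly_eval (hom_part d L) (act g h A) = poly_eval (hom_part d L) A"
proof -
  let ?p = "\<lambda>A. \<Sum>(c, m)\<leftarrow>L. monom (c * mono_eval m A) (length m)"
  have "poly (?p (act g h A)) t = poly (?p A) t" for t
  proof -
    have "map3 (smat t) (act g h A) = act g h (map3 (smat t) A)"
      by (simp add: act_eq_map3 map3_def)
    then show ?thesis
      unfolding poly_eval_smat[symmetric] using inv[OF Nil3_map3[OF A nilp_smat]] by simp
  qed
  then have "?p (act g h A) = ?p A" by (simp add: poly_eq_poly_eq_iff[symmetric] fun_eq_iff)
  then show ?thesis unfolding coeff_hom_part[symmetric] by simp
qed

section \<open>Polynomial functions of one variable, and singular g\<close>

definition polynomial_fun :: "('a::comm_ring_1 \<Rightarrow> 'a) \<Rightarrow> bool" where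
  "polynomial_fun f \<longleftrightarrow> (\<exists>p. \<forall>t. f t = poly p t)"

lemma polynomial_funI: "(\<And>t. f t = poly p t) \<Longrightarrow> polynomial_fun f"
  unfolding polynomial_fun_def by blast

lemma polynomial_fun_const: "polynomial_fun (\<lambda>_. c)"
  by (rule polynomial_funI[of _ "[:c:]"]) simp

lemma polynomial_fun_ident: "polynomial_fun (\<lambda>t. t)"
  by (rule polynomial_funI[of _ "[:0, 1:]"]) simp

lemma polynomial_fun_add: "polynomial_fun f \<Longrightarrow> polynomial_fun g \<Longrightarrow> polynomial_fun (\<lambda>t. f t + g t)"
  unfolding polynomial_fun_def by (metis poly_add)

lemma polynomial_fun_diff: "polynomial_fun f \<Longrightarrow> polynomial_fun g \<Longrightarrow> polynomial_fun (\<lambda>t. f t - g t)"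
  unfolding polynomial_fun_def by (metis poly_diff)

lemma polynomial_fun_mult: "polynomial_fun f \<Longrightarrow> polynomial_fun g \<Longrightarrow> polynomial_fun (\<lambda>t. f t * g t)"
  unfolding polynomial_fun_def by (metis poly_mult)

lemma polynomial_fun_power: "polynomial_fun f \<Longrightarrow> polynomial_fun (\<lambda>t. f t ^ n)"
  by (induct n) (simp_all add: polynomial_fun_const polynomial_fun_mult)

lemma polynomial_fun_sum: "(\<And>i. i \<in> I \<Longrightarrow> polynomial_fun (f i)) \<Longrightarrow> polynomial_fun (\<lambda>t. \<Sum>i\<in>I. f i t)"
  by (induct I rule: infinite_finite_induct) (simp_all add: polynomial_fun_const polynomial_fun_add)

lemma polynomial_fun_prod: "(\<And>i. i \<in> I \<Longrightarrow> polynomial_fun (f i)) \<Longrightarrow> polynomial_fun (\<lambda>t. \<Prod>i\<in>I. f i t)"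
  by (induct I rule: infinite_finite_induct) (simp_all add: polynomial_fun_const polynomial_fun_mult)

lemma polynomial_fun_poly_eval:
  assumes "\<And>l r s. polynomial_fun (\<lambda>t. Yc l (A t) $ r $ s)"
  shows "polynomial_fun (\<lambda>t. poly_eval L (A t))"
proof -
  have "polynomial_fun (\<lambda>t. mono_eval m (A t))" for m
    by (induct m) (auto simp: mono_eval_def polynomial_fun_const intro: polynomial_fun_mult assms)
  then show ?thesis
    unfolding poly_eval_def
    by (induct L) (auto simp: polynomial_fun_const intro!: polynomial_fun_mult polynomial_fun_add)
qed

text \<open>A density argument on a line: \<open>f * q\<close> vanishes identically, and polynomials
  over an infinite field have no zero divisors.\<close>

lemma polynomial_fun_zero:
  fixes f q :: "'a::field_char_0 \<Rightarrow> 'a"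
  assumes "polynomial_fun f" "polynomial_fun q" "\<And>t. q t \<noteq> 0 \<Longrightarrow> f t = 0" "q s \<noteq> 0"
  shows "f t = 0"
proof -
  obtain p p' where p: "\<And>t. f t = poly p t" and p': "\<And>t. q t = poly p' t"
    using assms(1,2) unfolding polynomial_fun_def by blast
  have "poly (p * p') t = 0" for t using assms(3)[of t] p p' by (cases "q t = 0") auto
  then have "p * p' = 0" using poly_all_0_iff_0 by blast
  moreover have "p' \<noteq> 0" using assms(4) p' by auto
  ultimately show ?thesis using p by simp
qed

text \<open>For invertible g, \<open>adj2 g\<close> is \<open>2 * det g\<close> times the inverse,
  so homogeneity pulls out the scalar. The omega operator evaluates also at singular matrices, which
  are reached by specialization along a line.\<close>

lemma hom_part_conj_adj2:
  fixes L :: "('a::field_char_0 \<times> (nat \<times> 3 \<times> 3) list) list"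
  assumes inv: "\<And>g h. (g, h) \<in> GL3 \<Longrightarrow> poly_eval (hom_part d L) (act g h A) = poly_eval (hom_part d L) A"
  shows "poly_eval (hom_part d L) (map3 (\<lambda>X. g ** X ** adj2 g) A) = (2 * det g) ^ d * poly_eval (hom_part d L) A"
proof -
  let ?F = "poly_eval (hom_part d L)"
  have nonsing: "?F (map3 (\<lambda>X. g ** X ** adj2 g) A) = (2 * det g) ^ d * ?F A" if det: "det g \<noteq> 0" for g
  proof -
    obtain h where gh: "g ** h = mat 1" and hg: "h ** g = mat 1"
      using det unfolding invertible_det_nz[symmetric] invertible_def by blast
    have "adj2 g = h ** (g ** adj2 g)" by (simp add: matrix_mul_assoc hg)
    also have "g ** adj2 g = smat (2 * det g) (mat 1)"
      unfolding matrix_mult_adj2 by (simp add: vec_eq_iff mat_def)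
    finally have "adj2 g = smat (2 * det g) h" by simp
    then have "map3 (\<lambda>X. g ** X ** adj2 g) A = map3 (smat (2 * det g)) (act g h A)"
      by (simp add: act_eq_map3 map3_def)
    then show ?thesis using inv[of g h] gh hg by (simp add: poly_eval_hom_part_smat GL3_def)
  qed
  \<comment> \<open>The line from \<open>g\<close> at t = 0 to the identity at t = 1. Its
    determinant is a polynomial in t that is nonzero at 1, so the identity extends to t = 0.\<close>
  define G where "G t = (\<chi> i j. (1 - t) * g $ i $ j + t * (if i = j then 1 else 0))" for t
  define f where "f t = ?F (map3 (\<lambda>X. G t ** X ** adj2 (G t)) A) - (2 * det (G t)) ^ d * ?F A" for t
  have G: "polynomial_fun (\<lambda>t. G t $ i $ j)" for i j
    unfolding G_def vec_lambda_beta
    by (intro polynomial_fun_add polynomial_fun_mult polynomial_fun_diff polynomial_fun_const polynomial_fun_ident)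
  have dG: "polynomial_fun (\<lambda>t. det (G t))"
    unfolding det_def by (intro polynomial_fun_sum polynomial_fun_mult polynomial_fun_prod polynomial_fun_const G)
  have "polynomial_fun (\<lambda>t. adj2 (G t) $ i $ j)" for i j
    unfolding adj2_def vec_lambda_beta
    by (intro polynomial_fun_sum polynomial_fun_mult polynomial_fun_const G)
  then have "polynomial_fun (\<lambda>t. (G t ** X ** adj2 (G t)) $ i $ j)" for i j X
    unfolding matrix_matrix_mult_def vec_lambda_beta
    by (intro polynomial_fun_sum polynomial_fun_mult polynomial_fun_const G)
  then have "polynomial_fun f"
    unfolding f_def
    by (intro polynomial_fun_diff polynomial_fun_poly_eval polynomial_fun_mult polynomial_fun_power
        polynomial_fun_const dG) simp
  moreover have "f t = 0" if "det (G t) \<noteq> 0" for t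
    unfolding f_def using nonsing[OF that] by simp
  moreover have "G 1 = mat 1" by (simp add: G_def mat_def vec_eq_iff)
  ultimately have "f 0 = 0" using dG polynomial_fun_zero[of f "\<lambda>t. det (G t)" 1 0] by simp
  moreover have "G 0 = g" by (simp add: G_def vec_eq_iff)
  ultimately show ?thesis by (simp add: f_def)
qed

text \<open>Applying the omega operator in \<open>g\<close> to
  \<open>f (g A adj g) = det g ^ d * f A\<close> expresses \<open>f A\<close> through traces.\<close>

lemma (in trace_algebra) invariant_hom_part:
  assumes char: "(\<And>d. Omega d (\<lambda>g. det g ^ d) \<noteq> (0::'a))" and two: "(2::'a) \<noteq> 0"
    and inv: "\<And>g A. A \<in> Nil3 \<Longrightarrow>
      poly_eval (hom_part d L) (map3 (\<lambda>X. g ** X ** adj2 g) A) = (2 * det g) ^ d * poly_eval (hom_part d L) A"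
  shows "\<exists>t\<in>T. \<forall>A\<in>Nil3. poly_eval (hom_part d L) A = t A"
proof -
  let ?c = "2 ^ d * Omega d (\<lambda>g. det g ^ d) :: 'a"
  let ?\<Omega> = "\<lambda>A. Omega d (\<lambda>g. poly_eval (hom_part d L) (map3 (\<lambda>X. g ** X ** adj2 g) A))"
  have mono: "(\<lambda>A. Omega d (\<lambda>g. mono_eval m (map3 (\<lambda>X. g ** X ** adj2 g) A))) \<in> T" if "length m = d" for m
  proof -
    have "mono_eval m (map3 (\<lambda>X. g ** X ** adj2 g) A) =
       (\<Prod>k<d. (g ** Yc (fst (m ! k)) A ** adj2 g) $ fst (snd (m ! k)) $ snd (snd (m ! k)))" for g and A :: "'a trip"
      unfolding mono_eval_def that[symmetric]
      by (simp add: prod.list_conv_set_nth case_prod_unfold atLeast0LessThan)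
    then show ?thesis using Omega_conj_monomial[of d "\<lambda>k. fst (m ! k)" "\<lambda>k. fst (snd (m ! k))" "\<lambda>k. snd (snd (m ! k))"] by simp
  qed
  have "(\<lambda>A. Omega d (\<lambda>g. poly_eval (hom_part d L) (map3 (\<lambda>X. g ** X ** adj2 g) A))) \<in> T"
  proof (induct L)
    case Nil
    have "Omega d (\<lambda>g. 0) = 0" using Omega_cmult[of d 0] by simp
    then show ?case by (simp add: poly_eval_def hom_part_def const)
  next
    case (Cons cm L)
    obtain c m where cm: "cm = (c, m)" by force
    show ?case
    proof (cases "length m = d")
      case True
      have "Omega d (\<lambda>g. poly_eval (hom_part d (cm # L)) (map3 (\<lambda>X. g ** X ** adj2 g) A)) =
         c * Omega d (\<lambda>g. mono_eval m (map3 (\<lambda>X. g ** X ** adj2 g) A)) +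
         Omega d (\<lambda>g. poly_eval (hom_part d L) (map3 (\<lambda>X. g ** X ** adj2 g) A))" for A
        using True by (simp add: cm hom_part_def poly_eval_def Omega_add Omega_cmult)
      then show ?thesis using add[OF cmult[OF mono[OF True]] Cons, of c] by simp
    qed (use Cons cm in \<open>simp add: hom_part_def\<close>)
  qed
  then have "(\<lambda>A. inverse ?c * ?\<Omega> A) \<in> T" by (rule cmult)
  moreover have "poly_eval (hom_part d L) A = inverse ?c * ?\<Omega> A" if "A \<in> Nil3" for A
  proof -
    have "?\<Omega> A = Omega d (\<lambda>g. (2 ^ d * poly_eval (hom_part d L) A) * det g ^ d)"
      using inv[OF that] by (simp add: power_mult_distrib mult_ac)
    also have "\<dots> = ?c * poly_eval (hom_part d L) A" by (simp add: Omega_cmult)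
    finally have eq: "?\<Omega> A = ?c * poly_eval (hom_part d L) A" .
    have c: "?c \<noteq> 0" using char[of d] two by simp
    have "inverse c * (c * y) = y" if "c \<noteq> 0" for c y :: 'a using that by simp
    from this[OF c] show ?thesis by (simp only: eq)
  qed
  ultimately show ?thesis by (intro bexI[where x = "\<lambda>A. inverse ?c * ?\<Omega> A"] ballI)
qed

lemma first_fundamental_theorem:
  fixes T :: "('a::field_char_0 trip \<Rightarrow> 'a) set"
  assumes T: "trace_algebra T" and "f \<in> Inv"
  shows "\<exists>t\<in>T. f = onN t"
proof -
  interpret trace_algebra T by (rule T)
  obtain F where F: "F \<in> polyfun" "f = onN F" using assms(2) by (auto simp: Inv_def Oring_def)
  obtain L where L: "F = poly_eval L" using polyfun_eq_poly_eval[OF F(1)] by blast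
  have inv: "poly_eval L (act g h A) = poly_eval L A" if "(g, h) \<in> GL3" "A \<in> Nil3" for g h A
  proof -
    have "f (act g h A) = f A" using assms(2) that by (auto simp: Inv_def)
    then show ?thesis using that Nil3_act[OF that] by (simp add: F(2) L onN_def)
  qed
  \<comment> \<open>The inserted 0 keeps \<open>Max\<close> meaningful when \<open>L\<close> is
    empty.\<close>
  define N where "N = Suc (Max (insert 0 (length ` snd ` set L)))"
  have N: "length m < N" if "(c, m) \<in> set L" for c m
    unfolding N_def less_Suc_eq_le by (rule Max_ge) (use that in force)+
  have "\<exists>t\<in>T. \<forall>A\<in>Nil3. poly_eval (hom_part d L) A = t A" for d
    by (rule invariant_hom_part[OF Omega_det_power_nonzero _ hom_part_conj_adj2[OF hom_part_invariant[OF inv]]]) auto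
  then obtain t where t: "\<And>d. t d \<in> T" "\<And>d A. A \<in> Nil3 \<Longrightarrow> poly_eval (hom_part d L) A = t d A"
    by metis
  have "f = onN (\<lambda>A. \<Sum>d<N. t d A)"
  proof
    fix A
    show "f A = onN (\<lambda>A. \<Sum>d<N. t d A) A"
      using poly_eval_eq_sum_hom_part[of L N A, OF N] t(2) by (cases "A \<in> Nil3") (simp_all add: F(2) L onN_def)
  qed
  then show ?thesis using sum[of "{..<N}" t, OF t(1)] by blast
qed

section \<open>Words modulo the identity \<open>x ^ 3 = 0\<close>\<close>

text \<open>In characteristic zero the identity \<open>x ^ 3 = 0\<close> forces nilpotency of index 6.  The chain of
  relations below was found by linear algebra over the words with given letter multiplicities.\<close>

lemma nil3_words6:
  fixes s :: "nat list \<Rightarrow> rat"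
  assumes R: "\<And>u a b c v. a \<noteq> [] \<Longrightarrow> b \<noteq> [] \<Longrightarrow> c \<noteq> [] \<Longrightarrow> length (u @ a @ b @ c @ v) = 6 \<Longrightarrow>
      s (u @ a @ b @ c @ v) + s (u @ a @ c @ b @ v) + s (u @ b @ a @ c @ v) +
      s (u @ b @ c @ a @ v) + s (u @ c @ a @ b @ v) + s (u @ c @ b @ a @ v) = 0"
    and "length w = 6" "set w \<subseteq> {1, 2, 3}"
  shows "s w = 0"
proof -
  \<comment> \<open>Each equation is proved for arbitrary letters, so one line covers all renamings;
    the letters may also coincide.\<close>
  have [simp]: "s [i, i, i, i, i, i] = 0" for i j k
    using R[of "[i]" "[i]" "[i]" "[]" "[i, i, i]"] by simp
  have [simp]: "s [i, i, i, i, i, j] = 0" for i j k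
    using R[of "[i]" "[i]" "[i]" "[]" "[i, i, j]"] by simp
  have [simp]: "s [i, i, i, i, j, i] = 0" for i j k
    using R[of "[i]" "[i]" "[i]" "[]" "[i, j, i]"] by simp
  have [simp]: "s [i, i, i, j, i, i] = 0" for i j k
    using R[of "[i]" "[i]" "[i, i, i, j]" "[]" "[]"] by simp
  have [simp]: "s [i, i, j, i, i, i] = 0" for i j k
    using R[of "[i]" "[i, i]" "[i, i, j]" "[]" "[]"] by simp
  have [simp]: "s [i, j, i, i, i, i] = 0" for i j k
    using R[of "[i]" "[i, i, i]" "[i, j]" "[]" "[]"] by simp
  have [simp]: "s [j, i, i, i, i, i] = 0" for i j k
    using R[of "[i]" "[i, i, i, i]" "[j]" "[]" "[]"] by simp
  have [simp]: "s [i, i, i, i, j, j] = 0" for i j k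
    using R[of "[i]" "[i]" "[i]" "[]" "[i, j, j]"] by simp
  have [simp]: "s [i, i, i, j, i, j] = 0" for i j k
    using R[of "[i]" "[i]" "[i]" "[]" "[j, i, j]"] by simp
  have [simp]: "s [i, i, i, j, j, i] = 0" for i j k
    using R[of "[i]" "[j]" "[j]" "[i, i, i]" "[]"] by simp
  have [simp]: "s [i, i, j, i, i, j] = 0" for i j k
    using R[of "[i]" "[i]" "[i, i, j]" "[]" "[j]"] by simp
  have [simp]: "s [i, i, j, i, j, i] = 0" for i j k
    using R[of "[i]" "[i, j]" "[j]" "[i, i]" "[]"] by simp
  have [simp]: "s [i, i, j, j, i, i] = 0" for i j k
    using R[of "[i]" "[i]" "[i, i, j, j]" "[]" "[]"] by simp
  have [simp]: "s [i, j, i, i, i, j] = 0" for i j k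
    using R[of "[i]" "[i, i]" "[i, j]" "[]" "[j]"] by simp
  have [simp]: "s [i, j, i, i, j, i] = 0" for i j k
    using R[of "[i]" "[i, i, j]" "[j]" "[i]" "[]"] by simp
  have [simp]: "s [i, j, i, j, i, i] = 0" for i j k
    using R[of "[i, i]" "[i, j]" "[j]" "[i]" "[]"] by simp
  have [simp]: "s [i, j, j, i, i, i] = 0" for i j k
    using R[of "[i]" "[i, i]" "[i, j, j]" "[]" "[]"] by simp
  have [simp]: "s [j, i, i, i, i, j] = 0" for i j k
    using R[of "[i]" "[i, i, i]" "[j]" "[]" "[j]"] by simp
  have [simp]: "s [j, i, i, i, j, i] = 0" for i j k
    using R[of "[i]" "[i, i, i, j]" "[j]" "[]" "[]"] by simp
  have [simp]: "s [j, i, i, j, i, i] = 0" for i j k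
    using R[of "[i, i]" "[i, i, j]" "[j]" "[]" "[]"] by simp
  have [simp]: "s [j, i, j, i, i, i] = 0" for i j k
    using R[of "[i, i, i]" "[i, j]" "[j]" "[]" "[]"] by simp
  have [simp]: "s [j, j, i, i, i, i] = 0" for i j k
    using R[of "[i]" "[i, i, i]" "[j, j]" "[]" "[]"] by simp
  have [simp]: "s [i, i, i, i, j, k] = 0" for i j k
    using R[of "[i]" "[i]" "[i]" "[]" "[i, j, k]"] by simp
  have [simp]: "s [i, i, i, j, i, k] = 0" for i j k
    using R[of "[i]" "[i]" "[i]" "[]" "[j, i, k]"] by simp
  have [simp]: "s [i, i, i, j, k, i] = 0" for i j k
    using R[of "[i]" "[i]" "[i]" "[]" "[j, k, i]"] by simp
  have [simp]: "s [i, i, j, i, i, k] = 0" for i j k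
    using R[of "[i]" "[i]" "[i, i, j]" "[]" "[k]"] by simp
  have [simp]: "s [i, i, j, i, k, i] = 0" for i j k
    using R[of "[i]" "[i, k]" "[j]" "[i, i]" "[]"] by simp
  have [simp]: "s [i, i, j, k, i, i] = 0" for i j k
    using R[of "[i]" "[i]" "[i, i, j, k]" "[]" "[]"] by simp
  have [simp]: "s [i, j, i, i, i, k] = 0" for i j k
    using R[of "[i]" "[i, i]" "[i, j]" "[]" "[k]"] by simp
  have [simp]: "s [i, j, i, i, k, i] = 0" for i j k
    using R[of "[i]" "[i, i, k]" "[j]" "[i]" "[]"] by simp
  have [simp]: "s [i, j, i, k, i, i] = 0" for i j k
    using R[of "[i, i]" "[i, k]" "[j]" "[i]" "[]"] by simp
  have [simp]: "s [i, j, k, i, i, i] = 0" for i j k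
    using R[of "[i]" "[i, i]" "[i, j, k]" "[]" "[]"] by simp
  have [simp]: "s [j, i, i, i, i, k] = 0" for i j k
    using R[of "[i]" "[i, i, i]" "[j]" "[]" "[k]"] by simp
  have [simp]: "s [j, i, i, i, k, i] = 0" for i j k
    using R[of "[i]" "[i, i, i, k]" "[j]" "[]" "[]"] by simp
  have [simp]: "s [j, i, i, k, i, i] = 0" for i j k
    using R[of "[i, i]" "[i, i, k]" "[j]" "[]" "[]"] by simp
  have [simp]: "s [j, i, k, i, i, i] = 0" for i j k
    using R[of "[i, i, i]" "[i, k]" "[j]" "[]" "[]"] by simp
  have [simp]: "s [j, k, i, i, i, i] = 0" for i j k
    using R[of "[i]" "[i, i, i]" "[j, k]" "[]" "[]"] by simp
  have [simp]: "s [i, i, i, j, j, j] = 0" for i j k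
    using R[of "[i]" "[i]" "[i]" "[]" "[j, j, j]"] by simp
  have [simp]: "s [i, i, j, j, j, i] = 0" for i j k
    using R[of "[j]" "[j]" "[j]" "[i, i]" "[i]"] by simp
  have [simp]: "s [i, j, i, j, i, j] = 0" for i j k
    using R[of "[i, j]" "[i, j]" "[i, j]" "[]" "[]"] by simp
  have [simp]: "s [i, j, j, j, i, i] = 0" for i j k
    using R[of "[i]" "[i]" "[i, j, j, j]" "[]" "[]"] by simp
  \<comment> \<open>The first word not settled by a single relation: several relations are combined
    and solved as a linear system over the rationals.\<close>
  have [simp]: "s [i, j, i, j, j, i] = 0" for i j k
    using R[of "[i, j, i]" "[j]" "[j]" "[]" "[i]"]
      R[of "[i]" "[i]" "[j, i, j]" "[j]" "[]"]
      R[of "[i, j, i]" "[j]" "[j, i]" "[]" "[]"]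
      R[of "[i]" "[i, i]" "[j]" "[j, j]" "[]"]
    by (simp; linarith)
  have [simp]: "s [i, i, j, i, j, j] = 0" for i j k
    using R[of "[i]" "[i]" "[j, i, j]" "[]" "[j]"] by simp
  have [simp]: "s [i, i, j, j, i, j] = 0" for i j k
    using R[of "[i]" "[j]" "[j]" "[i, i]" "[j]"] by simp
  have [simp]: "s [i, j, i, i, j, j] = 0" for i j k
    using R[of "[i]" "[i]" "[i, j]" "[]" "[j, j]"] by simp
  have [simp]: "s [i, j, j, i, i, j] = 0" for i j k
    using R[of "[i]" "[i]" "[i, j, j]" "[]" "[j]"] by simp
  have [simp]: "s [i, j, j, i, j, i] = 0" for i j k
    using R[of "[i]" "[i, j]" "[j, j]" "[i]" "[]"] by simp
  have [simp]: "s [i, i, i, j, j, k] = 0" for i j k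
    using R[of "[i]" "[i]" "[i]" "[]" "[j, j, k]"] by simp
  have [simp]: "s [i, i, i, j, k, j] = 0" for i j k
    using R[of "[i]" "[i]" "[i]" "[]" "[j, k, j]"] by simp
  have [simp]: "s [i, i, i, k, j, j] = 0" for i j k
    using R[of "[j]" "[j]" "[k]" "[i, i, i]" "[]"] by simp
  have [simp]: "s [i, j, i, j, i, k] = 0" for i j k
    using R[of "[i]" "[i]" "[j]" "[i, j]" "[k]"]
      R[of "[i, i]" "[j]" "[j]" "[i]" "[k]"]
    by (simp; linarith)
  have [simp]: "s [j, i, i, i, j, k] = 0" for i j k
    using R[of "[i]" "[i]" "[i]" "[j]" "[j, k]"] by simp
  have [simp]: "s [j, i, i, i, k, j] = 0" for i j k
    using R[of "[i]" "[i]" "[i]" "[j]" "[k, j]"] by simp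
  have [simp]: "s [j, j, i, i, i, k] = 0" for i j k
    using R[of "[i, i, i]" "[j]" "[j]" "[]" "[k]"] by simp
  have [simp]: "s [j, j, k, i, i, i] = 0" for i j k
    using R[of "[i]" "[i]" "[i]" "[j, j, k]" "[]"] by simp
  have [simp]: "s [j, k, i, i, i, j] = 0" for i j k
    using R[of "[i]" "[i]" "[i]" "[j, k]" "[j]"] by simp
  have [simp]: "s [j, k, j, i, i, i] = 0" for i j k
    using R[of "[i, i, i]" "[j]" "[j, k]" "[]" "[]"] by simp
  have [simp]: "s [k, i, i, i, j, j] = 0" for i j k
    using R[of "[j]" "[j]" "[k, i, i, i]" "[]" "[]"] by simp
  have [simp]: "s [k, i, j, i, j, i] = 0" for i j k
    using R[of "[i]" "[i]" "[j]" "[k, i, j]" "[]"]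
      R[of "[i, i]" "[j]" "[j]" "[k, i]" "[]"]
    by (simp; linarith)
  have [simp]: "s [k, j, i, i, i, j] = 0" for i j k
    using R[of "[i, i, i, j]" "[j]" "[k]" "[]" "[]"] by simp
  have [simp]: "s [k, j, j, i, i, i] = 0" for i j k
    using R[of "[i, i, i]" "[j, j]" "[k]" "[]" "[]"] by simp
  have [simp]: "s [i, j, i, k, i, j] = 0" for i j k
    using R[of "[i]" "[i]" "[j, i, k]" "[]" "[j]"]
      R[of "[i]" "[i]" "[k]" "[j, i]" "[j]"]
      R[of "[i]" "[i]" "[j]" "[]" "[k, i, j]"]
      R[of "[i]" "[i]" "[j]" "[i]" "[k, j]"]
      R[of "[i]" "[i]" "[k]" "[i, j]" "[j]"]
      R[of "[i]" "[i]" "[j, k, i]" "[]" "[j]"]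
    by (simp; linarith)
  have [simp]: "s [i, k, i, j, i, j] = 0" for i j k
    using R[of "[i, j]" "[i, j]" "[i, k]" "[]" "[]"] by simp
  have [simp]: "s [i, i, k, j, j, i] = 0" for i j k
    using R[of "[i]" "[i]" "[j, j]" "[i, k]" "[]"]
      R[of "[i]" "[j]" "[j]" "[i, k, i]" "[]"]
      R[of "[i]" "[i]" "[k, j, j]" "[i]" "[]"]
    by (simp; linarith)
  have [simp]: "s [i, k, j, j, i, i] = 0" for i j k
    using R[of "[i]" "[i]" "[i, k, j, j]" "[]" "[]"] by simp
  have [simp]: "s [i, i, k, i, j, j] = 0" for i j k
    using R[of "[i]" "[i]" "[k, i, j, j]" "[]" "[]"]
      R[of "[i]" "[i]" "[j, j]" "[i, k]" "[]"]
      R[of "[i]" "[i]" "[j, j, i]" "[k]" "[]"]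
      R[of "[i]" "[i]" "[k]" "[]" "[j, j, i]"]
      R[of "[i]" "[i]" "[k]" "[]" "[i, j, j]"]
    by (simp; linarith)
  have [simp]: "s [i, i, k, j, i, j] = 0" for i j k
    using R[of "[i]" "[j]" "[j]" "[i, i, k]" "[]"] by simp
  have [simp]: "s [i, j, i, k, j, i] = 0" for i j k
    using R[of "[i, k]" "[j]" "[j]" "[i]" "[i]"]
      R[of "[i, k, i]" "[j]" "[j]" "[i]" "[]"]
    by (simp; linarith)
  have [simp]: "s [i, j, j, i, k, i] = 0" for i j k
    using R[of "[i, k, i]" "[j]" "[j]" "[i]" "[]"] by simp
  have [simp]: "s [i, k, i, i, j, j] = 0" for i j k
    using R[of "[i]" "[i]" "[i, k]" "[]" "[j, j]"] by simp
  have [simp]: "s [i, k, i, j, j, i] = 0" for i j k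
    using R[of "[i]" "[i]" "[j, j]" "[i, k]" "[]"] by simp
  have [simp]: "s [i, k, j, i, i, j] = 0" for i j k
    using R[of "[i]" "[i]" "[i, k, j]" "[]" "[j]"] by simp
  have [simp]: "s [i, k, j, i, j, i] = 0" for i j k
    using R[of "[j, i]" "[j, i]" "[k]" "[i]" "[]"] by simp
  have [simp]: "s [j, i, i, j, k, i] = 0" for i j k
    using R[of "[i, i]" "[j]" "[j]" "[]" "[k, i]"]
      R[of "[i]" "[i]" "[j, j]" "[]" "[k, i]"]
    by (simp; linarith)
  have [simp]: "s [j, i, j, k, i, i] = 0" for i j k
    using R[of "[i]" "[i]" "[i, j, k]" "[j]" "[]"] by simp
  have [simp]: "s [j, k, i, i, j, i] = 0" for i j k
    using R[of "[j]" "[j]" "[k, i, i]" "[]" "[i]"]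
      R[of "[i]" "[i]" "[k]" "[]" "[j, j, i]"]
    by (simp; linarith)
  have [simp]: "s [j, k, i, j, i, i] = 0" for i j k
    using R[of "[i]" "[i]" "[i, j]" "[j, k]" "[]"] by simp
  have [simp]: "s [k, i, i, j, i, j] = 0" for i j k
    using R[of "[i]" "[i]" "[k]" "[]" "[j, i, j]"] by simp
  have [simp]: "s [k, i, i, j, j, i] = 0" for i j k
    using R[of "[i]" "[i]" "[k]" "[]" "[j, j, i]"] by simp
  have [simp]: "s [k, i, j, i, i, j] = 0" for i j k
    using R[of "[i]" "[i]" "[k, i, j]" "[]" "[j]"] by simp
  have [simp]: "s [k, i, j, j, i, i] = 0" for i j k
    using R[of "[i]" "[i]" "[k, i, j, j]" "[]" "[]"] by simp
  have [simp]: "s [k, j, i, i, j, i] = 0" for i j k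
    using R[of "[i]" "[i]" "[k, j]" "[]" "[j, i]"] by simp
  have [simp]: "s [k, j, i, j, i, i] = 0" for i j k
    using R[of "[i]" "[i]" "[k, j, i, j]" "[]" "[]"] by simp
  have [simp]: "s [i, i, j, i, j, k] = 0" for i j k
    using R[of "[i, i]" "[i, j, k]" "[j]" "[]" "[]"]
      R[of "[i, j]" "[j]" "[k, i, i]" "[]" "[]"]
      R[of "[j]" "[j]" "[k]" "[i]" "[i, i]"]
      R[of "[i]" "[i, j]" "[k, j, i]" "[]" "[]"]
      R[of "[i, i]" "[j, i]" "[j, k]" "[]" "[]"]
    by (simp; linarith)
  have [simp]: "s [i, i, j, i, k, j] = 0" for i j k
    using R[of "[i]" "[j]" "[j, i, k]" "[i]" "[]"]
      R[of "[i]" "[j]" "[j]" "[i, i]" "[k]"]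
    by (simp; linarith)
  have [simp]: "s [i, i, j, j, i, k] = 0" for i j k
    using R[of "[i]" "[j]" "[j]" "[i, i]" "[k]"] by simp
  have [simp]: "s [i, i, j, j, k, i] = 0" for i j k
    using R[of "[i]" "[i, i, j, j]" "[k]" "[]" "[]"] by simp
  have [simp]: "s [i, i, j, k, i, j] = 0" for i j k
    using R[of "[i, j]" "[j]" "[k]" "[i, i]" "[]"] by simp
  have [simp]: "s [i, i, j, k, j, i] = 0" for i j k
    using R[of "[i]" "[j]" "[j, k]" "[i, i]" "[]"] by simp
  have [simp]: "s [i, j, i, i, j, k] = 0" for i j k
    using R[of "[i]" "[i]" "[i, j]" "[]" "[j, k]"] by simp
  have [simp]: "s [i, j, i, i, k, j] = 0" for i j k
    using R[of "[i]" "[i]" "[i, j]" "[]" "[k, j]"] by simp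
  have [simp]: "s [i, j, i, j, k, i] = 0" for i j k
    using R[of "[i]" "[i, j, k]" "[j]" "[i]" "[]"] by simp
  have [simp]: "s [i, j, j, i, i, k] = 0" for i j k
    using R[of "[i]" "[i]" "[i, j, j]" "[]" "[k]"] by simp
  have [simp]: "s [i, j, j, k, i, i] = 0" for i j k
    using R[of "[i]" "[i]" "[i, j, j, k]" "[]" "[]"] by simp
  have [simp]: "s [i, j, k, i, i, j] = 0" for i j k
    using R[of "[i]" "[i, i, j]" "[j, k]" "[]" "[]"] by simp
  have [simp]: "s [i, j, k, i, j, i] = 0" for i j k
    using R[of "[i]" "[i, j]" "[j, k]" "[i]" "[]"] by simp
  have [simp]: "s [i, j, k, j, i, i] = 0" for i j k
    using R[of "[i, i]" "[j]" "[j, k]" "[i]" "[]"] by simp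
  have [simp]: "s [j, i, i, j, i, k] = 0" for i j k
    using R[of "[i]" "[i, i, j]" "[j]" "[]" "[k]"] by simp
  have [simp]: "s [j, i, i, k, i, j] = 0" for i j k
    using R[of "[i]" "[i, i, k]" "[j]" "[]" "[j]"] by simp
  have [simp]: "s [j, i, i, k, j, i] = 0" for i j k
    using R[of "[i]" "[i, i, k, j]" "[j]" "[]" "[]"] by simp
  have [simp]: "s [j, i, j, i, i, k] = 0" for i j k
    using R[of "[i, i]" "[i, j]" "[j]" "[]" "[k]"] by simp
  have [simp]: "s [j, i, j, i, k, i] = 0" for i j k
    using R[of "[i]" "[i, j, i, k]" "[j]" "[]" "[]"] by simp
  have [simp]: "s [j, i, k, i, i, j] = 0" for i j k
    using R[of "[i, i]" "[i, k]" "[j]" "[]" "[j]"] by simp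
  have [simp]: "s [j, i, k, i, j, i] = 0" for i j k
    using R[of "[i]" "[i, j]" "[j, i, k]" "[]" "[]"] by simp
  have [simp]: "s [j, i, k, j, i, i] = 0" for i j k
    using R[of "[i, i]" "[i, k, j]" "[j]" "[]" "[]"] by simp
  have [simp]: "s [j, j, i, i, k, i] = 0" for i j k
    using R[of "[i]" "[i, i, k]" "[j, j]" "[]" "[]"] by simp
  have [simp]: "s [j, j, i, k, i, i] = 0" for i j k
    using R[of "[i, i]" "[i, k]" "[j, j]" "[]" "[]"] by simp
  have [simp]: "s [i, i, j, j, k, k] = 0" for i j k
    using R[of "[i]" "[i]" "[j, j, k]" "[]" "[k]"]
      R[of "[i, i]" "[k]" "[k]" "[j, j]" "[]"]
      R[of "[i]" "[i]" "[j, j]" "[]" "[k, k]"]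
      R[of "[i]" "[i]" "[j, j, k, k]" "[]" "[]"]
      R[of "[i]" "[k]" "[k]" "[i, j, j]" "[]"]
    by (simp; linarith)
  have [simp]: "s [i, i, j, k, j, k] = 0" for i j k
    using R[of "[j]" "[j]" "[k]" "[i, i]" "[k]"]
      R[of "[j, j]" "[k]" "[k]" "[i, i]" "[]"]
    by (simp; linarith)
  have [simp]: "s [i, i, j, k, k, j] = 0" for i j k
    using R[of "[j]" "[j]" "[k, k]" "[i, i]" "[]"] by simp
  have [simp]: "s [i, j, i, j, k, k] = 0" for i j k
    using R[of "[i]" "[i]" "[j]" "[]" "[j, k, k]"]
      R[of "[i, i]" "[j]" "[j]" "[]" "[k, k]"]
    by (simp; linarith)
  have [simp]: "s [i, j, i, k, j, k] = 0" for i j k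
    using R[of "[i, k]" "[j]" "[j]" "[i]" "[k]"]
      R[of "[i]" "[j]" "[j]" "[]" "[i, k, k]"]
    by (simp; linarith)
  have [simp]: "s [i, j, i, k, k, j] = 0" for i j k
    using R[of "[j]" "[k]" "[k]" "[i, j, i]" "[]"] by simp
  have [simp]: "s [i, j, j, i, k, k] = 0" for i j k
    using R[of "[i]" "[i]" "[j, j]" "[]" "[k, k]"] by simp
  have [simp]: "s [i, j, j, k, i, k] = 0" for i j k
    using R[of "[i]" "[i]" "[j, j, k]" "[]" "[k]"] by simp
  have [simp]: "s [i, j, j, k, k, i] = 0" for i j k
    using R[of "[i]" "[i]" "[j, j, k, k]" "[]" "[]"] by simp
  have [simp]: "s [i, j, k, i, j, k] = 0" for i j k
    using R[of "[j]" "[j]" "[k, i]" "[i]" "[k]"] by simp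
  have [simp]: "s [i, j, k, i, k, j] = 0" for i j k
    using R[of "[i]" "[j]" "[k]" "[i]" "[k, j]"] by simp
  have [simp]: "s [i, j, k, j, i, k] = 0" for i j k
    using R[of "[i]" "[j]" "[j, k]" "[i]" "[k]"] by simp
  have [simp]: "s [i, j, k, j, k, i] = 0" for i j k
    using R[of "[i]" "[i]" "[j, k, j, k]" "[]" "[]"] by simp
  have [simp]: "s [i, j, k, k, i, j] = 0" for i j k
    using R[of "[i]" "[i, j]" "[j, k, k]" "[]" "[]"] by simp
  have [simp]: "s [i, j, k, k, j, i] = 0" for i j k
    using R[of "[i]" "[j]" "[j, k, k]" "[i]" "[]"] by simp
  obtain a b c d e f where w: "w = [a, b, c, d, e, f]"
    using assms(2) by (auto simp: length_Suc_conv eval_nat_numeral)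
  have "a \<in> {1, 2, 3}" "b \<in> {1, 2, 3}" "c \<in> {1, 2, 3}" "d \<in> {1, 2, 3}" "e \<in> {1, 2, 3}" "f \<in> {1, 2, 3}"
    using assms(3) by (auto simp: w)
  then show ?thesis unfolding w
    by (elim insertE emptyE; hypsubst; simp)
qed

section \<open>Explicit word lists, and necklaces of length 4 to 6\<close>

lemma triple_perm_iff: "{i, j, k} = {1, 2, 3::nat} \<longleftrightarrow>
    (i, j, k) \<in> {(1, 2, 3), (1, 3, 2), (2, 1, 3), (2, 3, 1), (3, 1, 2), (3, 2, 1)}"
proof
  assume h: "{i, j, k} = {1, 2, 3}"
  have "i \<in> {1, 2, 3}" "j \<in> {1, 2, 3}" "k \<in> {1, 2, 3}"
    unfolding h[symmetric] by blast+
  moreover have "1 \<in> {i, j, k}" "2 \<in> {i, j, k}" "3 \<in> {i, j, k}"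
    unfolding h by blast+
  ultimately show "(i, j, k) \<in> {(1, 2, 3), (1, 3, 2), (2, 1, 3), (2, 3, 1), (3, 1, 2), (3, 2, 1)}"
    by (simp only: insert_iff empty_iff prod.inject) presburger
qed (elim insertE emptyE Pair_inject; hypsubst; blast)

lemma triple_perm_image:
  "{f i j k | i j k. {i, j, k} = {1, 2, 3::nat}} =
    {f 1 2 3, f 1 3 2, f 2 1 3, f 2 3 1, f 3 1 2, f 3 2 1}"
  unfolding triple_perm_iff by auto

lemma ordered_pair_Union:
  "{w. \<exists>i j. i \<in> {1,2,3::nat} \<and> j \<in> {1,2,3} \<and> i < j \<and> w \<in> F i j} = F 1 2 \<union> F 1 3 \<union> F 2 3"
proof -
  have "(\<exists>i j. i \<in> {1,2,3::nat} \<and> j \<in> {1,2,3} \<and> i < j \<and> w \<in> F i j) \<longleftrightarrow>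
      (\<exists>i\<in>{1,2,3}. \<exists>j\<in>{1,2,3}. i < j \<and> w \<in> F i j)" for w
    by blast
  then show ?thesis by auto
qed

lemma S33_words_eq: "S33_words = {
    [1,2], [1,1,2], [1,2,2], [1,1,2,2], [1,1,2,2,1,2],
    [1,3], [1,1,3], [1,3,3], [1,1,3,3], [1,1,3,3,1,3],
    [2,3], [2,2,3], [2,3,3], [2,2,3,3], [2,2,3,3,2,3],
    [1,2,3], [1,3,2],
    [1,1,2,3], [1,1,3,2], [2,2,1,3], [2,2,3,1], [3,3,1,2], [3,3,2,1],
    [1,1,2,1,3], [2,2,1,2,3], [3,3,1,3,2]}"
  unfolding S33_words_def ordered_pair_Union[of "\<lambda>i j. {[i,j], [i,i,j], [i,j,j], [i,i,j,j], [i,i,j,j,i,j]}"]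
    triple_perm_image[of "\<lambda>i j k. [i,i,j,k]"]
  by (simp only: Un_insert_left Un_empty_left)

lemma P33'_words_eq: "P33'_words = {
    [1,1,2,2,3], [1,1,3,3,2], [2,2,1,1,3], [2,2,3,3,1], [3,3,1,1,2], [3,3,2,2,1],
    [1,1,2,2,1,3], [1,1,3,3,1,2], [2,2,1,1,2,3], [2,2,3,3,2,1], [3,3,1,1,3,2], [3,3,2,2,3,1],
    [1,1,2,2,3,3]}"
  unfolding P33'_words_def triple_perm_image[of "\<lambda>i j k. [i,i,j,j,k]"]
    triple_perm_image[of "\<lambda>i j k. [i,i,j,j,i,k]"]
  by (simp only: Un_insert_left Un_empty_left)

text \<open>\<open>t\<close> stands for a functional on traces that kills the decomposable ones. The
  relation is demanded for nonempty \<open>v\<close> only: without a further factor, the traces of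
  abc and acb on the right of the polarized identity are as long as the left side.
  \<open>cube\<close> records that each single matrix is nilpotent.\<close>

lemma necklaces4:
  fixes t :: "nat list \<Rightarrow> rat"
  assumes R: "\<And>a b c v. a \<noteq> [] \<Longrightarrow> b \<noteq> [] \<Longrightarrow> c \<noteq> [] \<Longrightarrow> v \<noteq> [] \<Longrightarrow> length (a @ b @ c @ v) = 4 \<Longrightarrow>
      t (a @ b @ c @ v) + t (a @ c @ b @ v) + t (b @ a @ c @ v) +
      t (b @ c @ a @ v) + t (c @ a @ b @ v) + t (c @ b @ a @ v) = 0"
    and cyc: "\<And>u v. t (u @ v) = t (v @ u)" and cube: "\<And>i v. t (i # i # i # v) = 0"
    and gen: "\<And>w. w \<in> S33_words \<union> P33'_words \<Longrightarrow> length w = 4 \<Longrightarrow> t w = 0"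
    and "length w = 4" "set w \<subseteq> {1, 2, 3}"
  shows "t w = 0"
proof -
  obtain a b c d where w: "w = [a, b, c, d]"
    using assms(5) by (auto simp: length_Suc_conv eval_nat_numeral)
  \<comment> \<open>Otherwise the letter \<open>1\<close> is rewritten to \<open>Suc 0\<close> and
    the stored equations no longer match.\<close>
  note [simp del] = One_nat_def
  have rots: "t [a, b, c, d] = 0"
    "t [b, c, d, a] = 0"
    "t [c, d, a, b] = 0"
    "t [d, a, b, c] = 0"
    if "t [a, b, c, d] = 0" for a b c d
    using that cyc[of "[a]" "[b, c, d]"] cyc[of "[a, b]" "[c, d]"] cyc[of "[a, b, c]" "[d]"] by simp_all
  note [simp] = rots[OF cube]
  have "t [1, 1, 2, 2] = 0"
    "t [1, 1, 3, 3] = 0"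
    "t [2, 2, 3, 3] = 0"
    "t [1, 1, 2, 3] = 0"
    "t [1, 1, 3, 2] = 0"
    "t [2, 2, 1, 3] = 0"
    "t [2, 2, 3, 1] = 0"
    "t [3, 3, 1, 2] = 0"
    "t [3, 3, 2, 1] = 0"
    by (rule gen; simp add: S33_words_eq P33'_words_eq)+
  note [simp] = this[THEN rots(1)] this[THEN rots(2)] this[THEN rots(3)] this[THEN rots(4)]
  have "t [1, 2, 1, 2] = 0"
    using R[of "[1]" "[1]" "[2]" "[2]"] by simp
  note [simp] = rots[OF this]
  have "t [1, 2, 1, 3] = 0"
    using R[of "[1]" "[1]" "[2]" "[3]"] by simp
  note [simp] = rots[OF this]
  have "t [1, 2, 3, 2] = 0"
    using R[of "[1]" "[2]" "[2]" "[3]"]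
      cyc[of "[2]" "[1, 2, 3]"] by simp
  note [simp] = rots[OF this]
  have "t [1, 3, 1, 3] = 0"
    using R[of "[1]" "[1]" "[3]" "[3]"] by simp
  note [simp] = rots[OF this]
  have "t [1, 3, 2, 3] = 0"
    using R[of "[1]" "[2]" "[3]" "[3]"]
      cyc[of "[2, 3]" "[1, 3]"] by simp
  note [simp] = rots[OF this]
  have "t [2, 3, 2, 3] = 0"
    using R[of "[2]" "[2]" "[3]" "[3]"] by simp
  note [simp] = rots[OF this]
  have "a \<in> {1, 2, 3}" "b \<in> {1, 2, 3}" "c \<in> {1, 2, 3}" "d \<in> {1, 2, 3}"
    using assms(6) by (auto simp: w)
  then show ?thesis unfolding w
    by (elim insertE emptyE; hypsubst; simp)
qed

text \<open>Modulo shorter traces, one generator suffices in each multidegree of type (3,1,1), two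
  in type (2,2,1), and none in the others.\<close>

lemma necklaces5:
  fixes t :: "nat list \<Rightarrow> rat"
  assumes R: "\<And>a b c v. a \<noteq> [] \<Longrightarrow> b \<noteq> [] \<Longrightarrow> c \<noteq> [] \<Longrightarrow> v \<noteq> [] \<Longrightarrow> length (a @ b @ c @ v) = 5 \<Longrightarrow>
      t (a @ b @ c @ v) + t (a @ c @ b @ v) + t (b @ a @ c @ v) +
      t (b @ c @ a @ v) + t (c @ a @ b @ v) + t (c @ b @ a @ v) = 0"
    and cyc: "\<And>u v. t (u @ v) = t (v @ u)" and cube: "\<And>i v. t (i # i # i # v) = 0"
    and gen: "\<And>w. w \<in> S33_words \<union> P33'_words \<Longrightarrow> length w = 5 \<Longrightarrow> t w = 0"
    and "length w = 5" "set w \<subseteq> {1, 2, 3}"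
  shows "t w = 0"
proof -
  obtain a b c d e where w: "w = [a, b, c, d, e]"
    using assms(5) by (auto simp: length_Suc_conv eval_nat_numeral)
  note [simp del] = One_nat_def
  have rots: "t [a, b, c, d, e] = 0"
    "t [b, c, d, e, a] = 0"
    "t [c, d, e, a, b] = 0"
    "t [d, e, a, b, c] = 0"
    "t [e, a, b, c, d] = 0"
    if "t [a, b, c, d, e] = 0" for a b c d e
    using that cyc[of "[a]" "[b, c, d, e]"] cyc[of "[a, b]" "[c, d, e]"] cyc[of "[a, b, c]" "[d, e]"] cyc[of "[a, b, c, d]" "[e]"] by simp_all
  note [simp] = rots[OF cube]
  have "t [1, 1, 2, 1, 3] = 0"
    "t [2, 2, 1, 2, 3] = 0"
    "t [3, 3, 1, 3, 2] = 0"
    "t [1, 1, 2, 2, 3] = 0"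
    "t [1, 1, 3, 3, 2] = 0"
    "t [2, 2, 1, 1, 3] = 0"
    "t [2, 2, 3, 3, 1] = 0"
    "t [3, 3, 1, 1, 2] = 0"
    "t [3, 3, 2, 2, 1] = 0"
    by (rule gen; simp add: S33_words_eq P33'_words_eq)+
  note [simp] = this[THEN rots(1)] this[THEN rots(2)] this[THEN rots(3)] this[THEN rots(4)] this[THEN rots(5)]
  have "t [1, 1, 2, 1, 2] = 0"
    using R[of "[1]" "[1]" "[1, 2]" "[2]"]
      cyc[of "[1, 2]" "[1, 1, 2]"] by simp
  note [simp] = rots[OF this]
  have "t [1, 1, 2, 3, 2] = 0"
    using R[of "[1, 1]" "[2]" "[2]" "[3]"]
      cyc[of "[2]" "[1, 1, 2, 3]"] by simp
  note [simp] = rots[OF this]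
  have "t [1, 1, 3, 1, 2] = 0"
    using R[of "[1]" "[1]" "[1, 2]" "[3]"]
      cyc[of "[1, 2]" "[1, 1, 3]"] by simp
  note [simp] = rots[OF this]
  have "t [1, 1, 3, 1, 3] = 0"
    using R[of "[1]" "[1]" "[1, 3]" "[3]"]
      cyc[of "[1, 3]" "[1, 1, 3]"] by simp
  note [simp] = rots[OF this]
  have "t [1, 1, 3, 2, 3] = 0"
    using R[of "[1, 1]" "[2]" "[3]" "[3]"]
      cyc[of "[2, 3]" "[1, 1, 3]"] by simp
  note [simp] = rots[OF this]
  have "t [1, 2, 1, 2, 2] = 0"
    using R[of "[1]" "[1]" "[2]" "[2, 2]"] by simp
  note [simp] = rots[OF this]
  have "t [1, 2, 1, 2, 3] = 0"
    using R[of "[1]" "[1]" "[2]" "[2, 3]"] by simp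
  note [simp] = rots[OF this]
  have "t [1, 2, 1, 3, 2] = 0"
    using R[of "[1]" "[1]" "[2]" "[3, 2]"] by simp
  note [simp] = rots[OF this]
  have "t [1, 2, 1, 3, 3] = 0"
    using R[of "[1]" "[1]" "[2]" "[3, 3]"] by simp
  note [simp] = rots[OF this]
  have "t [1, 2, 2, 1, 3] = 0"
    using R[of "[1]" "[1]" "[2, 2]" "[3]"] by simp
  note [simp] = rots[OF this]
  have "t [1, 2, 2, 3, 2] = 0"
    using R[of "[1]" "[2]" "[2]" "[2, 3]"]
      cyc[of "[2]" "[1, 2, 2, 3]"] by simp
  note [simp] = rots[OF this]
  have "t [1, 2, 3, 1, 3] = 0"
    using R[of "[1]" "[1]" "[2, 3]" "[3]"] by simp
  note [simp] = rots[OF this]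
  have "t [1, 2, 3, 3, 2] = 0"
    using R[of "[1]" "[2]" "[2]" "[3, 3]"]
      cyc[of "[2]" "[1, 2, 3, 3]"] by simp
  note [simp] = rots[OF this]
  have "t [1, 2, 3, 2, 3] = 0"
    using R[of "[1, 2]" "[2]" "[3]" "[3]"]
      cyc[of "[2, 3]" "[1, 2, 3]"] by simp
  note [simp] = rots[OF this]
  have "t [1, 3, 1, 3, 2] = 0"
    using R[of "[1]" "[1]" "[3, 2]" "[3]"]
      cyc[of "[1, 3, 2]" "[1, 3]"] by simp
  note [simp] = rots[OF this]
  have "t [1, 3, 1, 3, 3] = 0"
    using R[of "[1]" "[1]" "[3]" "[3, 3]"] by simp
  note [simp] = rots[OF this]
  have "t [1, 3, 2, 2, 3] = 0"
    using R[of "[1]" "[2, 2]" "[3]" "[3]"]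
      cyc[of "[2, 2, 3]" "[1, 3]"] by simp
  note [simp] = rots[OF this]
  have "t [1, 3, 2, 3, 2] = 0"
    using R[of "[1]" "[2]" "[2, 3]" "[3]"]
      cyc[of "[2, 3, 2]" "[1, 3]"] by simp
  note [simp] = rots[OF this]
  have "t [1, 3, 3, 2, 3] = 0"
    using R[of "[1]" "[2]" "[3]" "[3, 3]"]
      cyc[of "[2, 3]" "[1, 3, 3]"] by simp
  note [simp] = rots[OF this]
  have "t [2, 2, 3, 2, 3] = 0"
    using R[of "[2]" "[2]" "[2, 3]" "[3]"]
      cyc[of "[2, 3]" "[2, 2, 3]"] by simp
  note [simp] = rots[OF this]
  have "t [2, 3, 2, 3, 3] = 0"
    using R[of "[2]" "[2]" "[3]" "[3, 3]"] by simp
  note [simp] = rots[OF this]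
  have "a \<in> {1, 2, 3}" "b \<in> {1, 2, 3}" "c \<in> {1, 2, 3}" "d \<in> {1, 2, 3}" "e \<in> {1, 2, 3}"
    using assms(6) by (auto simp: w)
  then show ?thesis unfolding w
    by (elim insertE emptyE; hypsubst; simp)
qed

text \<open>The last length with generators: one suffices in each multidegree of type (3,3,0),
  (3,2,1) and (2,2,2), and all other multidegrees reduce to zero.\<close>

lemma necklaces6:
  fixes t :: "nat list \<Rightarrow> rat"
  assumes R: "\<And>a b c v. a \<noteq> [] \<Longrightarrow> b \<noteq> [] \<Longrightarrow> c \<noteq> [] \<Longrightarrow> v \<noteq> [] \<Longrightarrow> length (a @ b @ c @ v) = 6 \<Longrightarrow>
      t (a @ b @ c @ v) + t (a @ c @ b @ v) + t (b @ a @ c @ v) +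
      t (b @ c @ a @ v) + t (c @ a @ b @ v) + t (c @ b @ a @ v) = 0"
    and cyc: "\<And>u v. t (u @ v) = t (v @ u)" and cube: "\<And>i v. t (i # i # i # v) = 0"
    and gen: "\<And>w. w \<in> S33_words \<union> P33'_words \<Longrightarrow> length w = 6 \<Longrightarrow> t w = 0"
    and "length w = 6" "set w \<subseteq> {1, 2, 3}"
  shows "t w = 0"
proof -
  obtain a b c d e f where w: "w = [a, b, c, d, e, f]"
    using assms(5) by (auto simp: length_Suc_conv eval_nat_numeral)
  note [simp del] = One_nat_def
  have rots: "t [a, b, c, d, e, f] = 0"
    "t [b, c, d, e, f, a] = 0"
    "t [c, d, e, f, a, b] = 0"
    "t [d, e, f, a, b, c] = 0"
    "t [e, f, a, b, c, d] = 0"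
    "t [f, a, b, c, d, e] = 0"
    if "t [a, b, c, d, e, f] = 0" for a b c d e f
    using that cyc[of "[a]" "[b, c, d, e, f]"] cyc[of "[a, b]" "[c, d, e, f]"] cyc[of "[a, b, c]" "[d, e, f]"] cyc[of "[a, b, c, d]" "[e, f]"] cyc[of "[a, b, c, d, e]" "[f]"] by simp_all
  note [simp] = rots[OF cube]
  have "t [1, 1, 2, 2, 1, 2] = 0"
    "t [1, 1, 3, 3, 1, 3] = 0"
    "t [2, 2, 3, 3, 2, 3] = 0"
    "t [1, 1, 2, 2, 1, 3] = 0"
    "t [1, 1, 3, 3, 1, 2] = 0"
    "t [2, 2, 1, 1, 2, 3] = 0"
    "t [2, 2, 3, 3, 2, 1] = 0"
    "t [3, 3, 1, 1, 3, 2] = 0"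
    "t [3, 3, 2, 2, 3, 1] = 0"
    "t [1, 1, 2, 2, 3, 3] = 0"
    by (rule gen; simp add: S33_words_eq P33'_words_eq)+
  note [simp] = this[THEN rots(1)] this[THEN rots(2)] this[THEN rots(3)] this[THEN rots(4)] this[THEN rots(5)] this[THEN rots(6)]
  have "t [1, 1, 2, 1, 1, 2] = 0"
    using R[of "[1]" "[1]" "[1, 1, 2]" "[2]"] by simp
  note [simp] = rots[OF this]
  have "t [1, 1, 2, 1, 1, 3] = 0"
    using R[of "[1]" "[1]" "[1, 1, 2]" "[3]"] by simp
  note [simp] = rots[OF this]
  have "t [1, 1, 2, 1, 2, 2] = 0"
    using R[of "[1]" "[1]" "[1, 2]" "[2, 2]"] by simp
  note [simp] = rots[OF this]
  have "t [1, 1, 2, 1, 2, 3] = 0"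
    using R[of "[1]" "[2]" "[2]" "[3, 1, 1]"]
      cyc[of "[2, 1, 2, 3]" "[1, 1]"] by simp
  note [simp] = rots[OF this]
  have "t [1, 1, 2, 1, 3, 2] = 0"
    using R[of "[1, 1]" "[1, 3]" "[2]" "[2]"]
      cyc[of "[1, 3, 2]" "[1, 1, 2]"] by simp
  note [simp] = rots[OF this]
  have "t [1, 1, 2, 1, 3, 3] = 0"
    using R[of "[1]" "[1]" "[1, 2]" "[3, 3]"] by simp
  note [simp] = rots[OF this]
  have "t [1, 1, 2, 2, 3, 2] = 0"
    using R[of "[1, 1]" "[2]" "[2]" "[2, 3]"]
      cyc[of "[2]" "[1, 1, 2, 2, 3]"] by simp
  note [simp] = rots[OF this]
  have "t [1, 1, 2, 3, 1, 2] = 0"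
    using R[of "[1]" "[1]" "[1, 2]" "[2, 3]"]
      cyc[of "[1, 2]" "[1, 1, 2, 3]"] by simp
  note [simp] = rots[OF this]
  have "t [1, 1, 2, 3, 1, 3] = 0"
    using R[of "[1]" "[1, 1, 2]" "[3]" "[3]"]
      cyc[of "[1, 3]" "[1, 1, 2, 3]"] by simp
  note [simp] = rots[OF this]
  have "t [1, 1, 3, 1, 1, 3] = 0"
    using R[of "[1]" "[1]" "[1, 1, 3]" "[3]"] by simp
  note [simp] = rots[OF this]
  have "t [1, 1, 3, 1, 2, 2] = 0"
    using R[of "[1]" "[1]" "[1, 2, 2]" "[3]"]
      cyc[of "[1, 2, 2]" "[1, 1, 3]"] by simp
  note [simp] = rots[OF this]
  have "t [1, 1, 3, 1, 2, 3] = 0"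
    using R[of "[1]" "[1]" "[1, 2, 3]" "[3]"]
      cyc[of "[1, 2, 3]" "[1, 1, 3]"] by simp
  note [simp] = rots[OF this]
  have "t [1, 1, 3, 1, 3, 2] = 0"
    using R[of "[1, 1]" "[2]" "[3, 1]" "[3]"]
      cyc[of "[2]" "[1, 1, 3, 1, 3]"] by simp
  note [simp] = rots[OF this]
  have "t [1, 1, 3, 1, 3, 3] = 0"
    using R[of "[1]" "[1]" "[1, 3]" "[3, 3]"] by simp
  note [simp] = rots[OF this]
  have "t [1, 1, 3, 2, 1, 2] = 0"
    using R[of "[1, 1]" "[1, 2]" "[2]" "[3]"]
      cyc[of "[2, 1, 2]" "[1, 1, 3]"] by simp
  note [simp] = rots[OF this]
  have "t [1, 1, 3, 2, 1, 3] = 0"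
    using R[of "[1]" "[1]" "[1, 3, 2]" "[3]"] by simp
  note [simp] = rots[OF this]
  have "t [1, 1, 3, 3, 2, 3] = 0"
    using R[of "[1, 1]" "[2]" "[3]" "[3, 3]"]
      cyc[of "[2, 3]" "[1, 1, 3, 3]"] by simp
  note [simp] = rots[OF this]
  have "t [1, 2, 1, 2, 1, 2] = 0"
    using R[of "[1]" "[1]" "[2, 1, 2]" "[2]"] by simp
  note [simp] = rots[OF this]
  have "t [1, 2, 1, 2, 1, 3] = 0"
    using R[of "[1]" "[1]" "[2, 1, 2]" "[3]"] by simp
  note [simp] = rots[OF this]
  have "t [1, 2, 1, 2, 2, 3] = 0"
    using R[of "[1]" "[1]" "[2]" "[2, 2, 3]"] by simp
  note [simp] = rots[OF this]
  have "t [1, 2, 1, 2, 3, 2] = 0"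
    using R[of "[1]" "[1]" "[2]" "[2, 3, 2]"] by simp
  note [simp] = rots[OF this]
  have "t [1, 2, 1, 3, 1, 3] = 0"
    using R[of "[1]" "[1]" "[2, 1, 3]" "[3]"] by simp
  note [simp] = rots[OF this]
  have "t [1, 2, 1, 3, 2, 2] = 0"
    using R[of "[1]" "[1]" "[2]" "[3, 2, 2]"] by simp
  note [simp] = rots[OF this]
  have "t [1, 2, 2, 1, 2, 2] = 0"
    using R[of "[1]" "[1]" "[2, 2]" "[2, 2]"] by simp
  note [simp] = rots[OF this]
  have "t [1, 2, 2, 1, 2, 3] = 0"
    using R[of "[1]" "[1]" "[2, 2]" "[2, 3]"] by simp
  note [simp] = rots[OF this]
  have "t [1, 2, 2, 1, 3, 2] = 0"
    using R[of "[1]" "[1, 2, 2]" "[2]" "[3]"]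
      cyc[of "[2]" "[1, 2, 2, 1, 3]"] by simp
  note [simp] = rots[OF this]
  have "t [1, 2, 2, 3, 2, 2] = 0"
    using R[of "[1]" "[2]" "[2]" "[2, 2, 3]"]
      cyc[of "[2, 2]" "[1, 2, 2, 3]"] by simp
  note [simp] = rots[OF this]
  have "t [1, 2, 2, 3, 2, 3] = 0"
    using R[of "[1, 2, 2]" "[2]" "[3]" "[3]"]
      cyc[of "[2, 3]" "[1, 2, 2, 3]"] by simp
  note [simp] = rots[OF this]
  have "t [1, 2, 3, 1, 3, 3] = 0"
    using R[of "[1]" "[1]" "[2, 3]" "[3, 3]"] by simp
  note [simp] = rots[OF this]
  have "t [1, 2, 3, 2, 2, 3] = 0"
    using R[of "[2]" "[2]" "[2, 3, 1]" "[3]"]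
      cyc[of "[2, 2, 3]" "[1, 2, 3]"] by simp
  note [simp] = rots[OF this]
  have "t [1, 2, 3, 2, 3, 2] = 0"
    using R[of "[1, 2]" "[2]" "[2, 3]" "[3]"]
      cyc[of "[2, 3, 2]" "[1, 2, 3]"] by simp
  note [simp] = rots[OF this]
  have "t [1, 2, 3, 3, 1, 3] = 0"
    using R[of "[1]" "[1]" "[2, 3, 3]" "[3]"] by simp
  note [simp] = rots[OF this]
  have "t [1, 2, 3, 3, 2, 2] = 0"
    using R[of "[1]" "[2]" "[2]" "[2, 3, 3]"]
      cyc[of "[2, 2]" "[1, 2, 3, 3]"] by simp
  note [simp] = rots[OF this]
  have "t [1, 2, 3, 3, 2, 3] = 0"
    using R[of "[2]" "[2]" "[3, 1]" "[3, 3]"]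
      cyc[of "[2, 3]" "[1, 2, 3, 3]"] by simp
  note [simp] = rots[OF this]
  have "t [1, 2, 3, 2, 3, 3] = 0"
    using R[of "[1, 2]" "[2]" "[3]" "[3, 3]"] by simp
  note [simp] = rots[OF this]
  have "t [1, 3, 1, 3, 1, 3] = 0"
    using R[of "[1]" "[1]" "[3, 1, 3]" "[3]"] by simp
  note [simp] = rots[OF this]
  have "t [1, 3, 1, 3, 2, 3] = 0"
    using R[of "[1]" "[1]" "[3, 2, 3]" "[3]"]
      cyc[of "[1, 3, 2, 3]" "[1, 3]"] by simp
  note [simp] = rots[OF this]
  have "t [1, 3, 1, 3, 3, 2] = 0"
    using R[of "[1]" "[1]" "[3, 3, 2]" "[3]"]
      cyc[of "[1, 3, 3, 2]" "[1, 3]"] by simp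
  note [simp] = rots[OF this]
  have "t [1, 3, 2, 1, 3, 3] = 0"
    using R[of "[1]" "[1]" "[3, 2]" "[3, 3]"] by simp
  note [simp] = rots[OF this]
  have "t [1, 3, 2, 2, 3, 2] = 0"
    using R[of "[1]" "[2]" "[2, 2, 3]" "[3]"]
      cyc[of "[2, 2, 3, 2]" "[1, 3]"] by simp
  note [simp] = rots[OF this]
  have "t [1, 3, 2, 2, 3, 3] = 0"
    using R[of "[1]" "[2, 2]" "[3]" "[3, 3]"] by simp
  note [simp] = rots[OF this]
  have "t [1, 3, 2, 3, 2, 2] = 0"
    using R[of "[1]" "[2, 2]" "[2, 3]" "[3]"]
      cyc[of "[2, 3, 2, 2]" "[1, 3]"] by simp
  note [simp] = rots[OF this]
  have "t [1, 3, 2, 3, 2, 3] = 0"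
    using R[of "[1]" "[2, 3]" "[2, 3]" "[3]"]
      cyc[of "[2, 3, 2, 3]" "[1, 3]"] by simp
  note [simp] = rots[OF this]
  have "t [1, 3, 2, 3, 3, 2] = 0"
    using R[of "[1]" "[2]" "[2, 3, 3]" "[3]"]
      cyc[of "[2, 3, 3, 2]" "[1, 3]"] by simp
  note [simp] = rots[OF this]
  have "t [1, 3, 3, 1, 3, 3] = 0"
    using R[of "[1]" "[1]" "[3, 3]" "[3, 3]"] by simp
  note [simp] = rots[OF this]
  have "t [1, 3, 3, 2, 3, 2] = 0"
    using R[of "[1]" "[2]" "[2, 3]" "[3, 3]"]
      cyc[of "[2, 3, 2]" "[1, 3, 3]"] by simp
  note [simp] = rots[OF this]
  have "t [1, 3, 3, 2, 3, 3] = 0"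
    using R[of "[1]" "[2]" "[3, 3]" "[3, 3]"]
      cyc[of "[2, 3, 3]" "[1, 3, 3]"] by simp
  note [simp] = rots[OF this]
  have "t [2, 2, 3, 2, 2, 3] = 0"
    using R[of "[2]" "[2]" "[2, 2, 3]" "[3]"] by simp
  note [simp] = rots[OF this]
  have "t [2, 2, 3, 2, 3, 3] = 0"
    using R[of "[2]" "[2]" "[2, 3]" "[3, 3]"] by simp
  note [simp] = rots[OF this]
  have "t [2, 3, 2, 3, 2, 3] = 0"
    using R[of "[2]" "[2]" "[3, 2, 3]" "[3]"] by simp
  note [simp] = rots[OF this]
  have "t [2, 3, 3, 2, 3, 3] = 0"
    using R[of "[2]" "[2]" "[3, 3]" "[3, 3]"] by simp
  note [simp] = rots[OF this]
  \<comment> \<open>From here on every letter occurs twice; all these necklaces reduce to the single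
    generator \<open>[1, 1, 2, 2, 3, 3]\<close>.\<close>
  have "t [1, 1, 3, 2, 3, 2] = 0"
    using R[of "[1, 1, 3]" "[2]" "[2]" "[3]"]
      R[of "[1, 1]" "[2, 2]" "[3]" "[3]"]
      cyc[of "[2]" "[1, 1, 3, 2, 3]"]
      cyc[of "[2, 2]" "[1, 1, 3, 3]"]
      cyc[of "[2, 2, 3]" "[1, 1, 3]"]
      cyc[of "[3, 2, 2]" "[1, 1, 3]"]
    by (simp; linarith)
  note [simp] = rots[OF this]
  have "t [1, 3, 2, 1, 3, 2] = 0"
    using R[of "[1]" "[1]" "[3, 2]" "[3, 2]"] by simp
  note [simp] = rots[OF this]
  have "t [1, 2, 1, 3, 3, 2] = 0"
    using R[of "[2, 1]" "[2, 1]" "[3]" "[3]"]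
      cyc[of "[2]" "[1, 2, 1, 3, 3]"]
      cyc[of "[3, 2]" "[1, 2, 1, 3]"] by simp
  note [simp] = rots[OF this]
  have "t [1, 3, 1, 3, 2, 2] = 0"
    using R[of "[1, 3]" "[1, 3]" "[2]" "[2]"]
      cyc[of "[2]" "[1, 3, 1, 3, 2]"] by simp
  note [simp] = rots[OF this]
  have "t [1, 1, 2, 3, 3, 2] = 0"
    using R[of "[2]" "[2, 1, 1]" "[3]" "[3]"]
      R[of "[1]" "[2]" "[3, 2, 1]" "[3]"]
      R[of "[1]" "[1, 3]" "[2]" "[3, 2]"]
      R[of "[1, 3]" "[2]" "[2, 1]" "[3]"]
      cyc[of "[1, 3]" "[1, 2, 3, 2]"]
      cyc[of "[1, 3, 2]" "[1, 2, 3]"]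
      cyc[of "[2]" "[1, 1, 2, 3, 3]"]
      cyc[of "[2]" "[1, 1, 3, 3, 2]"]
      cyc[of "[2, 2]" "[1, 1, 3, 3]"]
      cyc[of "[3, 2]" "[1, 1, 2, 3]"]
      cyc[of "[3, 2, 2]" "[1, 1, 3]"]
    by (simp; linarith)
  note [simp] = rots[OF this]
  have "t [1, 1, 2, 3, 2, 3] = 0"
    using R[of "[1, 1, 2]" "[2]" "[3]" "[3]"]
      cyc[of "[2, 3]" "[1, 1, 2, 3]"] by simp
  note [simp] = rots[OF this]
  have "t [1, 1, 3, 2, 2, 3] = 0"
    using R[of "[1, 1]" "[2]" "[2, 3]" "[3]"]
      cyc[of "[2, 2, 3]" "[1, 1, 3]"] by simp
  note [simp] = rots[OF this]
  have "t [1, 1, 3, 3, 2, 2] = 0"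
    using R[of "[1, 1]" "[2]" "[2]" "[3, 3]"]
      cyc[of "[2, 2]" "[1, 1, 3, 3]"] by simp
  note [simp] = rots[OF this]
  have "t [1, 2, 1, 2, 3, 3] = 0"
    using R[of "[1]" "[1]" "[2]" "[2, 3, 3]"] by simp
  note [simp] = rots[OF this]
  have "t [1, 2, 1, 3, 2, 3] = 0"
    using R[of "[1]" "[1]" "[2]" "[3, 2, 3]"] by simp
  note [simp] = rots[OF this]
  have "t [1, 2, 2, 1, 3, 3] = 0"
    using R[of "[1]" "[1]" "[2, 2]" "[3, 3]"] by simp
  note [simp] = rots[OF this]
  have "t [1, 2, 2, 3, 1, 3] = 0"
    using R[of "[1]" "[1]" "[2, 2, 3]" "[3]"] by simp
  note [simp] = rots[OF this]
  have "t [1, 2, 3, 1, 2, 3] = 0"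
    using R[of "[1]" "[1, 2]" "[2, 3]" "[3]"] by simp
  note [simp] = rots[OF this]
  have "t [1, 2, 3, 1, 3, 2] = 0"
    using R[of "[1]" "[1]" "[2, 3]" "[3, 2]"] by simp
  note [simp] = rots[OF this]
  have "t [1, 2, 3, 2, 1, 3] = 0"
    using R[of "[1]" "[1]" "[2, 3, 2]" "[3]"] by simp
  note [simp] = rots[OF this]
  have "a \<in> {1, 2, 3}" "b \<in> {1, 2, 3}" "c \<in> {1, 2, 3}" "d \<in> {1, 2, 3}" "e \<in> {1, 2, 3}" "f \<in> {1, 2, 3}"
    using assms(6) by (auto simp: w)
  then show ?thesis unfolding w
    by (elim insertE emptyE; hypsubst; simp)
qed

section \<open>The generating set\<close>

definition minor_sum :: "'a::comm_ring_1^3^3 \<Rightarrow> 'a" where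
  "minor_sum M = M$1$1 * M$2$2 - M$1$2 * M$2$1 + M$1$1 * M$3$3 - M$1$3 * M$3$1 + M$2$2 * M$3$3 - M$2$3 * M$3$2"

lemma mat3_eq_iff: "X = Y \<longleftrightarrow> (\<forall>i j. X $ i $ j = Y $ i $ j)" for X Y :: "'a^3^3"
  by (simp add: vec_eq_iff)

lemma Cayley_Hamilton_3:
  "M ** M ** M = smat (trace M) (M ** M) - smat (minor_sum M) M + smat (det M) (mat 1)"
  for M :: "'a::comm_ring_1^3^3"
  unfolding mat3_eq_iff forall_3
  by (simp add: matrix_matrix_mult_def sum_3 trace_def minor_sum_def det_3 mat_def algebra_simps)

lemma trace_square: "trace (M ** M) = trace M ^ 2 - 2 * minor_sum M" for M :: "'a::comm_ring_1^3^3"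
  by (simp add: matrix_matrix_mult_def sum_3 trace_def minor_sum_def power2_eq_square algebra_simps)

text \<open>The full linearization of Cayley-Hamilton. With the coefficients of the characteristic
  polynomial linearized too, they become integral polynomials in traces.\<close>

lemma polarized_Cayley_Hamilton:
  fixes X Y Z :: "'a::field^3^3"
  shows "X**Y**Z + X**Z**Y + Y**X**Z + Y**Z**X + Z**X**Y + Z**Y**X =
    smat (trace X) (Y**Z + Z**Y) + smat (trace Y) (X**Z + Z**X) + smat (trace Z) (X**Y + Y**X)
    - smat (trace X * trace Y - trace (X**Y)) Z - smat (trace X * trace Z - trace (X**Z)) Y
    - smat (trace Y * trace Z - trace (Y**Z)) X
    + smat (trace X * trace Y * trace Z - trace X * trace (Y**Z) - trace Y * trace (X**Z)
        - trace Z * trace (X**Y) + trace (X**Y**Z) + trace (X**Z**Y)) (mat 1)"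
  unfolding mat3_eq_iff forall_3 smat_nth vector_add_component vector_minus_component
    matrix_matrix_mult_def vec_lambda_beta sum_3 trace_def mat_def
  by (intro conjI; simp; algebra)

lemma trace_smat: "trace (smat c X) = c * trace X"
  by (simp add: trace_def sum_distrib_left)

lemma polarized_trace_identity:
  fixes X Y Z V :: "'a::field^3^3"
  shows "trace (X**Y**Z**V) + trace (X**Z**Y**V) + trace (Y**X**Z**V) + trace (Y**Z**X**V) +
      trace (Z**X**Y**V) + trace (Z**Y**X**V) =
    trace X * (trace (Y**Z**V) + trace (Z**Y**V)) + trace Y * (trace (X**Z**V) + trace (Z**X**V)) +
    trace Z * (trace (X**Y**V) + trace (Y**X**V))
    - (trace X * trace Y - trace (X**Y)) * trace (Z**V) - (trace X * trace Z - trace (X**Z)) * trace (Y**V)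
    - (trace Y * trace Z - trace (Y**Z)) * trace (X**V)
    + (trace X * trace Y * trace Z - trace X * trace (Y**Z) - trace Y * trace (X**Z)
        - trace Z * trace (X**Y) + trace (X**Y**Z) + trace (X**Z**Y)) * trace V"
proof -
  have "trace ((X**Y**Z + X**Z**Y + Y**X**Z + Y**Z**X + Z**X**Y + Z**Y**X) ** V) = trace (
    (smat (trace X) (Y**Z + Z**Y) + smat (trace Y) (X**Z + Z**X) + smat (trace Z) (X**Y + Y**X)
    - smat (trace X * trace Y - trace (X**Y)) Z - smat (trace X * trace Z - trace (X**Z)) Y
    - smat (trace Y * trace Z - trace (Y**Z)) X
    + smat (trace X * trace Y * trace Z - trace X * trace (Y**Z) - trace Y * trace (X**Z)
        - trace Z * trace (X**Y) + trace (X**Y**Z) + trace (X**Z**Y)) (mat 1)) ** V)"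
    unfolding polarized_Cayley_Hamilton by (rule refl)
  moreover have "(P - Q) ** V = P ** V - Q ** V" "(P + Q) ** V = P ** V + Q ** V" for P Q :: "'a^3^3"
    by (simp_all add: matrix_matrix_mult_def vec_eq_iff sum_subtractf left_diff_distrib sum.distrib distrib_right)
  ultimately show ?thesis
    by (simp add: trace_add trace_sub trace_smat)
qed

text \<open>No eigenvalues are needed: det M is nilpotent, hence 0, and Cayley-Hamilton becomes a
  recursion of step two between powers of M. At the least vanishing power it kills first
  \<open>minor_sum M\<close> and then the trace; for small index the trace follows from
  \<open>trace_square\<close>.\<close>

lemma nilp_traces:
  fixes M :: "'a::field^3^3"
  assumes "nilp M"
  shows "trace M = 0" "minor_sum M = 0" "det M = 0"
proof -
  define k where "k = (LEAST k. mpow M k = 0)"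
  have k: "mpow M k = 0" unfolding k_def using assms unfolding nilp_def by (rule LeastI_ex)
  have least: "mpow M l \<noteq> 0" if "l < k" for l using that not_less_Least unfolding k_def by blast
  have "det (mpow M l) = det M ^ l" for l by (induct l) (simp_all add: det_mul)
  from this[of k] show d: "det M = 0" using k by (simp add: det_3 split: if_splits)
  have "k \<noteq> 0"
  proof
    assume "k = 0"
    then have "(mat 1 :: 'a^3^3) $ 1 $ 1 = 0" using k by simp
    then show False by (simp add: mat_def)
  qed
  have rec: "mpow M (Suc (Suc (Suc l))) = smat (trace M) (mpow M (Suc (Suc l))) - smat (minor_sum M) (mpow M (Suc l))" for l
  proof -
    have "M ** M ** M = smat (trace M) (M ** M) - smat (minor_sum M) M"
      using Cayley_Hamilton_3[of M] d by (simp add: smat_def vec_eq_iff)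
    then have "M ** M ** M ** mpow M l = (smat (trace M) (M ** M) - smat (minor_sum M) M) ** mpow M l" by simp
    moreover have "(P - Q) ** V = P ** V - Q ** V" for P Q V :: "'a^3^3"
      by (simp add: matrix_matrix_mult_def vec_eq_iff sum_subtractf left_diff_distrib)
    ultimately show ?thesis by (simp add: matrix_mul_assoc)
  qed
  have zero_above: "mpow M l = 0" if "k \<le> l" for l
    using that
  proof (induct rule: dec_induct)
    case (step l)
    then show ?case by (simp add: matrix_matrix_mult_def vec_eq_iff)
  qed (rule k)
  have smat0: "c = 0" if "smat c X = 0" "X \<noteq> 0" for c :: 'a and X
    using that by (auto simp: vec_eq_iff)
  show m: "minor_sum M = 0"
  proof (cases "k = 1")
    case True
    then have "M = 0" using k by simp
    then show ?thesis by (simp add: minor_sum_def)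
  next
    case False
    then obtain l where l: "k = Suc (Suc l)" using \<open>k \<noteq> 0\<close> by (metis One_nat_def old.nat.exhaust)
    have "smat (minor_sum M) (mpow M (Suc l)) = 0"
      using rec[of l] zero_above[of "Suc (Suc l)"] zero_above[of "Suc (Suc (Suc l))"] l by (simp add: vec_eq_iff)
    then show ?thesis using least[of "Suc l"] l by (auto intro: smat0)
  qed
  show "trace M = 0"
  proof (cases "k \<le> 2")
    case True
    have "mpow M 2 = 0" by (rule zero_above[OF True])
    then have "trace (M ** M) = 0" by (simp add: numeral_2_eq_2 trace_def)
    then show ?thesis using trace_square[of M] m by simp
  next
    case False
    then obtain l where l: "k = Suc (Suc (Suc l))" by (metis One_nat_def Suc_1 less_eq_Suc_le not_less_eq_eq old.nat.exhaust zero_le)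
    have "smat (trace M) (mpow M (Suc (Suc l))) = 0"
      using rec[of l] zero_above[of "Suc (Suc (Suc l))"] l m by (simp add: vec_eq_iff)
    then show ?thesis using least[of "Suc (Suc l)"] l by (auto intro: smat0)
  qed
qed

lemma nilp_cube: "nilp M \<Longrightarrow> M ** M ** M = 0" for M :: "'a::field^3^3"
  by (simp add: Cayley_Hamilton_3 nilp_traces) (simp add: vec_eq_iff)

lemma nilp_trace_square: "nilp M \<Longrightarrow> trace (M ** M) = 0" for M :: "'a::field^3^3"
  by (simp add: trace_square nilp_traces)

text \<open>\<open>R\<close> is viewed as a subspace over the rationals: a basis of it stays
  independent after \<open>f\<close> is added, and the functional is prescribed on this larger set.
  Rational values are wanted because the word relations are solved over an ordered field.\<close>

lemma separating_rat_functional: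
  fixes R :: "('b \<Rightarrow> 'a::field_char_0) set"
  assumes zero: "(\<lambda>_. 0) \<in> R" and add: "\<And>f g. f \<in> R \<Longrightarrow> g \<in> R \<Longrightarrow> (\<lambda>x. f x + g x) \<in> R"
    and scale: "\<And>c f. f \<in> R \<Longrightarrow> (\<lambda>x. c * f x) \<in> R" and "f \<notin> R"
  shows "\<exists>l :: ('b \<Rightarrow> 'a) \<Rightarrow> rat. (\<forall>g h. l (\<lambda>x. g x + h x) = l g + l h) \<and> (\<forall>g\<in>R. l g = 0) \<and> l f = 1"
proof -
  interpret vector_space_pair "\<lambda>q (f :: 'b \<Rightarrow> 'a) x. of_rat q * f x" "(*) :: rat \<Rightarrow> rat \<Rightarrow> rat"
    by unfold_locales (auto simp: fun_eq_iff algebra_simps of_rat_add of_rat_mult)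
  have sub: "vs1.subspace R"
    unfolding vs1.subspace_def using zero add scale by (auto simp: plus_fun_def zero_fun_def)
  obtain B where B: "B \<subseteq> R" "vs1.independent B" "R \<subseteq> vs1.span B"
    using vs1.maximal_independent_subset[of R] by blast
  have "f \<notin> vs1.span B" using vs1.span_minimal[OF B(1) sub] assms(4) by blast
  then have "vs1.independent (insert f B)" using B(2) by (rule vs1.independent_insertI)
  then obtain l where l: "Vector_Spaces.linear (\<lambda>q (f :: 'b \<Rightarrow> 'a) x. of_rat q * f x) (*) l"
      "\<forall>x\<in>insert f B. l x = (if x = f then 1 else 0 :: rat)"
    using linear_independent_extend[of "insert f B" "\<lambda>x. if x = f then 1 else 0"] by blast
  have "f \<notin> B" using assms(4) B(1) by blast
  then have "l x = 0" if "x \<in> B" for x using l(2) that by auto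
  then have "l g = 0" if "g \<in> R" for g
    using linear_eq_0_on_span[OF l(1), of B g] that B(3) by blast
  moreover have "l (\<lambda>x. g x + h x) = l g + l h" for g h
    using linear_add[OF l(1), of g h] by (simp add: plus_fun_def)
  ultimately show ?thesis using l(2) by auto
qed

lemma onN_add: "onN (\<lambda>A. f A + g A) = (\<lambda>A. onN f A + onN g A)"
  and onN_mult: "onN (\<lambda>A. f A * g A) = (\<lambda>A. onN f A * onN g A)"
  by (auto simp: onN_def)

lemma subalg_onN:
  fixes S :: "('a::field trip \<Rightarrow> 'a) set"
  defines "T \<equiv> {t. onN t \<in> subalg S}"
  shows "(\<lambda>_. c) \<in> T" "f \<in> T \<Longrightarrow> g \<in> T \<Longrightarrow> (\<lambda>A. f A + g A) \<in> T" "f \<in> T \<Longrightarrow> g \<in> T \<Longrightarrow> (\<lambda>A. f A * g A) \<in> T"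
    "f \<in> T \<Longrightarrow> g \<in> T \<Longrightarrow> (\<lambda>A. f A - g A) \<in> T"
proof -
  show const: "(\<lambda>_. c) \<in> T" for c unfolding T_def by (simp add: sconst)
  show add: "f \<in> T \<Longrightarrow> g \<in> T \<Longrightarrow> (\<lambda>A. f A + g A) \<in> T" for f g
    unfolding T_def by (simp add: onN_add sadd)
  show mult: "f \<in> T \<Longrightarrow> g \<in> T \<Longrightarrow> (\<lambda>A. f A * g A) \<in> T" for f g
    unfolding T_def by (simp add: onN_mult smul)
  show "f \<in> T \<Longrightarrow> g \<in> T \<Longrightarrow> (\<lambda>A. f A - g A) \<in> T"
    using add[of f "\<lambda>A. -1 * g A"] mult[OF const[of "-1"], of g] by simp
qed

section \<open>Reduction of trace words to the generators\<close>

abbreviation trword :: "nat list \<Rightarrow> 'a::field trip \<Rightarrow> 'a" where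
  "trword w \<equiv> \<lambda>A. trace (wprod w A)"

lemma trword_rotate: "trword (u @ v) = trword (v @ u)"
  unfolding wprod_append by (intro ext trace_mul_sym)

text \<open>Every trace on the right side of the polarized trace identity belongs to a strictly
  shorter word; for \<open>a @ b @ c\<close> this uses that \<open>v\<close> is nonempty.\<close>

lemma trword_identity:
  fixes T :: "('a::field trip \<Rightarrow> 'a) set"
  assumes const: "\<And>c. (\<lambda>_. c) \<in> T" and add: "\<And>f g. f \<in> T \<Longrightarrow> g \<in> T \<Longrightarrow> (\<lambda>A. f A + g A) \<in> T"
    and mult: "\<And>f g. f \<in> T \<Longrightarrow> g \<in> T \<Longrightarrow> (\<lambda>A. f A * g A) \<in> T"
    and diff: "\<And>f g. f \<in> T \<Longrightarrow> g \<in> T \<Longrightarrow> (\<lambda>A. f A - g A) \<in> T"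
    and shorter: "\<And>w. length w < length (a @ b @ c @ v) \<Longrightarrow> trword w \<in> T"
    and "a \<noteq> []" "b \<noteq> []" "c \<noteq> []" "v \<noteq> []"
  shows "(\<lambda>A. trword (a @ b @ c @ v) A + trword (a @ c @ b @ v) A + trword (b @ a @ c @ v) A +
    trword (b @ c @ a @ v) A + trword (c @ a @ b @ v) A + trword (c @ b @ a @ v) A) \<in> T"
proof -
  have ne: "length a > 0" "length b > 0" "length c > 0" "length v > 0" using assms(6-9) by auto
  have sh: "trword a \<in> T" "trword b \<in> T" "trword c \<in> T" "trword v \<in> T"
    "trword (a @ b) \<in> T" "trword (a @ c) \<in> T" "trword (b @ c) \<in> T"
    "trword (a @ v) \<in> T" "trword (b @ v) \<in> T" "trword (c @ v) \<in> T"
    "trword (a @ b @ c) \<in> T" "trword (a @ c @ b) \<in> T"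
    "trword (a @ b @ v) \<in> T" "trword (b @ a @ v) \<in> T" "trword (a @ c @ v) \<in> T" "trword (c @ a @ v) \<in> T"
    "trword (b @ c @ v) \<in> T" "trword (c @ b @ v) \<in> T"
    by (rule shorter; use ne in auto)+
  have "trword (a @ b @ c @ v) A + trword (a @ c @ b @ v) A + trword (b @ a @ c @ v) A +
      trword (b @ c @ a @ v) A + trword (c @ a @ b @ v) A + trword (c @ b @ a @ v) A =
    trword a A * (trword (b @ c @ v) A + trword (c @ b @ v) A) +
    trword b A * (trword (a @ c @ v) A + trword (c @ a @ v) A) +
    trword c A * (trword (a @ b @ v) A + trword (b @ a @ v) A)
    - (trword a A * trword b A - trword (a @ b) A) * trword (c @ v) A
    - (trword a A * trword c A - trword (a @ c) A) * trword (b @ v) A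
    - (trword b A * trword c A - trword (b @ c) A) * trword (a @ v) A
    + (trword a A * trword b A * trword c A - trword a A * trword (b @ c) A - trword b A * trword (a @ c) A
        - trword c A * trword (a @ b) A + trword (a @ b @ c) A + trword (a @ c @ b) A) * trword v A" for A :: "'a trip"
    using polarized_trace_identity[of "wprod a A" "wprod b A" "wprod c A" "wprod v A"]
    by (simp only: wprod_append matrix_mul_assoc)
  then show ?thesis by (simp only:) (intro add mult diff sh)
qed

text \<open>\<open>Yc\<close> reads every index other than 1 and 2 as the third matrix, so words
  over all naturals reduce to three letters.\<close>

lemma wprod_letters: "wprod (map (\<lambda>k. if k = 1 \<or> k = 2 then k else 3) w) = wprod w"
  by (induct w) (auto simp: fun_eq_iff Yc_def)

text \<open>By induction on length all shorter traces lie in \<open>T\<close>. If one of the present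
  length did not, a functional that kills \<open>T\<close> would satisfy the hypotheses of the
  necklace lemmas and vanish on it as well. \<open>T\<close> is left abstract and the generators are
  bounded by \<open>N\<close>, so that the lemma also applies to functions agreeing at two points
  when only short generators are under control.\<close>

lemma trword_in_algebra:
  fixes T :: "('a::field_char_0 trip \<Rightarrow> 'a) set"
  assumes T: "\<And>c. (\<lambda>_. c) \<in> T" "\<And>f g. f \<in> T \<Longrightarrow> g \<in> T \<Longrightarrow> (\<lambda>A. f A + g A) \<in> T"
      "\<And>f g. f \<in> T \<Longrightarrow> g \<in> T \<Longrightarrow> (\<lambda>A. f A * g A) \<in> T"
      "\<And>f g. f \<in> T \<Longrightarrow> g \<in> T \<Longrightarrow> (\<lambda>A. f A - g A) \<in> T"
    and zeroT: "\<And>f. (\<And>A. A \<in> Nil3 \<Longrightarrow> f A = 0) \<Longrightarrow> f \<in> T"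
    and gen: "\<And>v. v \<in> S33_words \<union> P33'_words \<Longrightarrow> length v \<le> N \<Longrightarrow> trword v \<in> T"
    and "length w \<le> N"
  shows "trword w \<in> T"
  using assms(7)
proof (induct w rule: length_induct)
  case (1 w)
  have nil: "nilp (Yc i A)" if "A \<in> Nil3" for i and A :: "'a trip"
    using that by (auto simp: Nil3_def Yc_def)
  have one: "trword [i] \<in> T" for i
    by (rule zeroT) (simp add: nilp_traces nil)
  have square: "trword [i, i] \<in> T" for i
    by (rule zeroT) (simp add: nilp_trace_square nil)
  have cube: "trword (i # i # i # v) \<in> T" for i v
  proof (rule zeroT)
    fix A :: "'a trip" assume "A \<in> Nil3"
    have "trword (i # i # i # v) A = trace ((Yc i A ** Yc i A ** Yc i A) ** wprod v A)"
      by (simp add: matrix_mul_assoc)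
    also have "\<dots> = 0" unfolding nilp_cube[OF nil[OF \<open>A \<in> Nil3\<close>]]
      by (simp add: matrix_matrix_mult_def trace_def)
    finally show "trword (i # i # i # v) A = 0" .
  qed
  have shorter: "trword v \<in> T" if "length v < length w" for v
    using 1 that by simp
  define w' where "w' = map (\<lambda>k. if k = 1 \<or> k = 2 then k else 3) w"
  have w': "length w' = length w" "set w' \<subseteq> {1, 2, 3}" by (auto simp: w'_def)
  have "trword w' \<in> T"
  proof (rule ccontr)
    assume notin: "trword w' \<notin> T"
    obtain l :: "('a trip \<Rightarrow> 'a) \<Rightarrow> rat" where
      ladd: "\<And>g h. l (\<lambda>x. g x + h x) = l g + l h" and l0: "\<And>g. g \<in> T \<Longrightarrow> l g = 0" and lw: "l (trword w') = 1"
      using separating_rat_functional[OF T(1,2) T(3)[OF T(1)] notin] by blast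
    define t where "t w = l (trword w)" for w
    have cyc: "t (u @ v) = t (v @ u)" for u v unfolding t_def trword_rotate[of u v] by (rule refl)
    have rel: "t (a @ b @ c @ v) + t (a @ c @ b @ v) + t (b @ a @ c @ v) +
        t (b @ c @ a @ v) + t (c @ a @ b @ v) + t (c @ b @ a @ v) = 0"
      if "a \<noteq> []" "b \<noteq> []" "c \<noteq> []" "v \<noteq> []" "length (a @ b @ c @ v) = length w" for a b c v
    proof -
      have "(\<lambda>A. trword (a @ b @ c @ v) A + trword (a @ c @ b @ v) A + trword (b @ a @ c @ v) A +
          trword (b @ c @ a @ v) A + trword (c @ a @ b @ v) A + trword (c @ b @ a @ v) A) \<in> T"
        by (rule trword_identity[OF T]) (use shorter that in simp_all)
      from l0[OF this] show ?thesis unfolding ladd t_def .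
    qed
    have gen0: "t v = 0" if "v \<in> S33_words \<union> P33'_words" "length v \<le> length w" for v
      unfolding t_def using l0[OF gen[OF that(1)]] that(2) 1(2) by simp
    have gen1: "t v = 0" if "v \<in> S33_words \<union> P33'_words" "length v = length w" for v
      using gen0[OF that(1)] that(2) by simp
    have cube0: "t (i # i # i # v) = 0" for i v unfolding t_def by (rule l0[OF cube])
    have small: "t v = 0" if "length v \<le> 3" "length v \<le> length w" "set v \<subseteq> {1, 2, 3}" for v
    proof -
      have rot2: "t [b, a] = t [a, b]" for a b using cyc[of "[a]" "[b]"] by simp
      have rot3: "t [b, c, a] = 0" "t [c, a, b] = 0" if "t [a, b, c] = 0" for a b c
        using that cyc[of "[a]" "[b, c]"] cyc[of "[a, b]" "[c]"] by simp_all
      have [simp]: "t [] = 0" unfolding t_def by (rule l0) (use T(1)[of "trace (mat 1)"] in simp)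
      have [simp]: "t [a] = 0" "t [a, a] = 0" "t [a, a, a] = 0" for a
        unfolding t_def using l0[OF one] l0[OF square] cube0[of a "[]"] by (simp_all add: t_def)
      have "t [a, b] = 0" if "a \<in> {1, 2, 3}" "b \<in> {1, 2, 3}" "2 \<le> length w" for a b
      proof -
        have "t [1, 2] = 0" "t [1, 3] = 0" "t [2, 3] = 0"
          by (rule gen0; use that(3) in \<open>simp add: S33_words_eq\<close>)+
        then show ?thesis using that rot2[of 1 2] rot2[of 1 3] rot2[of 2 3] by auto
      qed
      moreover have "t [a, b, c] = 0" if "a \<in> {1, 2, 3}" "b \<in> {1, 2, 3}" "c \<in> {1, 2, 3}" "3 \<le> length w" for a b c
      proof -
        have g3: "t [1, 1, 2] = 0" "t [1, 1, 3] = 0" "t [2, 2, 3] = 0" "t [1, 2, 2] = 0" "t [1, 3, 3] = 0"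
            "t [2, 3, 3] = 0" "t [1, 2, 3] = 0" "t [1, 3, 2] = 0"
          by (rule gen0; use that(4) in \<open>simp add: S33_words_eq\<close>)+
        show ?thesis
          using that(1-3) by (elim insertE emptyE; hypsubst; simp del: One_nat_def add: g3 g3[THEN rot3(1)] g3[THEN rot3(2)])
      qed
      ultimately show ?thesis
        using that by (cases v; cases "tl v"; cases "tl (tl v)"; cases "tl (tl (tl v))") auto
    qed
    consider "length w \<le> 3" | "length w = 4" | "length w = 5" | "length w = 6" | "length w \<ge> 7" by linarith
    then have "t w' = 0"
    proof cases
      case 1
      then show ?thesis using w' by (intro small) simp_all
    next
      case 2
      show ?thesis by (rule necklaces4[of t, OF rel cyc cube0 gen1]) (use w' 2 in simp_all)
    next
      case 3
      show ?thesis by (rule necklaces5[of t, OF rel cyc cube0 gen1]) (use w' 3 in simp_all)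
    next
      case 4
      show ?thesis by (rule necklaces6[of t, OF rel cyc cube0 gen1]) (use w' 4 in simp_all)
    next
      case 5
      \<comment> \<open>The first six letters are treated as a word in an algebra with x^3 = 0. The
        nonempty rest \<open>r\<close>, after rotation, is part of the trailing factor that the
        trace relation requires.\<close>
      define r where "r = drop 6 w'"
      have r: "length r = length w - 6" "r \<noteq> []" using 5 w' by (auto simp: r_def)
      have "t (take 6 w' @ r) = 0"
      proof (rule nil3_words6[of "\<lambda>u. t (u @ r)"])
        fix u a b c v :: "nat list"
        assume *: "a \<noteq> []" "b \<noteq> []" "c \<noteq> []" "length (u @ a @ b @ c @ v) = 6"
        have "t ((u @ x @ y @ z @ v) @ r) = t (x @ y @ z @ (v @ r @ u))" for x y z
          using cyc[of u "x @ y @ z @ v @ r"] by simp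
        then show "t ((u @ a @ b @ c @ v) @ r) + t ((u @ a @ c @ b @ v) @ r) + t ((u @ b @ a @ c @ v) @ r) +
            t ((u @ b @ c @ a @ v) @ r) + t ((u @ c @ a @ b @ v) @ r) + t ((u @ c @ b @ a @ v) @ r) = 0"
          using rel[of a b c "v @ r @ u"] * r 5 by simp
      qed (use 5 w' set_take_subset[of 6 w'] in auto)
      then show ?thesis by (simp add: r_def)
    qed
    then show False using lw by (simp add: t_def)
  qed
  then show ?case unfolding w'_def wprod_letters .
qed

lemma trword_in_subalg_P33:
  "onN (trword w :: 'a::field_char_0 trip \<Rightarrow> 'a) \<in> subalg P33"
proof -
  define T where "T = {t :: 'a trip \<Rightarrow> 'a. onN t \<in> subalg P33}"
  note T = subalg_onN[where S = "P33 :: ('a trip \<Rightarrow> 'a) set", folded T_def]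
  have "trword w \<in> T"
  proof (rule trword_in_algebra[OF T _ _ order_refl])
    fix f :: "'a trip \<Rightarrow> 'a" assume "\<And>A. A \<in> Nil3 \<Longrightarrow> f A = 0"
    then have "onN f = onN (\<lambda>_. 0)" by (auto simp: onN_def)
    then show "f \<in> T" using T(1)[of 0] by (simp add: T_def)
  next
    fix v assume "v \<in> S33_words \<union> P33'_words"
    then have "(trw v :: 'a trip \<Rightarrow> 'a) \<in> P33" unfolding P33_def by blast
    from sgen[OF this] show "trword v \<in> T" by (simp add: T_def trw_def)
  qed
  then show ?thesis by (simp add: T_def)
qed

lemma trace_algebra_P33: "trace_algebra {t :: 'a::field_char_0 trip \<Rightarrow> 'a. onN t \<in> subalg P33}"
  by unfold_locales (use subalg_onN(1-3) trword_in_subalg_P33 in auto)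

section \<open>Traces of words are invariants\<close>

lemma polyfun_sum: "(\<And>i. i \<in> I \<Longrightarrow> f i \<in> polyfun) \<Longrightarrow> (\<lambda>A. \<Sum>i\<in>I. f i A) \<in> polyfun"
  by (induct I rule: infinite_finite_induct) (auto intro: pconst padd)

lemma wprod_polyfun:
  assumes "set w \<subseteq> {1, 2, 3}"
  shows "(\<lambda>A. wprod w A $ i $ j) \<in> polyfun"
  using assms
proof (induct w arbitrary: i j)
  case Nil
  then show ?case by (simp add: pconst)
next
  case (Cons k w)
  then show ?case by (auto simp: matrix_matrix_mult_def intro!: polyfun_sum pmul pcoord)
qed

lemma wprod_act:
  assumes "(g, h) \<in> GL3"
  shows "wprod w (act g h A) = g ** wprod w A ** h"
proof -
  have gh: "g ** h = mat 1" and hg: "h ** g = mat 1" using assms by (auto simp: GL3_def)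
  show ?thesis
  proof (induct w)
    case (Cons k w)
    have "Yc k (act g h A) = g ** Yc k A ** h" by (simp add: act_eq_map3)
    then have "wprod (k # w) (act g h A) = g ** Yc k A ** (h ** g) ** wprod w A ** h"
      by (simp only: wprod_Cons Cons matrix_mul_assoc)
    then show ?case by (simp add: hg matrix_mul_assoc)
  qed (simp add: gh)
qed

lemma InvI: "f \<in> Oring \<Longrightarrow> (\<And>g h A. (g, h) \<in> GL3 \<Longrightarrow> A \<in> Nil3 \<Longrightarrow> f (act g h A) = f A) \<Longrightarrow> f \<in> Inv"
  and InvD: "f \<in> Inv \<Longrightarrow> (g, h) \<in> GL3 \<Longrightarrow> A \<in> Nil3 \<Longrightarrow> f (act g h A) = f A"
  unfolding Inv_def by blast+

lemma trw_in_Inv: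
  assumes "set w \<subseteq> {1, 2, 3}"
  shows "(trw w :: 'a::field trip \<Rightarrow> 'a) \<in> Inv"
proof -
  have "(trw w :: 'a trip \<Rightarrow> 'a) \<in> Oring"
    unfolding trw_def Oring_def trace_def by (intro imageI polyfun_sum wprod_polyfun assms)
  moreover have "trw w (act g h A) = trw w A" if g: "(g, h) \<in> GL3" and "A \<in> Nil3" for g h and A :: "'a trip"
  proof -
    have "trace (g ** wprod w A ** h) = trace (wprod w A)"
      using g trace_mul_sym[of "g ** wprod w A" h] by (simp add: GL3_def matrix_mul_assoc)
    then show ?thesis using that Nil3_act[OF that] by (simp add: trw_def onN_def wprod_act[OF g])
  qed
  ultimately show ?thesis by (rule InvI)
qed

lemma subalg_subset_Inv:
  fixes S :: "('a::field trip \<Rightarrow> 'a) set"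
  assumes "S \<subseteq> Inv"
  shows "subalg S \<subseteq> Inv"
proof
  fix f assume "f \<in> subalg S"
  then show "f \<in> Inv"
  proof induct
    case (sgen f)
    then show ?case using assms by blast
  next
    case (sconst c)
    then show ?case by (auto simp: Inv_def Oring_def onN_def Nil3_act intro: pconst)
  next
    case (sadd f g)
    then have "(\<lambda>A. f A + g A) \<in> Oring"
      unfolding Inv_def Oring_def by (auto simp: onN_add[symmetric] intro: padd)
    then show ?case using sadd by (intro InvI) (simp_all add: InvD)
  next
    case (smul f g)
    then have "(\<lambda>A. f A * g A) \<in> Oring"
      unfolding Inv_def Oring_def by (auto simp: onN_mult[symmetric] intro: pmul)
    then show ?case using smul by (intro InvI) (simp_all add: InvD)
  qed
qed

lemma P33_subset_Inv: "(P33 :: ('a::field trip \<Rightarrow> 'a) set) \<subseteq> Inv"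
proof -
  have "\<forall>w \<in> S33_words \<union> P33'_words. set w \<subseteq> {1, 2, 3}"
    unfolding S33_words_eq P33'_words_eq by simp
  then show ?thesis unfolding P33_def using trw_in_Inv by blast
qed

theorem generating_P33: "generating (P33 :: ('a::field_char_0 trip \<Rightarrow> 'a) set)"
proof -
  have "f \<in> subalg P33" if "f \<in> Inv" for f :: "'a trip \<Rightarrow> 'a"
    using first_fundamental_theorem[OF trace_algebra_P33 that] by auto
  then show ?thesis
    unfolding generating_def using P33_subset_Inv subalg_subset_Inv[OF P33_subset_Inv] by blast
qed

section \<open>Minimality\<close>

definition m3 :: "'a \<Rightarrow> 'a \<Rightarrow> 'a \<Rightarrow> 'a \<Rightarrow> 'a \<Rightarrow> 'a \<Rightarrow> 'a \<Rightarrow> 'a \<Rightarrow> 'a \<Rightarrow> 'a::zero mat3" where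
  "m3 a b c d e f g h i = vector [vector [a, b, c], vector [d, e, f], vector [g, h, i]]"

lemma m3_nth [simp]:
  "m3 a b c d e f g h i $ 1 $ 1 = a" "m3 a b c d e f g h i $ 1 $ 2 = b" "m3 a b c d e f g h i $ 1 $ 3 = c"
  "m3 a b c d e f g h i $ 2 $ 1 = d" "m3 a b c d e f g h i $ 2 $ 2 = e" "m3 a b c d e f g h i $ 2 $ 3 = f"
  "m3 a b c d e f g h i $ 3 $ 1 = g" "m3 a b c d e f g h i $ 3 $ 2 = h" "m3 a b c d e f g h i $ 3 $ 3 = i"
  by (simp_all add: m3_def)

lemma m3_mult [simp]:
  "m3 a b c d e f g h i ** m3 a' b' c' d' e' f' g' h' i' =
   m3 (a*a' + b*d' + c*g') (a*b' + b*e' + c*h') (a*c' + b*f' + c*i')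
      (d*a' + e*d' + f*g') (d*b' + e*e' + f*h') (d*c' + e*f' + f*i')
      (g*a' + h*d' + i*g') (g*b' + h*e' + i*h') (g*c' + h*f' + i*i')"
  by (simp add: vec_eq_iff forall_3 matrix_matrix_mult_def sum_3)

lemma trace_m3 [simp]: "trace (m3 a b c d e f g h i) = a + e + i"
  by (simp add: trace_def sum_3)

lemma mat_1_m3: "mat 1 = m3 1 0 0 0 1 0 0 0 1"
  by (simp add: vec_eq_iff forall_3 mat_def)

lemma zero_m3: "0 = m3 0 0 0 0 0 0 0 0 0"
  by (simp add: vec_eq_iff forall_3)

lemma nilp_m3I: "m3 a b c d e f g h i ** m3 a b c d e f g h i ** m3 a b c d e f g h i = m3 0 0 0 0 0 0 0 0 0 \<Longrightarrow>
   nilp (m3 a b c d e f g h i)"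
  unfolding nilp_def by (intro exI[of _ 3]) (simp add: numeral_3_eq_3 matrix_mul_assoc zero_m3 del: m3_mult)

lemma Yc_simps [simp]: "Yc 1 A = fst A" "Yc (Suc 0) A = fst A" "Yc 2 A = fst (snd A)" "Yc 3 A = snd (snd A)"
  by (simp_all add: Yc_def)

lemma subalg_agree:
  assumes "f \<in> subalg S" "u \<in> Nil3" "v \<in> Nil3" "\<And>s. s \<in> S \<Longrightarrow> s u = s v"
  shows "f u = f v"
  using assms(1) by induct (use assms(2-4) in \<open>auto simp: onN_def\<close>)

definition torus :: "(nat \<Rightarrow> nat) \<Rightarrow> 'a::field \<Rightarrow> 'a trip \<Rightarrow> 'a trip" where
  "torus e x A = (smat (x ^ e 1) (fst A), smat (x ^ e 2) (fst (snd A)), smat (x ^ e 3) (snd (snd A)))"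

lemma torus_Nil3: "A \<in> Nil3 \<Longrightarrow> torus e x A \<in> Nil3"
  by (simp add: Nil3_def torus_def nilp_smat)

lemma trword_torus:
  assumes "set w \<subseteq> {1, 2, 3}"
  shows "trword w (torus e x A) = x ^ sum_list (map e w) * trword w A"
proof -
  have "wprod w (torus e x A) = smat (x ^ sum_list (map e w)) (wprod w A)"
    using assms by (induct w) (auto simp: torus_def power_add mult_ac)
  then show ?thesis by (simp add: trace_smat)
qed

text \<open>Along the orbit of \<open>u\<close> under a one-parameter torus, an invariant generated by traces
  becomes a polynomial whose exponents lie in the semigroup generated by the weights of the
  traces that do not vanish at \<open>u\<close>.\<close>

lemma trw_not_in_subalg:
  fixes u :: "'a::field_char_0 trip" and e :: "nat \<Rightarrow> nat"
  assumes u: "u \<in> Nil3" and W: "\<forall>v\<in>insert w W. set v \<subseteq> {1, 2, 3}"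
    and G: "0 \<in> G" "\<And>a b. a \<in> G \<Longrightarrow> b \<in> G \<Longrightarrow> a + b \<in> G"
    and in_G: "\<And>v. v \<in> W \<Longrightarrow> trword v u = 0 \<or> sum_list (map e v) \<in> G"
    and w: "trword w u \<noteq> 0" "sum_list (map e w) \<notin> G"
  shows "(trw w :: 'a trip \<Rightarrow> 'a) \<notin> subalg (trw ` W)"
proof
  assume "(trw w :: 'a trip \<Rightarrow> 'a) \<in> subalg (trw ` W)"
  moreover have "\<exists>p. (\<forall>x. f (torus e x u) = poly p x) \<and> (\<forall>n. coeff p n \<noteq> 0 \<longrightarrow> n \<in> G)"
    if "f \<in> subalg (trw ` W)" for f :: "'a trip \<Rightarrow> 'a"
    using that
  proof induct
    case (sgen f)
    then obtain v where v: "v \<in> W" "f = trw v" by blast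
    have "\<forall>x. f (torus e x u) = poly (monom (trword v u) (sum_list (map e v))) x"
      using v W torus_Nil3[OF u] by (simp add: trw_def onN_def trword_torus poly_monom)
    moreover have "\<forall>n. coeff (monom (trword v u) (sum_list (map e v))) n \<noteq> 0 \<longrightarrow> n \<in> G"
      using in_G[OF v(1)] by auto
    ultimately show ?case by blast
  next
    case (sconst c)
    have "\<forall>x. onN (\<lambda>A. c) (torus e x u) = poly [:c:] x" by (simp add: onN_def torus_Nil3[OF u])
    moreover have "\<forall>n. coeff [:c:] n \<noteq> 0 \<longrightarrow> n \<in> G" using G(1) by (simp add: coeff_pCons split: nat.split)
    ultimately show ?case by blast
  next
    case (sadd f g)
    then obtain p q where pq: "\<forall>x. f (torus e x u) = poly p x" "\<forall>n. coeff p n \<noteq> 0 \<longrightarrow> n \<in> G"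
      "\<forall>x. g (torus e x u) = poly q x" "\<forall>n. coeff q n \<noteq> 0 \<longrightarrow> n \<in> G" by blast
    have "n \<in> G" if "coeff (p + q) n \<noteq> 0" for n
      using that pq(2,4) by (cases "coeff p n = 0") auto
    then show ?case using pq(1,3) by (intro exI[of _ "p + q"]) simp
  next
    case (smul f g)
    then obtain p q where pq: "\<forall>x. f (torus e x u) = poly p x" "\<forall>n. coeff p n \<noteq> 0 \<longrightarrow> n \<in> G"
      "\<forall>x. g (torus e x u) = poly q x" "\<forall>n. coeff q n \<noteq> 0 \<longrightarrow> n \<in> G" by blast
    have "n \<in> G" if "coeff (p * q) n \<noteq> 0" for n
    proof -
      have "(\<Sum>i\<le>n. coeff p i * coeff q (n - i)) \<noteq> 0" using that unfolding coeff_mult .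
      then obtain i where "i \<le> n" "coeff p i * coeff q (n - i) \<noteq> 0"
        using sum.neutral[of "{..n}" "\<lambda>i. coeff p i * coeff q (n - i)"] by auto
      then show ?thesis using pq G(2)[of i "n - i"] by auto
    qed
    then show ?case using pq by (intro exI[of _ "p * q"]) simp
  qed
  ultimately obtain p where p: "\<And>x. trw w (torus e x u) = poly p x" "\<And>n. coeff p n \<noteq> 0 \<longrightarrow> n \<in> G" by blast
  have "poly p x = poly (monom (trword w u) (sum_list (map e w))) x" for x
    using p(1)[of x, symmetric] W torus_Nil3[OF u] by (simp add: trw_def onN_def trword_torus poly_monom mult.commute)
  then have "p = monom (trword w u) (sum_list (map e w))" by (simp add: poly_eq_poly_eq_iff[symmetric] fun_eq_iff)
  then show False using p(2)[of "sum_list (map e w)"] w by simp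
qed

abbreviation P33_words :: "nat list set" where
  "P33_words \<equiv> S33_words \<union> P33'_words"

definition isolates :: "nat list \<Rightarrow> 'a::field trip \<Rightarrow> 'a trip \<Rightarrow> bool" where
  "isolates w u v \<longleftrightarrow> u \<in> Nil3 \<and> v \<in> Nil3 \<and> trword w u \<noteq> trword w v \<and>
     (\<forall>w'\<in>P33_words. w' = w \<or> trword w' u = trword w' v)"

text \<open>Most first points spell the word as a closed walk along matrix units, for instance E12,
  E23, E31 for \<open>[1, 2, 3]\<close>. If a shorter trace is then nonzero, the second point
  reproduces it while the word itself gets trace 0; otherwise the second point is zero. For the
  words of length 6, E21 - E32 is replaced by its negative, which affects only traces of odd degree
  in it, and those of degree 3 vanish.\<close>

lemma isolating_points:
  shows "isolates [1, 2] (m3 0 1 0 0 0 0 0 0 0, m3 0 0 0 1 0 0 0 0 0, m3 0 0 0 0 0 0 0 0 0)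
      ((m3 0 0 0 0 0 0 0 0 0, m3 0 0 0 0 0 0 0 0 0, m3 0 0 0 0 0 0 0 0 0) :: 'a::field_char_0 trip)"
    "isolates [1, 1, 2] (m3 0 1 0 0 0 1 0 0 0, m3 0 0 0 0 0 0 1 0 0, m3 0 0 0 0 0 0 0 0 0)
      ((m3 0 0 0 0 0 0 0 0 0, m3 0 0 0 0 0 0 0 0 0, m3 0 0 0 0 0 0 0 0 0) :: 'a::field_char_0 trip)"
    "isolates [1, 2, 2] (m3 0 0 0 0 0 0 1 0 0, m3 0 1 0 0 0 1 0 0 0, m3 0 0 0 0 0 0 0 0 0)
      ((m3 0 0 0 0 0 0 0 0 0, m3 0 0 0 0 0 0 0 0 0, m3 0 0 0 0 0 0 0 0 0) :: 'a::field_char_0 trip)"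
    "isolates [1, 1, 2, 2, 1, 2] (m3 0 1 0 0 0 1 0 0 0, m3 0 0 0 1 0 0 0 (-1) 0, m3 0 0 0 0 0 0 0 0 0)
      ((m3 0 1 0 0 0 1 0 0 0, m3 0 0 0 (-1) 0 0 0 1 0, m3 0 0 0 0 0 0 0 0 0) :: 'a::field_char_0 trip)"
    "isolates [1, 3] (m3 0 1 0 0 0 0 0 0 0, m3 0 0 0 0 0 0 0 0 0, m3 0 0 0 1 0 0 0 0 0)
      ((m3 0 0 0 0 0 0 0 0 0, m3 0 0 0 0 0 0 0 0 0, m3 0 0 0 0 0 0 0 0 0) :: 'a::field_char_0 trip)"
    "isolates [1, 1, 3] (m3 0 1 0 0 0 1 0 0 0, m3 0 0 0 0 0 0 0 0 0, m3 0 0 0 0 0 0 1 0 0)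
      ((m3 0 0 0 0 0 0 0 0 0, m3 0 0 0 0 0 0 0 0 0, m3 0 0 0 0 0 0 0 0 0) :: 'a::field_char_0 trip)"
    "isolates [1, 3, 3] (m3 0 0 0 0 0 0 1 0 0, m3 0 0 0 0 0 0 0 0 0, m3 0 1 0 0 0 1 0 0 0)
      ((m3 0 0 0 0 0 0 0 0 0, m3 0 0 0 0 0 0 0 0 0, m3 0 0 0 0 0 0 0 0 0) :: 'a::field_char_0 trip)"
    "isolates [1, 1, 3, 3, 1, 3] (m3 0 1 0 0 0 1 0 0 0, m3 0 0 0 0 0 0 0 0 0, m3 0 0 0 1 0 0 0 (-1) 0)
      ((m3 0 1 0 0 0 1 0 0 0, m3 0 0 0 0 0 0 0 0 0, m3 0 0 0 (-1) 0 0 0 1 0) :: 'a::field_char_0 trip)"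
    "isolates [2, 3] (m3 0 0 0 0 0 0 0 0 0, m3 0 1 0 0 0 0 0 0 0, m3 0 0 0 1 0 0 0 0 0)
      ((m3 0 0 0 0 0 0 0 0 0, m3 0 0 0 0 0 0 0 0 0, m3 0 0 0 0 0 0 0 0 0) :: 'a::field_char_0 trip)"
    "isolates [2, 2, 3] (m3 0 0 0 0 0 0 0 0 0, m3 0 1 0 0 0 1 0 0 0, m3 0 0 0 0 0 0 1 0 0)
      ((m3 0 0 0 0 0 0 0 0 0, m3 0 0 0 0 0 0 0 0 0, m3 0 0 0 0 0 0 0 0 0) :: 'a::field_char_0 trip)"
    "isolates [2, 3, 3] (m3 0 0 0 0 0 0 0 0 0, m3 0 0 0 0 0 0 1 0 0, m3 0 1 0 0 0 1 0 0 0)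
      ((m3 0 0 0 0 0 0 0 0 0, m3 0 0 0 0 0 0 0 0 0, m3 0 0 0 0 0 0 0 0 0) :: 'a::field_char_0 trip)"
    "isolates [2, 2, 3, 3, 2, 3] (m3 0 0 0 0 0 0 0 0 0, m3 0 1 0 0 0 1 0 0 0, m3 0 0 0 1 0 0 0 (-1) 0)
      ((m3 0 0 0 0 0 0 0 0 0, m3 0 1 0 0 0 1 0 0 0, m3 0 0 0 (-1) 0 0 0 1 0) :: 'a::field_char_0 trip)"
    "isolates [1, 2, 3] (m3 0 1 0 0 0 0 0 0 0, m3 0 0 0 0 0 1 0 0 0, m3 0 0 0 0 0 0 1 0 0)
      ((m3 0 0 0 0 0 0 0 0 0, m3 0 0 0 0 0 0 0 0 0, m3 0 0 0 0 0 0 0 0 0) :: 'a::field_char_0 trip)"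
    "isolates [1, 3, 2] (m3 0 1 0 0 0 0 0 0 0, m3 0 0 0 0 0 0 1 0 0, m3 0 0 0 0 0 1 0 0 0)
      ((m3 0 0 0 0 0 0 0 0 0, m3 0 0 0 0 0 0 0 0 0, m3 0 0 0 0 0 0 0 0 0) :: 'a::field_char_0 trip)"
    "isolates [1, 1, 2, 3] (m3 0 1 0 0 0 1 0 0 0, m3 0 0 0 0 0 0 0 1 0, m3 0 0 0 1 0 0 0 0 0)
      ((m3 0 1 0 0 0 0 0 0 0, m3 0 0 0 1 0 0 0 0 0, m3 0 0 0 1 0 0 0 0 0) :: 'a::field_char_0 trip)"
    "isolates [1, 1, 3, 2] (m3 0 1 0 0 0 1 0 0 0, m3 0 0 0 1 0 0 0 0 0, m3 0 0 0 0 0 0 0 1 0)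
      ((m3 0 1 0 0 0 0 0 0 0, m3 0 0 0 1 0 0 0 0 0, m3 0 0 0 1 0 0 0 0 0) :: 'a::field_char_0 trip)"
    "isolates [2, 2, 1, 3] (m3 0 0 0 0 0 0 0 1 0, m3 0 1 0 0 0 1 0 0 0, m3 0 0 0 1 0 0 0 0 0)
      ((m3 0 0 0 1 0 0 0 0 0, m3 0 1 0 0 0 0 0 0 0, m3 0 0 0 1 0 0 0 0 0) :: 'a::field_char_0 trip)"
    "isolates [2, 2, 3, 1] (m3 0 0 0 1 0 0 0 0 0, m3 0 1 0 0 0 1 0 0 0, m3 0 0 0 0 0 0 0 1 0)
      ((m3 0 0 0 1 0 0 0 0 0, m3 0 1 0 0 0 0 0 0 0, m3 0 0 0 1 0 0 0 0 0) :: 'a::field_char_0 trip)"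
    "isolates [3, 3, 1, 2] (m3 0 0 0 0 0 0 0 1 0, m3 0 0 0 1 0 0 0 0 0, m3 0 1 0 0 0 1 0 0 0)
      ((m3 0 0 0 1 0 0 0 0 0, m3 0 0 0 1 0 0 0 0 0, m3 0 1 0 0 0 0 0 0 0) :: 'a::field_char_0 trip)"
    "isolates [3, 3, 2, 1] (m3 0 0 0 1 0 0 0 0 0, m3 0 0 0 0 0 0 0 1 0, m3 0 1 0 0 0 1 0 0 0)
      ((m3 0 0 0 1 0 0 0 0 0, m3 0 0 0 1 0 0 0 0 0, m3 0 1 0 0 0 0 0 0 0) :: 'a::field_char_0 trip)"
    "isolates [1, 1, 2, 1, 3] (m3 0 1 0 0 0 1 0 0 0, m3 0 0 0 0 0 0 1 0 0, m3 0 0 0 1 0 0 0 0 0)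
      ((m3 0 1 0 0 0 1 0 0 0, m3 0 0 0 0 0 0 1 0 0, m3 0 0 0 0 0 0 0 1 0) :: 'a::field_char_0 trip)"
    "isolates [2, 2, 1, 2, 3] (m3 0 0 0 0 0 0 1 0 0, m3 0 1 0 0 0 1 0 0 0, m3 0 0 0 1 0 0 0 0 0)
      ((m3 0 0 0 0 0 0 1 0 0, m3 0 1 0 0 0 1 0 0 0, m3 0 0 0 0 0 0 0 1 0) :: 'a::field_char_0 trip)"
    "isolates [3, 3, 1, 3, 2] (m3 0 0 0 0 0 0 1 0 0, m3 0 0 0 1 0 0 0 0 0, m3 0 1 0 0 0 1 0 0 0)
      ((m3 0 0 0 0 0 0 1 0 0, m3 0 0 0 0 0 0 0 1 0, m3 0 1 0 0 0 1 0 0 0) :: 'a::field_char_0 trip)"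
  by (simp_all add: isolates_def S33_words_eq P33'_words_eq Nil3_def nilp_m3I mat_1_m3)

text \<open>With \<open>J = E12 + E23\<close> and \<open>K = E21 - E32\<close>, the plane spanned by \<open>J\<close> and \<open>K\<close> consists of
  nilpotent matrices, so the traces of degree at most 3 in \<open>J\<close> and \<open>K\<close> vanish.  Scaling \<open>J\<close>
  by a cube root of unity preserves the trace of degree 6.\<close>

lemma isolating_points_square:
  fixes t :: "'a::field_char_0"
  assumes [simp]: "t * t \<noteq> 1" "t * t * t = 1" "t * (t * t) = 1"
  shows "isolates [1, 1, 2, 2] (m3 0 1 0 0 0 1 0 0 0, m3 0 0 0 1 0 0 0 (-1) 0, m3 0 0 0 0 0 0 0 0 0)
      (m3 0 t 0 0 0 t 0 0 0, m3 0 0 0 1 0 0 0 (-1) 0, m3 0 0 0 0 0 0 0 0 0)"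
    "isolates [1, 1, 3, 3] (m3 0 1 0 0 0 1 0 0 0, m3 0 0 0 0 0 0 0 0 0, m3 0 0 0 1 0 0 0 (-1) 0)
      (m3 0 t 0 0 0 t 0 0 0, m3 0 0 0 0 0 0 0 0 0, m3 0 0 0 1 0 0 0 (-1) 0)"
    "isolates [2, 2, 3, 3] (m3 0 0 0 0 0 0 0 0 0, m3 0 1 0 0 0 1 0 0 0, m3 0 0 0 1 0 0 0 (-1) 0)
      (m3 0 0 0 0 0 0 0 0 0, m3 0 t 0 0 0 t 0 0 0, m3 0 0 0 1 0 0 0 (-1) 0)"
  by (simp_all add: isolates_def S33_words_eq P33'_words_eq Nil3_def nilp_m3I mat_1_m3)

definition tri_weight :: "nat \<Rightarrow> nat \<Rightarrow> nat \<Rightarrow> nat \<Rightarrow> nat" where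
  "tri_weight a b c k = (if k = 1 then a else if k = 2 then b else c)"

lemma P33_words_letters: "w \<in> P33_words \<Longrightarrow> set w \<subseteq> {1, 2, 3}"
proof -
  have "\<forall>w\<in>P33_words. set w \<subseteq> {1, 2, 3}" unfolding S33_words_eq P33'_words_eq by simp
  then show "w \<in> P33_words \<Longrightarrow> set w \<subseteq> {1, 2, 3}" by blast
qed

lemma P33_trw_not_in_subalg:
  fixes u :: "'a::field_char_0 trip" and e :: "nat \<Rightarrow> nat"
  assumes "u \<in> Nil3" "w \<in> P33_words" "trword w u \<noteq> 0" "sum_list (map e w) \<notin> G" "0 \<in> G"
    and "\<forall>a\<in>G. \<forall>b\<in>G. a + b \<in> G"
    and "\<forall>v\<in>P33_words. v = w \<or> trword v u = 0 \<or> sum_list (map e v) \<in> G"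
  shows "(trw w :: 'a trip \<Rightarrow> 'a) \<notin> subalg (trw ` (P33_words - {w}))"
  using assms P33_words_letters by (intro trw_not_in_subalg[where e = e and G = G and u = u]) blast+

text \<open>Two nonzero members of this exponent set add up to at least 8, so it is a semigroup that
  omits 7. It remains to find weights that give the word weight 7 and keep all other nonvanishing
  traces in the set.\<close>

lemma P33'_not_in_subalg_7:
  fixes u :: "'a::field_char_0 trip" and e :: "nat \<Rightarrow> nat"
  assumes "u \<in> Nil3" "w \<in> P33_words" "trword w u \<noteq> 0" "sum_list (map e w) = 7"
    and "\<forall>v\<in>P33_words. v = w \<or> trword v u = 0 \<or> 4 \<le> sum_list (map e v) \<and> sum_list (map e v) \<noteq> 7"
  shows "(trw w :: 'a trip \<Rightarrow> 'a) \<notin> subalg (trw ` (P33_words - {w}))"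
  by (rule P33_trw_not_in_subalg[OF assms(1-3), where e = e and G = "{n. n = 0 \<or> 4 \<le> n \<and> n \<noteq> 7}"])
    (use assms(4,5) in auto)

lemma P33'_not_in_subalg:
  assumes "w \<in> P33'_words"
  shows "(trw w :: 'a::field_char_0 trip \<Rightarrow> 'a) \<notin> subalg (trw ` (P33_words - {w}))"
proof -
  note seven = P33'_not_in_subalg_7[where 'a = 'a]
  note eval = S33_words_eq P33'_words_eq Nil3_def nilp_m3I mat_1_m3 tri_weight_def
  \<comment> \<open>With J = E12 + E23 and K = E21 - E32, the trace of J^2 K^2 E is minus the (1,1)
    entry of E. The competing words of length 5 and weight 7 read off the entries (3,1), (1,3),
    (3,3), which are 0 here. E is the column (1,1,0) times the row (1,-1,0) and has square zero, so
    tr(J E^2) and tr(K E^2), also of weight 7, vanish.\<close>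
  have w0: "(trw [1, 1, 2, 2, 3] :: 'a trip \<Rightarrow> 'a) \<notin> subalg (trw ` (P33_words - {[1, 1, 2, 2, 3]}))"
    by (rule seven[where e = "tri_weight 1 1 3" and u = "(m3 0 1 0 0 0 1 0 0 0, m3 0 0 0 1 0 0 0 (-1) 0, m3 1 (-1) 0 1 (-1) 0 0 0 0)"])
      (simp_all add: eval)
  \<comment> \<open>At J, K, K a nonzero trace has as many J as K, because a diagonal conjugation
    scales J by s and K by 1/s, and tr(JK) = 0. The weights 2 and 3 for the two copies of K then
    give 7 only as 2 + 2 + 3.\<close>
  have w1: "(trw [1, 1, 2, 2, 1, 3] :: 'a trip \<Rightarrow> 'a) \<notin> subalg (trw ` (P33_words - {[1, 1, 2, 2, 1, 3]}))"
    by (rule seven[where e = "tri_weight 0 2 3" and u = "(m3 0 1 0 0 0 1 0 0 0, m3 0 0 0 1 0 0 0 (-1) 0, m3 0 0 0 1 0 0 0 (-1) 0)"])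
      (simp_all add: eval)
  have w2: "(trw [1, 1, 3, 3, 2] :: 'a trip \<Rightarrow> 'a) \<notin> subalg (trw ` (P33_words - {[1, 1, 3, 3, 2]}))"
    by (rule seven[where e = "tri_weight 1 3 1" and u = "(m3 0 1 0 0 0 1 0 0 0, m3 1 (-1) 0 1 (-1) 0 0 0 0, m3 0 0 0 1 0 0 0 (-1) 0)"])
      (simp_all add: eval)
  have w3: "(trw [1, 1, 3, 3, 1, 2] :: 'a trip \<Rightarrow> 'a) \<notin> subalg (trw ` (P33_words - {[1, 1, 3, 3, 1, 2]}))"
    by (rule seven[where e = "tri_weight 0 3 2" and u = "(m3 0 1 0 0 0 1 0 0 0, m3 0 0 0 1 0 0 0 (-1) 0, m3 0 0 0 1 0 0 0 (-1) 0)"])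
      (simp_all add: eval)
  have w4: "(trw [2, 2, 1, 1, 3] :: 'a trip \<Rightarrow> 'a) \<notin> subalg (trw ` (P33_words - {[2, 2, 1, 1, 3]}))"
    by (rule seven[where e = "tri_weight 1 1 3" and u = "(m3 0 0 0 1 0 0 0 (-1) 0, m3 0 1 0 0 0 1 0 0 0, m3 1 (-1) 0 1 (-1) 0 0 0 0)"])
      (simp_all add: eval)
  have w5: "(trw [2, 2, 1, 1, 2, 3] :: 'a trip \<Rightarrow> 'a) \<notin> subalg (trw ` (P33_words - {[2, 2, 1, 1, 2, 3]}))"
    by (rule seven[where e = "tri_weight 0 2 1" and u = "(m3 0 0 0 1 0 0 0 (-1) 0, m3 0 1 0 0 0 1 0 0 0, m3 0 0 0 1 0 0 0 (-1) 0)"])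
      (simp_all add: eval)
  have w6: "(trw [2, 2, 3, 3, 1] :: 'a trip \<Rightarrow> 'a) \<notin> subalg (trw ` (P33_words - {[2, 2, 3, 3, 1]}))"
    by (rule seven[where e = "tri_weight 3 1 1" and u = "(m3 1 (-1) 0 1 (-1) 0 0 0 0, m3 0 1 0 0 0 1 0 0 0, m3 0 0 0 1 0 0 0 (-1) 0)"])
      (simp_all add: eval)
  have w7: "(trw [2, 2, 3, 3, 2, 1] :: 'a trip \<Rightarrow> 'a) \<notin> subalg (trw ` (P33_words - {[2, 2, 3, 3, 2, 1]}))"
    by (rule seven[where e = "tri_weight 1 2 0" and u = "(m3 0 0 0 1 0 0 0 (-1) 0, m3 0 1 0 0 0 1 0 0 0, m3 0 0 0 1 0 0 0 (-1) 0)"])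
      (simp_all add: eval)
  have w8: "(trw [3, 3, 1, 1, 2] :: 'a trip \<Rightarrow> 'a) \<notin> subalg (trw ` (P33_words - {[3, 3, 1, 1, 2]}))"
    by (rule seven[where e = "tri_weight 1 3 1" and u = "(m3 0 0 0 1 0 0 0 (-1) 0, m3 1 (-1) 0 1 (-1) 0 0 0 0, m3 0 1 0 0 0 1 0 0 0)"])
      (simp_all add: eval)
  have w9: "(trw [3, 3, 1, 1, 3, 2] :: 'a trip \<Rightarrow> 'a) \<notin> subalg (trw ` (P33_words - {[3, 3, 1, 1, 3, 2]}))"
    by (rule seven[where e = "tri_weight 0 1 2" and u = "(m3 0 0 0 1 0 0 0 (-1) 0, m3 0 0 0 1 0 0 0 (-1) 0, m3 0 1 0 0 0 1 0 0 0)"])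
      (simp_all add: eval)
  have w10: "(trw [3, 3, 2, 2, 1] :: 'a trip \<Rightarrow> 'a) \<notin> subalg (trw ` (P33_words - {[3, 3, 2, 2, 1]}))"
    by (rule seven[where e = "tri_weight 3 1 1" and u = "(m3 1 (-1) 0 1 (-1) 0 0 0 0, m3 0 0 0 1 0 0 0 (-1) 0, m3 0 1 0 0 0 1 0 0 0)"])
      (simp_all add: eval)
  have w11: "(trw [3, 3, 2, 2, 3, 1] :: 'a trip \<Rightarrow> 'a) \<notin> subalg (trw ` (P33_words - {[3, 3, 2, 2, 3, 1]}))"
    by (rule seven[where e = "tri_weight 1 0 2" and u = "(m3 0 0 0 1 0 0 0 (-1) 0, m3 0 0 0 1 0 0 0 (-1) 0, m3 0 1 0 0 0 1 0 0 0)"])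
      (simp_all add: eval)
  \<comment> \<open>At J, K, J + K only traces of degree 4 and 6 survive: after expansion a nonzero
    word has equally many J and K, and tr(JK) = 0. The set holds their weights other than 34; the
    least nonzero one is 16 and the next is 20, so sums give 32 or at least 36, never 34.\<close>
  let ?G = "{0, 16, 20, 22, 24, 26, 28, 30, 32} \<union> {34<..} :: nat set"
  have "\<forall>a\<in>?G. \<forall>b\<in>?G. a + b \<in> ?G" by auto
  then have w12: "(trw [1, 1, 2, 2, 3, 3] :: 'a trip \<Rightarrow> 'a) \<notin> subalg (trw ` (P33_words - {[1, 1, 2, 2, 3, 3]}))"
    by (intro P33_trw_not_in_subalg[where G = ?G and e = "tri_weight 3 5 9" and u = "(m3 0 1 0 0 0 1 0 0 0, m3 0 0 0 1 0 0 0 (-1) 0, m3 0 1 0 1 0 1 0 (-1) 0)"])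
      (simp_all add: eval)
  show ?thesis using assms[unfolded P33'_words_eq]
    by (elim insertE emptyE; hypsubst; intro w0 w1 w2 w3 w4 w5 w6 w7 w8 w9 w10 w11 w12)
qed

lemma exists_isolating_points:
  assumes "alg_closed TYPE('a::field_char_0)" "w \<in> S33_words"
  shows "\<exists>u v :: 'a trip. isolates w u v"
proof -
  \<comment> \<open>A root of 1 + x + x^2 is a primitive cube root of unity; in characteristic zero
    it differs from 1.\<close>
  obtain t :: 'a where "poly [:1, 1, 1:] t = 0"
    using assms(1)[unfolded alg_closed_def, rule_format, of "[:1, 1, 1:]"] by auto
  then have t: "t * t = - 1 - t" by (simp add: algebra_simps eq_neg_iff_add_eq_0)
  then have t3: "t * t * t = 1" by algebra
  have t1: "t * t \<noteq> 1"
  proof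
    assume "t * t = 1"
    then have "t = 1" using t3 by simp
    then show False using t by simp
  qed
  have t3': "t * (t * t) = 1" using t3 by (simp only: mult.assoc)
  show ?thesis
    using assms(2)[unfolded S33_words_eq]
    by (elim insertE emptyE)
      (hypsubst, intro exI, rule isolating_points isolating_points_square[OF t1 t3 t3'])+
qed

lemma isolates_not_in_subalg:
  fixes u v :: "'a::field trip"
  assumes "isolates w u v"
  shows "(trw w :: 'a trip \<Rightarrow> 'a) \<notin> subalg (trw ` (P33_words - {w}))"
proof
  assume "(trw w :: 'a trip \<Rightarrow> 'a) \<in> subalg (trw ` (P33_words - {w}))"
  then have "trw w u = trw w v"
    by (rule subalg_agree) (use assms in \<open>auto simp: isolates_def trw_def onN_def\<close>)
  then show False using assms by (simp add: isolates_def trw_def onN_def)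
qed

text \<open>Reduces both minimality claims to the sets obtained by deleting a single word.\<close>

lemma proper_subset_image:
  assumes "T \<subset> f ` W"
  obtains w where "w \<in> W" "T \<subseteq> f ` (W - {w})"
proof -
  obtain w where w: "w \<in> W" "f w \<notin> T" using assms by blast
  have "T \<subseteq> f ` (W - {w})"
  proof
    fix t assume t: "t \<in> T"
    then obtain w' where "w' \<in> W" "t = f w'" using assms by blast
    then show "t \<in> f ` (W - {w})" using w(2) t by (cases "w' = w") simp_all
  qed
  with w(1) show thesis by (rule that)
qed

lemma subalg_mono: "S \<subseteq> T \<Longrightarrow> subalg S \<subseteq> subalg T"
proof
  fix f assume "S \<subseteq> T" "f \<in> subalg S"
  from this(2,1) show "f \<in> subalg T"
    by induct (auto intro: subalg.intros)
qed

theorem min_generating_P33: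
  assumes "alg_closed TYPE('a::field_char_0)"
  shows "min_generating (P33 :: ('a trip \<Rightarrow> 'a) set)"
  unfolding min_generating_def
proof (intro conjI allI impI notI generating_P33)
  fix T :: "('a trip \<Rightarrow> 'a) set"
  assume "T \<subset> P33" "generating T"
  then have "T \<subset> trw ` P33_words" by (simp add: P33_def)
  then obtain w where w: "w \<in> P33_words" "T \<subseteq> trw ` (P33_words - {w})"
    by (rule proper_subset_image)
  have "(trw w :: 'a trip \<Rightarrow> 'a) \<notin> subalg (trw ` (P33_words - {w}))"
  proof (cases "w \<in> S33_words")
    case True
    then obtain u v :: "'a trip" where "isolates w u v" using exists_isolating_points[OF assms] by blast
    then show ?thesis by (rule isolates_not_in_subalg)
  next
    case False
    then show ?thesis using w(1) by (intro P33'_not_in_subalg) simp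
  qed
  moreover have "trw w \<in> subalg T"
    using \<open>generating T\<close> trw_in_Inv[OF P33_words_letters[OF w(1)]] unfolding generating_def by simp
  ultimately show False using subalg_mono[OF w(2)] by (meson subsetD)
qed

lemma not_separating_proper_subset:
  assumes "alg_closed TYPE('a::field_char_0)" "T \<subset> (S33 :: ('a trip \<Rightarrow> 'a) set)"
  shows "\<not> separating T"
proof
  assume sep: "separating T"
  obtain w where w: "w \<in> S33_words" "T \<subseteq> trw ` (S33_words - {w})"
    using assms(2) unfolding S33_def by (rule proper_subset_image)
  obtain u v :: "'a trip" where uv: "isolates w u v" using exists_isolating_points[OF assms(1) w(1)] by blast
  then have "trw w u \<noteq> trw w v" "u \<in> Nil3" "v \<in> Nil3" by (auto simp: isolates_def trw_def onN_def)
  moreover have "trw w \<in> Inv" using w(1) by (intro trw_in_Inv P33_words_letters) blast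
  ultimately obtain f where "f \<in> T" "f u \<noteq> f v" using sep unfolding separating_def separated_by_def by blast
  then obtain w' where "w' \<in> S33_words" "w' \<noteq> w" "trw w' u \<noteq> trw w' v" using w(2) by blast
  then show False using uv by (auto simp: isolates_def trw_def onN_def)
qed

section \<open>Normal forms of pairs\<close>

definition J3 :: "'a::field mat3" where
  "J3 = m3 0 1 0 0 0 1 0 0 0"

lemma m3_eta: "m3 (M$1$1) (M$1$2) (M$1$3) (M$2$1) (M$2$2) (M$2$3) (M$3$1) (M$3$2) (M$3$3) = M"
  by (simp add: vec_eq_iff forall_3)

lemma m3_cases: obtains a b c d e f g h i where "M = m3 a b c d e f g h i"
  using m3_eta[of M, symmetric] by blast

lemma m3_eq_iff [simp]: "m3 a b c d e f g h i = m3 a' b' c' d' e' f' g' h' i' \<longleftrightarrow>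
    a = a' \<and> b = b' \<and> c = c' \<and> d = d' \<and> e = e' \<and> f = f' \<and> g = g' \<and> h = h' \<and> i = i'"
  by (auto simp: vec_eq_iff forall_3)

lemma nilp_m3:
  assumes "nilp (m3 a b c d e f g h i)"
  shows "a + e + i = (0::'a::field)" "a*e - b*d + a*i - c*g + e*i - f*h = 0"
    "a*e*i + b*f*g + c*d*h - a*f*h - b*d*i - c*e*g = 0"
  using nilp_traces[OF assms] by (simp_all add: minor_sum_def det_3 algebra_simps)

text \<open>The Jordan basis X^2 w, X w, w for a basis vector w with X^2 w nonzero. Independence
  follows by applying X repeatedly to a linear relation.\<close>

lemma regular_nilpotent_conj_J3:
  fixes X :: "'a::field mat3"
  assumes "nilp X" "X ** X \<noteq> 0"
  obtains g h where "(g, h) \<in> GL3" "g ** X ** h = J3"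
proof -
  have X3: "X ** X ** X = 0" using nilp_cube[OF assms(1)] .
  obtain r s where rs: "(X ** X) $ r $ s \<noteq> 0" using assms(2) by (auto simp: vec_eq_iff)
  define w where "w = (axis s 1 :: 'a^3)"
  define v1 where "v1 = X *v w"
  define v2 where "v2 = X *v v1"
  have "v2 $ r \<noteq> 0"
    using rs by (simp add: matrix_matrix_mult_def v2_def v1_def w_def matrix_vector_mul_assoc matrix_vector_mult_def axis_def
        if_distrib[where f = "(*) _"] cong: if_cong)
  have Xv2: "X *v v2 = 0"
    unfolding v2_def v1_def matrix_vector_mul_assoc matrix_mul_assoc X3 by simp
  define P :: "'a^3^3" where "P = (\<chi> i j. if j = 1 then v2 $ i else if j = 2 then v1 $ i else w $ i)"
  have ker: "c = 0" if "P *v c = 0" for c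
  proof -
    have zero: "a = 0" if "a *s v2 = 0" for a
      using that \<open>v2 $ r \<noteq> 0\<close> by (auto simp: vec_eq_iff)
    have e1: "c $ 1 *s v2 + c $ 2 *s v1 + c $ 3 *s w = 0"
      using that by (simp add: P_def vec_eq_iff matrix_vector_mult_def sum_3 mult.commute)
    from arg_cong[OF this, of "(*v) X"] have e2: "c $ 2 *s v2 + c $ 3 *s v1 = 0"
      by (simp add: matrix_vector_right_distrib vector_scalar_commute Xv2 v2_def[symmetric] v1_def[symmetric])
    from arg_cong[OF this, of "(*v) X"] have "c $ 3 *s v2 = 0"
      by (simp add: matrix_vector_right_distrib vector_scalar_commute Xv2 v2_def[symmetric])
    then have c3: "c $ 3 = 0" by (rule zero)
    then have c2: "c $ 2 = 0" using e2 by (intro zero) simp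
    then have "c $ 1 = 0" using e1 c3 by (intro zero) simp
    then show "c = 0" using c2 c3 by (simp add: vec_eq_iff forall_3)
  qed
  have "\<exists>B. B ** P = mat 1" unfolding matrix_left_invertible_ker using ker by simp
  then obtain B where B: "B ** P = mat 1" ..
  then have B': "P ** B = mat 1" using matrix_left_right_inverse[of P B] by simp
  have cols: "(\<Sum>k\<in>UNIV. X $ i $ k * v2 $ k) = 0" "(\<Sum>k\<in>UNIV. X $ i $ k * v1 $ k) = v2 $ i"
    "(\<Sum>k\<in>UNIV. X $ i $ k * w $ k) = v1 $ i" for i
    using arg_cong[OF Xv2, of "\<lambda>v. v $ i"] arg_cong[OF v2_def, of "\<lambda>v. v $ i"]
      arg_cong[OF v1_def, of "\<lambda>v. v $ i"]
    by (simp_all only: matrix_vector_mult_def vec_lambda_beta zero_index)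
  have "X ** P = P ** J3"
    unfolding mat3_eq_iff
  proof (intro allI)
    fix i j :: 3
    show "(X ** P) $ i $ j = (P ** J3) $ i $ j"
      using exhaust_3[of j] cols[of i, unfolded sum_3]
      by (elim disjE) (simp_all add: matrix_matrix_mult_def P_def J3_def sum_3)
  qed
  then have "B ** X ** P = J3"
    using matrix_mul_assoc[of B X P] matrix_mul_assoc[of B P J3] B by simp
  then show thesis using that[of B P] B B' by (simp add: GL3_def)
qed

lemma upper_unipotent_GL3:
  "(m3 1 s r 0 1 s 0 0 1, m3 1 (- s) (s * s - r) 0 1 (- s) 0 0 1) \<in> GL3"
  by (simp add: GL3_def mat_1_m3 algebra_simps)

lemma upper_unipotent_conj_J3:
  "m3 1 s r 0 1 s 0 0 1 ** J3 ** m3 1 (- s) (s * s - r) 0 1 (- s) 0 0 1 = J3"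
  by (simp add: J3_def algebra_simps)

text \<open>The matrices \<open>1 + s J + r J ^ 2\<close> commute with \<open>J\<close>; they bring a second nilpotent
  matrix to one of two normal forms unless it has a common flag with \<open>J\<close>.\<close>

lemma J3_pair_normal_form:
  fixes Y :: "'a::field mat3"
  assumes "nilp Y" "trace (J3 ** J3 ** Y) \<noteq> 0 \<or> trace (J3 ** J3 ** Y ** Y) \<noteq> 0"
  obtains g h p q r b t c where "(g, h) \<in> GL3" "g ** J3 ** h = J3"
      "g ** Y ** h = m3 p q r b (- p) t c 0 0" "c \<noteq> 0"
  | g h a e b f c where "(g, h) \<in> GL3" "g ** J3 ** h = J3"
      "g ** Y ** h = m3 a 0 e b (- a) f 0 c 0" "b \<noteq> 0" "c \<noteq> 0"
proof -
  obtain y11 y12 y13 y21 y22 y23 y31 y32 y33 where Y: "Y = m3 y11 y12 y13 y21 y22 y23 y31 y32 y33"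
    by (rule m3_cases)
  define M where "M s r = m3 1 s r 0 1 s 0 0 1 ** Y ** m3 1 (- s) (s * s - r) 0 1 (- s) 0 0 1" for s r
  have nilp: "nilp (M s r)" for s r
    unfolding M_def using upper_unipotent_GL3 assms(1) by (intro nilp_conj) (auto simp: GL3_def)
  have entries: "M s r $ 3 $ 1 = y31" "M s r $ 2 $ 1 = y21 + s * y31" "M s r $ 3 $ 2 = y32 - s * y31"
    "M s r $ 3 $ 3 = y33 - s * y32 + (s * s - r) * y31"
    "M s r $ 1 $ 2 = y12 + s * y22 + r * y32 - s * (y11 + s * y21 + r * y31)" for s r
    by (simp_all add: M_def Y algebra_simps)
  have tr: "M s r $ 2 $ 2 = - (M s r $ 1 $ 1 + M s r $ 3 $ 3)" for s r
  proof -
    have "M s r $ 1 $ 1 + M s r $ 2 $ 2 + M s r $ 3 $ 3 = 0"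
      using nilp_traces(1)[OF nilp[of s r]] by (simp add: trace_def sum_3)
    then show ?thesis by algebra
  qed
  have eta: "M s r = m3 (M s r$1$1) (M s r$1$2) (M s r$1$3) (M s r$2$1) (M s r$2$2) (M s r$2$3)
      (M s r$3$1) (M s r$3$2) (M s r$3$3)" for s r
    by (simp only: m3_eta)
  show thesis
  proof (cases "y31 = 0")
    case False
    define s r where "s = y32 / y31" and "r = y33 / y31"
    have "M s r $ 3 $ 2 = 0" "M s r $ 3 $ 3 = 0"
      unfolding entries using False by (simp_all add: s_def r_def field_simps)
    then have "M s r = m3 (M s r$1$1) (M s r$1$2) (M s r$1$3) (M s r$2$1) (- (M s r$1$1)) (M s r$2$3) y31 0 0"
      using eta[of s r] tr[of s r] entries(1)[of s r] by simp
    then show thesis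
      using that(1)[OF upper_unipotent_GL3 upper_unipotent_conj_J3] False unfolding M_def by blast
  next
    case True
    \<comment> \<open>With y31 = 0 the trace of J^2 Y vanishes and that of J^2 Y^2 is y32 *
      y21.\<close>
    then have ne: "y21 \<noteq> 0" "y32 \<noteq> 0" using assms(2) by (auto simp: Y J3_def)
    define s where "s = y33 / y32"
    define r where "r = - (y12 + s * y22 - s * (y11 + s * y21)) / y32"
    have r: "r * y32 = - (y12 + s * y22 - s * (y11 + s * y21))" using ne by (simp add: r_def)
    have "M s r $ 3 $ 3 = 0" "M s r $ 1 $ 2 = 0"
      unfolding entries r True using ne by (simp_all add: s_def)
    then have "M s r = m3 (M s r$1$1) 0 (M s r$1$3) y21 (- (M s r$1$1)) (M s r$2$3) 0 y32 0"
      using eta[of s r] tr[of s r] entries(1-3)[of s r] True by simp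
    then show thesis
      using that(2)[OF upper_unipotent_GL3 upper_unipotent_conj_J3] ne unfolding M_def by blast
  qed
qed

text \<open>The traces form a triangular system: they yield \<open>c\<close>, \<open>b\<close>,
  \<open>p\<close>, \<open>q\<close>, \<open>t\<close> in this order, each step dividing at most by
  powers of \<open>c\<close>. The vanishing sum of principal minors then gives
  \<open>r\<close>.\<close>

lemma normal_form_1_unique:
  fixes Y Y' :: "'a::field mat3"
  assumes Y: "Y = m3 p q r b (- p) t c 0 0" "Y' = m3 p' q' r' b' (- p') t' c' 0 0" "nilp Y" "nilp Y'" "c \<noteq> 0"
    and tr: "trace (J3 ** Y) = trace (J3 ** Y')" "trace (J3 ** J3 ** Y) = trace (J3 ** J3 ** Y')"
      "trace (J3 ** Y ** Y) = trace (J3 ** Y' ** Y')" "trace (J3 ** J3 ** Y ** Y) = trace (J3 ** J3 ** Y' ** Y')"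
      "trace (J3 ** J3 ** Y ** Y ** J3 ** Y) = trace (J3 ** J3 ** Y' ** Y' ** J3 ** Y')"
  shows "Y = Y'"
proof -
  have c: "c' = c" using tr(2) by (simp add: Y J3_def)
  have b: "b' = b" using tr(1) by (simp add: Y J3_def)
  have p: "p' = p" using tr(4) \<open>c \<noteq> 0\<close> by (simp add: Y J3_def c mult.commute)
  have q: "q' = q" using tr(5) \<open>c \<noteq> 0\<close> by (simp add: Y J3_def b c p algebra_simps)
  have t: "t' = t" using tr(3) \<open>c \<noteq> 0\<close> by (simp add: Y J3_def b c p q algebra_simps)
  have "p * p + q * b + r * c = 0" "p' * p' + q' * b' + r' * c' = 0"
    using nilp_m3(2)[OF Y(3)[unfolded Y(1)]] nilp_m3(2)[OF Y(4)[unfolded Y(2)]]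
    by (simp_all add: algebra_simps) algebra+
  then have "r' * c = r * c" by (simp add: b c p q) algebra
  then have "r' = r" using \<open>c \<noteq> 0\<close> by simp
  then show ?thesis by (simp add: Y b c p q t)
qed

text \<open>The sum and the product of \<open>b\<close> and \<open>c\<close> would leave their order
  open; the trace of degree 6 is b^2 c and, divided by the trace bc of J^2 Y^2, yields
  \<open>b\<close>. Then \<open>a\<close> comes from the trace of J Y^2, and \<open>f\<close> and
  \<open>e\<close> from the minor sum and the determinant.\<close>

lemma normal_form_2_unique:
  fixes Y Y' :: "'a::field mat3"
  assumes Y: "Y = m3 a 0 e b (- a) f 0 c 0" "Y' = m3 a' 0 e' b' (- a') f' 0 c' 0" "nilp Y" "nilp Y'"
      "b \<noteq> 0" "c \<noteq> 0"
    and tr: "trace (J3 ** Y) = trace (J3 ** Y')"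
      "trace (J3 ** Y ** Y) = trace (J3 ** Y' ** Y')" "trace (J3 ** J3 ** Y ** Y) = trace (J3 ** J3 ** Y' ** Y')"
      "trace (J3 ** J3 ** Y ** Y ** J3 ** Y) = trace (J3 ** J3 ** Y' ** Y' ** J3 ** Y')"
  shows "Y = Y'"
proof -
  have bc: "c * b = c' * b'" using tr(3) by (simp add: Y J3_def)
  have "(c * b) * b = (c' * b') * b'" using tr(4) by (simp add: Y J3_def)
  then have "(c * b) * b' = (c * b) * b" unfolding bc by (rule sym)
  then have b: "b' = b" using \<open>b \<noteq> 0\<close> \<open>c \<noteq> 0\<close> by simp
  then have c: "c' = c" using bc \<open>b \<noteq> 0\<close> by simp
  have a: "a' = a" using tr(2) \<open>b \<noteq> 0\<close> \<open>c \<noteq> 0\<close> by (simp add: Y J3_def b c)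
  have "f * c = - (a * a)" "f' * c' = - (a' * a')"
    using nilp_m3(2)[OF Y(3)[unfolded Y(1)]] nilp_m3(2)[OF Y(4)[unfolded Y(2)]]
    by (simp_all add: algebra_simps)
  then have f: "f' = f" using \<open>c \<noteq> 0\<close> by (metis a c mult_right_cancel)
  have ee: "e * (b * c) = a * f * c" "e' * (b' * c') = a' * f' * c'"
    using nilp_m3(3)[OF Y(3)[unfolded Y(1)]] nilp_m3(3)[OF Y(4)[unfolded Y(2)]] by (simp_all add: algebra_simps)
  have "e' * (b * c) = e * (b * c)" by (simp only: ee[unfolded a b c f])
  then have "e' = e" using \<open>b \<noteq> 0\<close> \<open>c \<noteq> 0\<close> by simp
  then show ?thesis by (simp add: Y a b c f)
qed

text \<open>All eight traces are linear in the third matrix; with trace zero as a ninth equation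
  they determine the nine entries one after another.\<close>

lemma third_matrix_unique_1:
  fixes Z Z' :: "'a::field mat3"
  assumes Y: "Y = m3 p q r b (- p) t c 0 0" "c \<noteq> 0" and Z: "nilp Z" "nilp Z'"
    and tr: "trace (J3 ** Z) = trace (J3 ** Z')" "trace (Y ** Z) = trace (Y ** Z')"
      "trace (J3 ** J3 ** Z) = trace (J3 ** J3 ** Z')" "trace (J3 ** Y ** Z) = trace (J3 ** Y ** Z')"
      "trace (Y ** J3 ** Z) = trace (Y ** J3 ** Z')" "trace (J3 ** J3 ** Y ** Z) = trace (J3 ** J3 ** Y ** Z')"
      "trace (Y ** J3 ** J3 ** Z) = trace (Y ** J3 ** J3 ** Z')"
      "trace (J3 ** J3 ** Y ** J3 ** Z) = trace (J3 ** J3 ** Y ** J3 ** Z')"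
  shows "Z = Z'"
proof -
  obtain z11 z12 z13 z21 z22 z23 z31 z32 z33 where zz: "Z = m3 z11 z12 z13 z21 z22 z23 z31 z32 z33"
    by (rule m3_cases)
  obtain w11 w12 w13 w21 w22 w23 w31 w32 w33 where ww: "Z' = m3 w11 w12 w13 w21 w22 w23 w31 w32 w33"
    by (rule m3_cases)
  note d = zz ww Y(1) J3_def
  have 1: "w31 = z31" using tr(3) by (simp add: d)
  have 2: "w11 = z11" using tr(6) Y(2) by (simp add: d 1)
  have 3: "w21 = z21" using tr(8) Y(2) by (simp add: d 1)
  have 4: "w32 = z32" using tr(1) by (simp add: d 3)
  have 5: "w33 = z33" using tr(7) Y(2) by (simp add: d 1 4)
  have 6: "w22 = z22" using nilp_m3(1)[OF Z(1)[unfolded zz]] nilp_m3(1)[OF Z(2)[unfolded ww]]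
    by (simp add: 2 5) (metis add.commute add_left_cancel)
  have 7: "w12 = z12" using tr(4) Y(2) by (simp add: d 1 2 3 6)
  have 8: "w23 = z23" using tr(5) Y(2) by (simp add: d 1 2 3 4 5 6)
  have 9: "w13 = z13" using tr(2) Y(2) by (simp add: d 1 2 3 4 5 6 7 8)
  show ?thesis by (simp add: zz ww 1 2 3 4 5 6 7 8 9)
qed

text \<open>The linear conditions on the third matrix leave a one-dimensional ambiguity exactly when
  \<open>b / c\<close> is a primitive sixth root of unity and \<open>a = 0\<close>; there the traces
  that are quadratic in the third matrix are needed.\<close>

lemma third_matrix_unique_2:
  fixes Z Z' :: "'a::field_char_0 mat3"
  assumes Y: "Y = m3 a 0 e b (- a) f 0 c 0" "b \<noteq> 0" "c \<noteq> 0" "nilp Y" and Z: "nilp Z" "nilp Z'"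
    and tr: "trace (J3 ** Z) = trace (J3 ** Z')" "trace (Y ** Z) = trace (Y ** Z')"
      "trace (J3 ** J3 ** Z) = trace (J3 ** J3 ** Z')" "trace (J3 ** Y ** Z) = trace (J3 ** Y ** Z')"
      "trace (Y ** J3 ** Z) = trace (Y ** J3 ** Z')" "trace (J3 ** J3 ** Y ** Z) = trace (J3 ** J3 ** Y ** Z')"
      "trace (Y ** Y ** Z) = trace (Y ** Y ** Z')" "trace (J3 ** Y ** Y ** Z) = trace (J3 ** Y ** Y ** Z')"
      "trace (Y ** Y ** J3 ** Z) = trace (Y ** Y ** J3 ** Z')"
    and quad: "trace (J3 ** Z ** Z) = trace (J3 ** Z' ** Z')" "trace (Y ** Z ** Z) = trace (Y ** Z' ** Z')"
      "trace (J3 ** J3 ** Z ** Z) = trace (J3 ** J3 ** Z' ** Z')"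
      "trace (Y ** Y ** Z ** Z) = trace (Y ** Y ** Z' ** Z')"
      "trace (J3 ** Y ** Z ** Z) = trace (J3 ** Y ** Z' ** Z')"
      "trace (Y ** J3 ** Z ** Z) = trace (Y ** J3 ** Z' ** Z')"
  shows "Z = Z'"
proof -
  obtain z11 z12 z13 z21 z22 z23 z31 z32 z33 where zz: "Z = m3 z11 z12 z13 z21 z22 z23 z31 z32 z33"
    by (rule m3_cases)
  obtain w11 w12 w13 w21 w22 w23 w31 w32 w33 where ww: "Z' = m3 w11 w12 w13 w21 w22 w23 w31 w32 w33"
    by (rule m3_cases)
  note d = zz ww Y(1) J3_def
  note nz = nilp_m3[OF Z(1)[unfolded zz]] and nw = nilp_m3[OF Z(2)[unfolded ww]]
  \<comment> \<open>The entries below the diagonal agree at once, and the differences above it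
    vanish as soon as the diagonal differences do. Everything reduces to
    \<open>u = 0\<close>.\<close>
  define x u v where "x = w11 - z11" and "u = w22 - z22" and "v = w33 - z33"
  have w: "w11 = z11 + x" "w22 = z22 + u" "w33 = z33 + v" by (simp_all add: x_def u_def v_def)
  have s0: "x + u + v = 0" using nz(1) nw(1) unfolding w by algebra
  have 31: "w31 = z31" using tr(3) by (simp add: d)
  have 21: "w21 = z21" using tr(6) Y(3) by (simp add: d)
  have 32: "w32 = z32" using tr(1) by (simp add: d 21)
  have l1: "b * x + c * u = 0" using tr(4) by (simp add: d 21 31 32 w algebra_simps)
  have l2: "b * u + c * v = 0" using tr(5) by (simp add: d 21 31 32 w algebra_simps)
  have ef: "f * c = - (a * a)" "e * (b * c) = a * f * c"
    using nilp_m3(2,3)[OF Y(4)[unfolded Y(1)]] by (simp_all add: algebra_simps)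
  have m12: "b * (w12 - z12) = a * u"
  proof -
    have "c * (b * (w12 - z12)) = c * (a * u)"
      using tr(8) by (simp add: d 21 31 32 w algebra_simps)
    then show ?thesis using Y(3) by simp
  qed
  have m23: "b * (w23 - z23) = a * v"
  proof -
    have "c * (b * (w23 - z23)) = c * (a * v)"
      using tr(9) by (simp add: d 21 31 32 w algebra_simps)
    then show ?thesis using Y(3) by simp
  qed
  have m13: "b * c * (w13 - z13) + a * a * (x - v) - a * c * (w23 - z23) = 0"
    using tr(7) ef by (simp add: d 21 31 32 w algebra_simps) algebra
  have u0: "u = 0"
  proof (rule ccontr)
    assume u: "u \<noteq> 0"
    \<comment> \<open>The trace relation multiplied by bc, with b x = - c u and c v = - b u
      inserted.\<close>
    have "u * (b * b + c * c - b * c) = 0" using s0 l1 l2 by algebra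
    then have q: "b * c = b * b + c * c" using u by simp
    have bc: "b + c \<noteq> 0"
    proof
      assume "b + c = 0"
      then have "3 * (c * c) = 0" using q by algebra
      then show False using Y(3) by simp
    qed
    have "a * (b + c) * u = 0"
    proof -
      have "a * x + b * (w12 - z12) - a * u + c * (w23 - z23) = 0"
        using tr(2) by (simp add: d 21 31 32 w algebra_simps)
      then have "b * (a * x + b * (w12 - z12) - a * u + c * (w23 - z23)) = 0" by simp
      then show ?thesis using m12 m23 l1 l2 by algebra
    qed
    then have a: "a = 0" using bc u by simp
    have f: "f = 0" and e: "e = 0" using ef Y(2,3) by (simp_all add: a)
    have 12: "w12 = z12" and 23: "w23 = z23" using m12 m23 Y(2) by (simp_all add: a)
    then have 13: "w13 = z13" using m13 Y(2,3) by (simp add: a)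
    note off = 12 13 21 23 31 32
    have q1: "b * x * (2 * z11 + x) + c * u * (2 * z22 + u) = 0"
      using quad(5) by (simp add: d a e f off w algebra_simps)
    have q2: "b * u * (2 * z22 + u) + c * v * (2 * z33 + v) = 0"
      using quad(6) by (simp add: d a e f off w algebra_simps)
    have "c * u * (2 * z11 + x - (2 * z22 + u)) = 0" using q1 l1 by algebra
    then have k1: "2 * z11 + x = 2 * z22 + u" using u Y(3) by simp
    have "b * u * (2 * z22 + u - (2 * z33 + v)) = 0" using q2 l2 by algebra
    then have k2: "2 * z22 + u = 2 * z33 + v" using u Y(2) by simp
    have "3 * (2 * z22 + u) = 0" using k1 k2 s0 nz(1) by algebra
    then have "2 * z22 + u = 0" unfolding mult_eq_0_iff by simp
    \<comment> \<open>The diagonal of \<open>Z'\<close> is thus the negative of that of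
      \<open>Z\<close>, while all other entries agree. The rest shows that the quadratic traces and
      nilpotency exclude this.\<close>
    then have k: "u = - 2 * z22" by algebra
    then have x: "x = - 2 * z11" and v: "v = - 2 * z33" using k1 k2 by algebra+
    have z22: "z22 \<noteq> 0" using u k by simp
    have t1: "b * z11 = - c * z22"
    proof -
      have "2 * (b * z11 + c * z22) = 0" using l1 unfolding x k by algebra
      then have "b * z11 + c * z22 = 0" unfolding mult_eq_0_iff by simp
      then show ?thesis by algebra
    qed
    have t3: "c * z33 = - b * z22"
    proof -
      have "2 * (c * z33 + b * z22) = 0" using l2 unfolding v k by algebra
      then have "c * z33 + b * z22 = 0" unfolding mult_eq_0_iff by simp
      then show ?thesis by algebra
    qed
    have z33: "z33 = - (z11 + z22)" using nz(1) by algebra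
    have "2 * (z31 * z22) = 0" using quad(3) by (simp add: d off w x v z33 algebra_simps)
    then have z31: "z31 = 0" using z22 by simp
    have "2 * (b * c * (z13 * z22)) = 0"
      using quad(4) by (simp add: d a e f off w x v z33 algebra_simps)
    then have z13: "z13 = 0" using z22 Y(2,3) by simp
    have "2 * (z21 * z33 + z32 * z11) = 0"
      using quad(1) nz(1) by (simp add: d off w x k v z31 algebra_simps) algebra
    then have p1: "z21 * z33 + z32 * z11 = 0" unfolding mult_eq_0_iff by simp
    have "2 * (b * z12 * z33 + c * z23 * z11) = 0"
      using quad(2) nz(1) by (simp add: d a e f off w x k v z13 algebra_simps) algebra
    then have p2: "b * z12 * z33 + c * z23 * z11 = 0" unfolding mult_eq_0_iff by simp
    have cube: "c * c * c = - (b * b * b)" using q by algebra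
    have "b * b * b * z22 * (z12 - z23) = 0" using p2 t1 t3 cube by algebra
    then have z12: "z12 = z23" using Y(2) z22 by simp
    have "b * b * c * c * (z12 * z21 + z23 * z32) = 0"
      using nz(1,2) t1 t3 q z13 by algebra
    then have off2: "z12 * z21 + z23 * z32 = 0" using Y(2,3) by simp
    then have p3: "z23 * (z21 + z32) = 0" by (simp add: z12 algebra_simps)
    have "c * (b * b * z21 + c * c * z32) * z22 = 0" using p1 t1 t3 by algebra
    then have p4: "b * b * z21 + c * c * z32 = 0" using Y(3) z22 by simp
    \<comment> \<open>Since z22 is nonzero, the vanishing determinant makes z23 and z32 nonzero.
      Then \<open>p3\<close> and \<open>p4\<close> force c = b, which contradicts b^2 + c^2 =
      bc.\<close>
    have p5: "z22 * z22 * z22 = z23 * z32 * (z11 - z33)"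
    proof -
      have "b * c * (z11 * z33 - z22 * z22) = 0" using t1 t3 by algebra
      then have "z11 * z33 = z22 * z22" using Y(2,3) by simp
      then show ?thesis using nz(3) off2 z13 z31 by algebra
    qed
    have "z23 \<noteq> 0" using p5 z22 by auto
    then have "z21 = - z32" using p3 by (simp add: eq_neg_iff_add_eq_0)
    then have "z32 * (c - b) * (c + b) = 0" using p4 by algebra
    moreover have "z32 \<noteq> 0" using p5 z22 by auto
    ultimately have "c = b" using bc by (simp add: add.commute)
    then have "b * b = 0" using q by simp
    then show False using Y(2) by simp
  qed
  have x0: "x = 0" using l1 u0 Y(2) by simp
  have v0: "v = 0" using s0 x0 u0 by simp
  have 12: "w12 = z12" and 23: "w23 = z23" using m12 m23 u0 v0 Y(2) by simp_all
  moreover from this have "w13 = z13" using m13 x0 v0 Y(2,3) by simp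
  ultimately show ?thesis by (simp add: zz ww w x0 u0 v0 21 31 32)
qed

section \<open>Separation\<close>

lemma zero_matrix_mult [simp]: "0 ** (X :: 'a::semiring_1^'n^'m) = 0" "(X :: 'a^'n^'m) ** 0 = 0"
  by (simp_all add: matrix_matrix_mult_def vec_eq_iff)

lemma trace_zero: "trace 0 = 0"
  by (simp add: trace_def)

text \<open>With X brought to J, the product J^2 Y^2 consists of the third row of Y^2 moved to the
  top. The two traces give y31 = 0 and y32 * y21 = 0, so Y is block triangular, and nilpotency of
  the blocks kills the rest of that row.\<close>

lemma squares_product_zero:
  fixes X Y :: "'a::field mat3"
  assumes "nilp X" "nilp Y" "trace (X ** X ** Y) = 0" "trace (X ** X ** Y ** Y) = 0"
  shows "X ** X ** Y ** Y = 0"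
proof (cases "X ** X = 0")
  case False
  obtain g h where gh: "(g, h) \<in> GL3" "g ** X ** h = J3"
    by (rule regular_nilpotent_conj_J3[OF assms(1) False])
  have hg: "h ** g = mat 1" and gh': "g ** h = mat 1" using gh(1) by (auto simp: GL3_def)
  define Y' where "Y' = g ** Y ** h"
  have X: "X = h ** J3 ** g" and Y: "Y = h ** Y' ** g"
    unfolding gh(2)[symmetric] Y'_def
    by (simp_all add: matrix_mul_assoc hg) (simp_all add: matrix_mul_assoc[symmetric] hg)
  have cancel: "A ** g ** h = A" for A :: "'a mat3" by (simp add: gh' flip: matrix_mul_assoc)
  have tr: "trace (h ** A ** g) = trace A" for A
    using trace_mul_sym[of "h ** A" g] by (simp add: matrix_mul_assoc gh')
  have XXY: "X ** X ** Y = h ** (J3 ** J3 ** Y') ** g" "X ** X ** Y ** Y = h ** (J3 ** J3 ** Y' ** Y') ** g"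
    unfolding X Y by (simp_all add: matrix_mul_assoc cancel)
  have "nilp Y'" unfolding Y'_def by (rule nilp_conj[OF hg assms(2)])
  obtain y11 y12 y13 y21 y22 y23 y31 y32 y33 where y: "Y' = m3 y11 y12 y13 y21 y22 y23 y31 y32 y33"
    by (rule m3_cases)
  note n = nilp_m3[OF \<open>nilp Y'\<close>[unfolded y]]
  have "y31 = 0" using assms(3) unfolding XXY(1) tr by (simp add: y J3_def)
  moreover have "y32 * y21 = 0" using assms(4) unfolding XXY(2) tr by (simp add: y J3_def \<open>y31 = 0\<close>)
  then consider "y32 = 0" | "y21 = 0" by auto
  then have "y32 * (y22 + y33) = 0 \<and> y32 * y23 + y33 * y33 = 0"
  proof cases
    case 1
    have "y33 * y33 * y33 = 0" using n \<open>y31 = 0\<close> 1 by algebra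
    then show ?thesis using 1 by simp
  next
    case 2
    have "y11 * y11 * y11 = 0" using n \<open>y31 = 0\<close> 2 by algebra
    then have "y11 = 0" by simp
    then show ?thesis using n \<open>y31 = 0\<close> 2 by algebra
  qed
  ultimately have "J3 ** J3 ** Y' ** Y' = 0"
    using \<open>y32 * y21 = 0\<close> by (simp add: y J3_def zero_m3 algebra_simps)
  then show ?thesis unfolding XXY(2) by simp
qed simp

lemma Yc_nilp: "A \<in> Nil3 \<Longrightarrow> nilp (Yc i A)"
  by (auto simp: Nil3_def Yc_def)

lemma Inv_trword:
  assumes "\<And>f. f \<in> Inv \<Longrightarrow> f u = f v" "set w \<subseteq> {1, 2, 3}" "u \<in> Nil3" "v \<in> Nil3"
  shows "trword w u = trword w v"
  using assms(1)[OF trw_in_Inv[OF assms(2)]] assms(3,4) by (simp add: trw_def onN_def)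

text \<open>The passage to the new triple is recorded only through the values of invariants, which
  is all that separation requires.\<close>

lemma exists_normal_form:
  fixes u :: "'a::field trip"
  assumes u: "u \<in> Nil3" and ij: "{i, j} \<subseteq> {1, 2, 3}"
    and tr: "trword [i, i, j] u \<noteq> 0 \<or> trword [i, i, j, j] u \<noteq> 0"
  shows "\<exists>v\<in>Nil3. (\<forall>f\<in>Inv. f v = f u) \<and> Yc i v = J3 \<and>
    ((\<exists>p q r b t c. Yc j v = m3 p q r b (- p) t c 0 0 \<and> c \<noteq> 0) \<or>
     (\<exists>a e b f c. Yc j v = m3 a 0 e b (- a) f 0 c 0 \<and> b \<noteq> 0 \<and> c \<noteq> 0))"
proof -
  have "Yc i u ** Yc i u \<noteq> 0"
  proof
    assume "Yc i u ** Yc i u = 0"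
    then show False using tr by (simp add: matrix_mul_assoc trace_def)
  qed
  then obtain g h where gh: "(g, h) \<in> GL3" "g ** Yc i u ** h = J3"
    by (rule regular_nilpotent_conj_J3[OF Yc_nilp[OF u]])
  define u' where "u' = act g h u"
  have u': "u' \<in> Nil3" unfolding u'_def by (rule Nil3_act[OF gh(1) u])
  have inv: "f u' = f u" if "f \<in> Inv" for f unfolding u'_def by (rule InvD[OF that gh(1) u])
  have J: "Yc i u' = J3" using gh(2) by (simp add: u'_def act_eq_map3)
  have "trword [i, i, j] u' = trword [i, i, j] u" "trword [i, i, j, j] u' = trword [i, i, j, j] u"
    by (rule Inv_trword[OF inv]; use ij u u' in simp)+
  then have "trace (J3 ** J3 ** Yc j u') \<noteq> 0 \<or> trace (J3 ** J3 ** Yc j u' ** Yc j u') \<noteq> 0"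
    using tr by (simp add: J matrix_mul_assoc)
  then obtain g' h' where gh': "(g', h') \<in> GL3" "g' ** J3 ** h' = J3" and
    form: "(\<exists>p q r b t c. g' ** Yc j u' ** h' = m3 p q r b (- p) t c 0 0 \<and> c \<noteq> 0) \<or>
     (\<exists>a e b f c. g' ** Yc j u' ** h' = m3 a 0 e b (- a) f 0 c 0 \<and> b \<noteq> 0 \<and> c \<noteq> 0)"
    by (rule J3_pair_normal_form[OF Yc_nilp[OF u']]) blast+
  show ?thesis
  proof (intro bexI conjI ballI)
    show "act g' h' u' \<in> Nil3" by (rule Nil3_act[OF gh'(1) u'])
    show "f (act g' h' u') = f u" if "f \<in> Inv" for f using InvD[OF that gh'(1) u'] inv[OF that] by simp
  qed (use gh'(2) form J in \<open>simp_all add: act_eq_map3\<close>)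
qed

text \<open>Both triples are moved to normal form with the same J in position i. The traces then
  identify the second and the third matrices, so the normal forms coincide as triples.\<close>

lemma S33_separates_regular:
  fixes u v :: "'a::field_char_0 trip"
  assumes uv: "u \<in> Nil3" "v \<in> Nil3" and ijk: "{i, j, k} = {1, 2, 3}"
    and tr: "trword [i, i, j] u \<noteq> 0 \<or> trword [i, i, j, j] u \<noteq> 0"
    and agree: "\<And>w. set w \<subseteq> {1, 2, 3} \<Longrightarrow> length w \<le> 4 \<Longrightarrow> trword w u = trword w v"
      "trword [i, i, j, i, k] u = trword [i, i, j, i, k] v"
      "trword [i, i, j, j, i, j] u = trword [i, i, j, j, i, j] v"
    and "f \<in> Inv"
  shows "f u = f v"
proof -
  have sub: "{i, j} \<subseteq> {1, 2, 3}" "i \<in> {1, 2, 3}" "j \<in> {1, 2, 3}" "k \<in> {1, 2, 3}" using ijk by auto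
  obtain u' where u': "u' \<in> Nil3" "\<And>f. f \<in> Inv \<Longrightarrow> f u' = f u" "Yc i u' = J3" and
    fu: "(\<exists>p q r b t c. Yc j u' = m3 p q r b (- p) t c 0 0 \<and> c \<noteq> 0) \<or>
     (\<exists>a e b f c. Yc j u' = m3 a 0 e b (- a) f 0 c 0 \<and> b \<noteq> 0 \<and> c \<noteq> 0)"
    using exists_normal_form[OF uv(1) sub(1) tr] by blast
  have "trword [i, i, j] v \<noteq> 0 \<or> trword [i, i, j, j] v \<noteq> 0"
    using tr agree(1)[of "[i, i, j]"] agree(1)[of "[i, i, j, j]"] sub by auto
  then obtain v' where v': "v' \<in> Nil3" "\<And>f. f \<in> Inv \<Longrightarrow> f v' = f v" "Yc i v' = J3" and
    fv: "(\<exists>p q r b t c. Yc j v' = m3 p q r b (- p) t c 0 0 \<and> c \<noteq> 0) \<or>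
     (\<exists>a e b f c. Yc j v' = m3 a 0 e b (- a) f 0 c 0 \<and> b \<noteq> 0 \<and> c \<noteq> 0)"
    using exists_normal_form[OF uv(2) sub(1)] by blast
  define Y Z Y' Z' where "Y = Yc j u'" and "Z = Yc k u'" and "Y' = Yc j v'" and "Z' = Yc k v'"
  have nil: "nilp Y" "nilp Z" "nilp Y'" "nilp Z'"
    unfolding Y_def Z_def Y'_def Z'_def by (intro Yc_nilp u'(1) v'(1))+
  have eq: "trword w u' = trword w v'" if "set w \<subseteq> {i, j, k}" "trword w u = trword w v" for w
    using Inv_trword[OF u'(2) _ u'(1) uv(1), of w] Inv_trword[OF v'(2) _ v'(1) uv(2), of w] that
    unfolding ijk by simp
  have eq4: "trword w u' = trword w v'" if "set w \<subseteq> {i, j, k}" "length w \<le> 4" for w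
    using eq[OF that(1)] agree(1)[of w] that unfolding ijk by simp
  note defs = u'(3) v'(3) Y_def[symmetric] Z_def[symmetric] Y'_def[symmetric] Z'_def[symmetric] matrix_mul_assoc
  have pair: "trace (J3 ** Y) = trace (J3 ** Y')" "trace (J3 ** J3 ** Y) = trace (J3 ** J3 ** Y')"
      "trace (J3 ** Y ** Y) = trace (J3 ** Y' ** Y')" "trace (J3 ** J3 ** Y ** Y) = trace (J3 ** J3 ** Y' ** Y')"
    using eq4[of "[i, j]"] eq4[of "[i, i, j]"] eq4[of "[i, j, j]"] eq4[of "[i, i, j, j]"]
    by (simp_all add: defs)
  have pair6: "trace (J3 ** J3 ** Y ** Y ** J3 ** Y) = trace (J3 ** J3 ** Y' ** Y' ** J3 ** Y')"
    using eq[OF _ agree(3)] by (simp add: defs)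
  have third: "trace (J3 ** Z) = trace (J3 ** Z')" "trace (Y ** Z) = trace (Y' ** Z')"
      "trace (J3 ** J3 ** Z) = trace (J3 ** J3 ** Z')" "trace (J3 ** Y ** Z) = trace (J3 ** Y' ** Z')"
      "trace (Y ** J3 ** Z) = trace (Y' ** J3 ** Z')" "trace (J3 ** J3 ** Y ** Z) = trace (J3 ** J3 ** Y' ** Z')"
      "trace (Y ** J3 ** J3 ** Z) = trace (Y' ** J3 ** J3 ** Z')"
      "trace (Y ** Y ** Z) = trace (Y' ** Y' ** Z')" "trace (J3 ** Y ** Y ** Z) = trace (J3 ** Y' ** Y' ** Z')"
      "trace (Y ** Y ** J3 ** Z) = trace (Y' ** Y' ** J3 ** Z')"
    using eq4[of "[i, k]"] eq4[of "[j, k]"] eq4[of "[i, i, k]"] eq4[of "[i, j, k]"] eq4[of "[j, i, k]"]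
      eq4[of "[i, i, j, k]"] eq4[of "[j, i, i, k]"] eq4[of "[j, j, k]"] eq4[of "[i, j, j, k]"] eq4[of "[j, j, i, k]"]
    by (simp_all add: defs)
  have third5: "trace (J3 ** J3 ** Y ** J3 ** Z) = trace (J3 ** J3 ** Y' ** J3 ** Z')"
    using eq[OF _ agree(2)] by (simp add: defs)
  have quad: "trace (J3 ** Z ** Z) = trace (J3 ** Z' ** Z')" "trace (Y ** Z ** Z) = trace (Y' ** Z' ** Z')"
      "trace (J3 ** J3 ** Z ** Z) = trace (J3 ** J3 ** Z' ** Z')"
      "trace (Y ** Y ** Z ** Z) = trace (Y' ** Y' ** Z' ** Z')"
      "trace (J3 ** Y ** Z ** Z) = trace (J3 ** Y' ** Z' ** Z')"
      "trace (Y ** J3 ** Z ** Z) = trace (Y' ** J3 ** Z' ** Z')"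
    using eq4[of "[i, k, k]"] eq4[of "[j, k, k]"] eq4[of "[i, i, k, k]"] eq4[of "[j, j, k, k]"]
      eq4[of "[i, j, k, k]"] eq4[of "[j, i, k, k]"]
    by (simp_all add: defs)
  have "Y = Y' \<and> Z = Z'"
    using fu[folded Y_def]
  proof (elim disjE exE conjE)
    fix p q r b t c assume Y: "Y = m3 p q r b (- p) t c 0 0" "c \<noteq> 0"
    \<comment> \<open>The trace of J^2 Y is the (3,1) entry, which is \<open>c\<close> in the first
      normal form and 0 in the second. Hence the two triples have the same form.\<close>
    then have "trace (J3 ** J3 ** Y') \<noteq> 0" unfolding pair(2)[symmetric] by (simp add: J3_def)
    then obtain p' q' r' b' t' c' where Y': "Y' = m3 p' q' r' b' (- p') t' c' 0 0"
      using fv[folded Y'_def] by (auto simp: J3_def)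
    have YY: "Y = Y'" by (rule normal_form_1_unique[OF Y(1) Y' nil(1,3) Y(2) pair pair6])
    have "Z = Z'"
      by (rule third_matrix_unique_1[OF Y nil(2,4)]) (use third third5 in \<open>simp_all add: YY[symmetric]\<close>)
    with YY show ?thesis ..
  next
    fix a e b f c assume Y: "Y = m3 a 0 e b (- a) f 0 c 0" "b \<noteq> 0" "c \<noteq> 0"
    then have "trace (J3 ** J3 ** Y') = 0" unfolding pair(2)[symmetric] by (simp add: J3_def)
    then obtain a' e' b' f' c' where Y': "Y' = m3 a' 0 e' b' (- a') f' 0 c' 0"
      using fv[folded Y'_def] by (auto simp: J3_def)
    have YY: "Y = Y'" by (rule normal_form_2_unique[OF Y(1) Y' nil(1,3) Y(2,3) pair(1,3,4) pair6])
    have "Z = Z'"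
      by (rule third_matrix_unique_2[OF Y nil(1,2,4)]) (use third quad in \<open>simp_all add: YY[symmetric]\<close>)
    with YY show ?thesis ..
  qed
  then have "Yc l u' = Yc l v'" if "l \<in> {i, j, k}" for l
    using that u'(3) v'(3) by (auto simp: Y_def Z_def Y'_def Z'_def)
  then have "\<forall>l\<in>{1, 2, 3}. Yc l u' = Yc l v'" unfolding ijk by blast
  then have "u' = v'" by (simp add: prod_eq_iff)
  then show ?thesis using u'(2)[OF \<open>f \<in> Inv\<close>] v'(2)[OF \<open>f \<in> Inv\<close>] by simp
qed

text \<open>Functions taking the same value at two nilpotent triples form an algebra to which
  \<open>trword_in_algebra\<close> applies.\<close>

lemma agreement_algebra:
  fixes u v :: "'a::field_char_0 trip"
  assumes uv: "u \<in> Nil3" "v \<in> Nil3"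
    and gen: "\<And>w. w \<in> P33_words \<Longrightarrow> length w \<le> N \<Longrightarrow> trword w u = trword w v"
    and "length w \<le> N"
  shows "trword w u = trword w v"
  using trword_in_algebra[of "{t. t u = t v}" N w] assms by simp

text \<open>Supplies the orientations absent from \<open>S33\<close>, such as
  \<open>[1, 1, 3, 1, 2]\<close> and \<open>[2, 2, 1, 1, 2, 1]\<close>, so that the regular pair may
  be any ordered pair of letters.\<close>

lemma S33_agreement:
  fixes u v :: "'a::field_char_0 trip"
  assumes uv: "u \<in> Nil3" "v \<in> Nil3" and S: "\<And>w. w \<in> S33_words \<Longrightarrow> trword w u = trword w v"
  shows "length w \<le> 4 \<Longrightarrow> trword w u = trword w v"
    and "{i, j, k} = {1, 2, 3} \<Longrightarrow> trword [i, i, j, i, k] u = trword [i, i, j, i, k] v"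
    and "i \<in> {1, 2, 3} \<Longrightarrow> j \<in> {1, 2, 3} \<Longrightarrow> i \<noteq> j \<Longrightarrow>
      trword [i, i, j, j, i, j] u = trword [i, i, j, j, i, j] v"
proof -
  show four: "trword w u = trword w v" if "length w \<le> 4" for w
  proof (rule agreement_algebra[OF uv _ that])
    fix w assume w: "w \<in> P33_words" "length w \<le> 4"
    \<comment> \<open>The generators outside \<open>S33\<close> have length at least 5.\<close>
    have "\<forall>w\<in>P33'_words. \<not> length w \<le> 4" unfolding P33'_words_eq by simp
    then have "w \<notin> P33'_words" using w(2) by blast
    then show "trword w u = trword w v" using w(1) by (intro S) simp
  qed
  have swap5: "trword [i, i, k, i, j] u = trword [i, i, k, i, j] v"
    if "trword [i, i, j, i, k] u = trword [i, i, j, i, k] v" for i j k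
  proof -
    \<comment> \<open>In the polarized identity for i, i, j with trailing factor ik each word occurs
      twice: one is the given word, one a rotation of iikij, and one contains a cube.\<close>
    have "(\<lambda>A. trword ([i] @ [i] @ [j] @ [i, k]) A + trword ([i] @ [j] @ [i] @ [i, k]) A +
        trword ([i] @ [i] @ [j] @ [i, k]) A + trword ([i] @ [j] @ [i] @ [i, k]) A +
        trword ([j] @ [i] @ [i] @ [i, k]) A + trword ([j] @ [i] @ [i] @ [i, k]) A) \<in> {t. t u = t v}"
    proof (rule trword_identity)
      fix w :: "nat list" assume "length w < length ([i] @ [i] @ [j] @ [i, k])"
      then have l: "length w \<le> 4" by simp
      show "trword w \<in> {t. t u = t v}" using four[OF l] by simp
    qed simp_all
    then have rel: "trword [i, i, j, i, k] u + trword [i, j, i, i, k] u + trword [i, i, j, i, k] u +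
        trword [i, j, i, i, k] u + trword [j, i, i, i, k] u + trword [j, i, i, i, k] u =
      trword [i, i, j, i, k] v + trword [i, j, i, i, k] v + trword [i, i, j, i, k] v +
        trword [i, j, i, i, k] v + trword [j, i, i, i, k] v + trword [j, i, i, i, k] v"
      by (simp del: wprod_Cons)
    have rot: "trword [i, j, i, i, k] A = trword [i, i, k, i, j] A" for A :: "'a trip"
      using fun_cong[OF trword_rotate[of "[i, j]" "[i, i, k]"], of A] by (simp del: wprod_Cons)
    have zero: "trword [j, i, i, i, k] A = 0" if "A \<in> Nil3" for A :: "'a trip"
    proof -
      have "trword [j, i, i, i, k] A = trace (Yc j A ** (Yc i A ** Yc i A ** Yc i A) ** Yc k A)"
        by (simp add: matrix_mul_assoc)
      also have "\<dots> = 0" unfolding nilp_cube[OF Yc_nilp[OF that]] by (simp add: trace_zero)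
      finally show ?thesis .
    qed
    have "2 * y = 2 * y'" if "x + y + x + y + z + z = x' + y' + x' + y' + z' + z'" "x = x'" "z = 0" "z' = 0"
      for x y z x' y' z' :: 'a using that by algebra
    from this[OF rel that zero[OF uv(1)] zero[OF uv(2)]]
    have "2 * trword [i, i, k, i, j] u = 2 * trword [i, i, k, i, j] v" unfolding rot .
    then show ?thesis by simp
  qed
  show "trword [i, i, j, i, k] u = trword [i, i, j, i, k] v" if "{i, j, k} = {1, 2, 3}"
  proof -
    have "trword [1, 1, 2, 1, 3] u = trword [1, 1, 2, 1, 3] v" "trword [2, 2, 1, 2, 3] u = trword [2, 2, 1, 2, 3] v"
      "trword [3, 3, 1, 3, 2] u = trword [3, 3, 1, 3, 2] v"
      by (rule S; simp add: S33_words_eq)+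
    note six = this this[THEN swap5]
    show ?thesis
      using that[unfolded triple_perm_iff] by (elim insertE emptyE Pair_inject; hypsubst; intro six)
  qed
  have pair: "trword [i, i, j, j, i, j] u = trword [i, i, j, j, i, j] v \<and>
      trword [j, j, i, i, j, i] u = trword [j, j, i, i, j, i] v"
    if ij: "(i, j) \<in> {(1, 2), (1, 3), (2, 3)}" for i j
  proof -
    \<comment> \<open>The letters i, j are renamed to 1, 2 and the third matrix is set to 0. All
      generators involving 3 vanish, and those left belong to \<open>S33\<close>; so traces of
      length at most 6 agree in either order of the pair.\<close>
    define p :: "'a trip \<Rightarrow> 'a trip" where "p A = (Yc i A, Yc j A, 0)" for A
    have "nilp (0 :: 'a mat3)" unfolding nilp_def by (intro exI[of _ 1]) simp
    then have p: "p A \<in> Nil3" if "A \<in> Nil3" for A by (simp add: p_def Nil3_def Yc_nilp[OF that])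
    have "trword w (p u) = trword w (p v)" if "length w \<le> 6" for w
    proof (rule agreement_algebra[OF p[OF uv(1)] p[OF uv(2)] _ that])
      have gens: "trword [i, j] u = trword [i, j] v" "trword [i, i, j] u = trword [i, i, j] v"
        "trword [i, j, j] u = trword [i, j, j] v" "trword [i, i, j, j] u = trword [i, i, j, j] v"
        "trword [i, i, j, j, i, j] u = trword [i, i, j, j, i, j] v"
        by (rule S; use ij in \<open>elim insertE emptyE Pair_inject; simp add: S33_words_eq\<close>)+
      have "\<forall>w\<in>P33_words. trword w (p u) = trword w (p v)"
        unfolding S33_words_eq P33'_words_eq using gens by (simp add: p_def trace_zero)
      then show "trword w (p u) = trword w (p v)" if "w \<in> P33_words" for w using that by blast
    qed
    from this[of "[1, 1, 2, 2, 1, 2]"] this[of "[2, 2, 1, 1, 2, 1]"] show ?thesis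
      by (simp add: p_def)
  qed
  show "trword [i, i, j, j, i, j] u = trword [i, i, j, j, i, j] v"
    if "i \<in> {1, 2, 3}" "j \<in> {1, 2, 3}" "i \<noteq> j"
  proof -
    have "(i, j) \<in> {(1, 2), (1, 3), (2, 3)} \<or> (j, i) \<in> {(1, 2), (1, 3), (2, 3)}"
      using that by (elim insertE emptyE) simp_all
    then show ?thesis using pair by blast
  qed
qed

text \<open>Every word outside \<open>S33\<close> begins with iijj for distinct i, j, and by
  \<open>squares_product_zero\<close> this prefix is already the zero matrix.\<close>

lemma P33'_vanish:
  fixes u :: "'a::field trip"
  assumes u: "u \<in> Nil3" and w: "w \<in> P33'_words"
    and zero: "\<And>i j. i \<in> {1, 2, 3} \<Longrightarrow> j \<in> {1, 2, 3} \<Longrightarrow> i \<noteq> j \<Longrightarrow> trword [i, i, j] u = 0 \<and> trword [i, i, j, j] u = 0"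
  shows "trword w u = 0"
proof -
  have "Yc i u ** Yc i u ** Yc j u ** Yc j u = 0" if "i \<in> {1, 2, 3}" "j \<in> {1, 2, 3}" "i \<noteq> j" for i j
    using zero[OF that] Yc_nilp[OF u] by (intro squares_product_zero) (simp_all add: matrix_mul_assoc)
  then have "wprod (i # i # j # j # w) u = 0" if "i \<in> {1, 2, 3}" "j \<in> {1, 2, 3}" "i \<noteq> j" for i j w
    using that by (simp add: matrix_mul_assoc)
  then have "wprod w u = 0"
    using w unfolding P33'_words_eq by (elim insertE emptyE; hypsubst; simp del: wprod_Cons)
  then show ?thesis by (simp add: trace_def)
qed

theorem separating_S33: "separating (S33 :: ('a::field_char_0 trip \<Rightarrow> 'a) set)"
  unfolding separating_def
proof (intro conjI ballI impI)
  show "S33 \<subseteq> (Inv :: ('a trip \<Rightarrow> 'a) set)"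
    using P33_subset_Inv unfolding P33_def S33_def by blast
next
  fix u v :: "'a trip"
  assume uv: "u \<in> Nil3" "v \<in> Nil3" and sep: "separated_by Inv u v"
  show "separated_by S33 u v"
  proof (rule ccontr)
    assume "\<not> separated_by S33 u v"
    then have S: "trword w u = trword w v" if "w \<in> S33_words" for w
      using that uv unfolding separated_by_def S33_def by (auto simp: trw_def onN_def)
    have agree: "length w \<le> 4 \<Longrightarrow> trword w u = trword w v"
      "{i, j, k} = {1, 2, 3} \<Longrightarrow> trword [i, i, j, i, k] u = trword [i, i, j, i, k] v"
      "i \<in> {1, 2, 3} \<Longrightarrow> j \<in> {1, 2, 3} \<Longrightarrow> i \<noteq> j \<Longrightarrow>
        trword [i, i, j, j, i, j] u = trword [i, i, j, j, i, j] v" for w i j k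
      using S33_agreement[OF uv] S by blast+
    have "f u = f v" if "f \<in> Inv" for f
    proof (cases "\<exists>i\<in>{1, 2, 3}. \<exists>j\<in>{1, 2, 3}. i \<noteq> j \<and> (trword [i, i, j] u \<noteq> 0 \<or> trword [i, i, j, j] u \<noteq> 0)")
      case True
      then obtain i j where ij: "i \<in> {1, 2, 3}" "j \<in> {1, 2, 3}" "i \<noteq> j"
        and tr: "trword [i, i, j] u \<noteq> 0 \<or> trword [i, i, j, j] u \<noteq> 0" by blast
      obtain k where k: "{i, j, k} = {1, 2, 3::nat}"
      proof
        \<comment> \<open>The three letters sum to 6.\<close>
        show "{i, j, 6 - i - j} = {1, 2, 3}" using ij by (elim insertE emptyE) auto
      qed
      show ?thesis
        by (rule S33_separates_regular[OF uv k tr agree(1) agree(2)[OF k] agree(3)[OF ij] that])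
    next
      case False
      then have u0: "trword [i, i, j] u = 0 \<and> trword [i, i, j, j] u = 0"
        if "i \<in> {1, 2, 3}" "j \<in> {1, 2, 3}" "i \<noteq> j" for i j using that by blast
      have v0: "trword [i, i, j] v = 0 \<and> trword [i, i, j, j] v = 0"
        if "i \<in> {1, 2, 3}" "j \<in> {1, 2, 3}" "i \<noteq> j" for i j
        using u0[OF that] agree(1)[of "[i, i, j]"] agree(1)[of "[i, i, j, j]"] by simp
      have "trword w u = trword w v" if "w \<in> P33_words" for w
        using that S P33'_vanish[OF uv(1) _ u0] P33'_vanish[OF uv(2) _ v0] by auto
      then have "s u = s v" if "s \<in> P33" for s
        using that uv unfolding P33_def by (auto simp: trw_def onN_def)
      moreover have "f \<in> subalg P33" using that generating_P33 unfolding generating_def by blast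
      ultimately show ?thesis using subalg_agree[OF _ uv] by blast
    qed
    then show False using sep unfolding separated_by_def by blast
  qed
qed

theorem theorem3p2:
  assumes "alg_closed TYPE('a::field_char_0)"
  shows "min_generating (P33 :: ('a trip \<Rightarrow> 'a) set) \<and> min_separating (S33 :: ('a trip \<Rightarrow> 'a) set)"
  using min_generating_P33[OF assms] separating_S33 not_separating_proper_subset[OF assms]
  unfolding min_separating_def by blast

end
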